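(* Let $G$ be a locally compact abelian group with Haar measure $\mu$ and dual group $\widehat{G}$, and let $T: L^1(G)\to L^{\infty}(\widehat{G})$ be a linear and bounded operator. If $T$ satisfies the Fourier convolution property $$T(f\star_{\mathcal{F}} g) = T(f)\,T(g)\qquad\text{for all } f,g\in L^1(G),$$ then there exists a function $\theta_{\mathcal{F}}:\widehat{G}\to\widehat{G}\cup\{0\}$ such that $$T(f) = \mathcal{F}(f)\circ\theta_{\mathcal{F}}\qquad\text{for all } f\in L^1(G),$$ where $\theta_{\mathcal{F}}(\phi)=0$ if and only if $T(f)(\phi)=0$ for every $f\in L^1(G)$.
   Context: $L^1(G)$ is the usual space of complex-valued $\mu$-integrable functions on $G$, and $L^{\infty}(\widehat{G})$ is the usual $L^\infty$ space on the dual group $\widehat{G}$, with pointwise product; $T(f)(\phi)$ denotes the value of $T(f)$ at $\phi\in\widehat{G}$. The dual group $\widehat{G}$ is the group of continuous homomorphisms $\chi:G\to\{z\in\mathbb{C}:|z|=1\}$. The Fourier transform $\mathcal{F}:L^1(G)\to C_0(\widehat{G})$ is given by $\mathcal{F}(f)(\chi) := \int_G f(x)\overline{\chi(x)}\,d\mu(x)$ for $f\in L^1(G)$, $\chi\in\widehat{G}$. The Fourier convolution $\star_{\mathcal{F}}:L^1(G)\times L^1(G)\to L^1(G)$ is given by $(f\star_{\mathcal{F}} g)(x) := \int_G f(u)g(x-u)\,d\mu(u)$ for $f,g\in L^1(G)$, $x\in G$. The symbol $0$ in $\widehat{G}\cup\{0\}$ is the zero function on $G$, at which the formula for the Fourier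 transform gives $\mathcal{F}(f)(0)=0$. *)

theory Defs
  imports "HOL-Analysis.Analysis" "HOL-Probability.Essential_Supremum"
begin

text \<open>
  A Haar measure is a nonzero translation-invariant Radon measure on the Borel sets, where
  \<^emph>\<open>Radon\<close> means finite on compact sets and inner regular by compact sets on all Borel sets.
  The other common convention (outer regular on Borel sets, inner regular on open sets) agrees with
  this one on sigma-finite sets. It has the same space of integrable functions modulo null
  functions; on a group that is not sigma-finite its null sets may be fewer, and that convention
  defines the space of essentially bounded functions modulo \<^emph>\<open>locally\<close> null sets. For
  inner regular measures locally null Borel sets are null, so ``almost everywhere'' is the right
  notion for every group.
\<close>

definition haar_measure :: "'a::{topological_space, ab_group_add} measure \<Rightarrow> bool" where
  "haar_measure M \<longleftrightarrow>
     sets M = sets borel \<and>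
     emeasure M UNIV \<noteq> 0 \<and>
     (\<forall>K. compact K \<longrightarrow> emeasure M K < \<infinity>) \<and>
     (\<forall>A\<in>sets borel. emeasure M A = (SUP K\<in>{K. compact K \<and> K \<subseteq> A}. emeasure M K)) \<and>
     (\<forall>a. \<forall>A\<in>sets borel. emeasure M ((\<lambda>x. a + x) ` A) = emeasure M A)"

definition characters :: "('a::topological_ab_group_add \<Rightarrow> complex) set" where
  "characters = {\<xi>. continuous_on UNIV \<xi> \<and> (\<forall>x. norm (\<xi> x) = 1) \<and> (\<forall>x y. \<xi> (x + y) = \<xi> x * \<xi> y)}"

typedef (overloaded) ('a::topological_ab_group_add) dual = "characters :: ('a \<Rightarrow> complex) set"
  morphisms char_of Dual
  by (rule exI[of _ "\<lambda>_. 1"]) (simp add: characters_def)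

setup_lifting type_definition_dual

text \<open>The group operation on characters is pointwise multiplication; it is written additively.\<close>

instantiation dual :: (topological_ab_group_add) ab_group_add
begin

lift_definition zero_dual :: "'a dual" is "\<lambda>_. 1"
  by (simp add: characters_def)

lift_definition plus_dual :: "'a dual \<Rightarrow> 'a dual \<Rightarrow> 'a dual" is "\<lambda>\<xi> \<psi> x. \<xi> x * \<psi> x"
  by (auto simp: characters_def norm_mult intro!: continuous_intros)

lift_definition uminus_dual :: "'a dual \<Rightarrow> 'a dual" is "\<lambda>\<xi> x. cnj (\<xi> x)"
  by (auto simp: characters_def intro!: continuous_intros)

lift_definition minus_dual :: "'a dual \<Rightarrow> 'a dual \<Rightarrow> 'a dual" is "\<lambda>\<xi> \<psi> x. \<xi> x * cnj (\<psi> x)"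
  by (auto simp: characters_def norm_mult intro!: continuous_intros)

instance
proof
  fix a b c :: "'a dual"
  show "a + b + c = a + (b + c)"
    by transfer (simp add: mult.assoc)
  show "a + b = b + a"
    by transfer (simp add: mult.commute)
  show "0 + a = a"
    by transfer simp
  show "- a + a = 0"
    by transfer (auto simp: characters_def complex_norm_square[symmetric] mult.commute)
  show "a - b = a + - b"
    by transfer simp
qed

end

text \<open>The dual group carries the compact-open topology.\<close>

instantiation dual :: (topological_ab_group_add) topological_space
begin

definition open_dual :: "'a dual set \<Rightarrow> bool" where
  "open_dual = generate_topology {{\<xi>. char_of \<xi> ` K \<subseteq> U} | K U. compact K \<and> open U}"

instance
  by standard (auto simp: open_dual_def intro: generate_topology.intros)

end

text \<open>
  Elements of the Lebesgue spaces are represented by functions, and two functions represent the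
  same element if they agree almost everywhere.
\<close>

definition L1 :: "'a measure \<Rightarrow> ('a \<Rightarrow> complex) set" where
  "L1 M = {f. integrable M f}"

definition L1_norm :: "'a measure \<Rightarrow> ('a \<Rightarrow> complex) \<Rightarrow> real" where
  "L1_norm M f = (\<integral>x. norm (f x) \<partial>M)"

definition Linf_norm :: "'a measure \<Rightarrow> ('a \<Rightarrow> complex) \<Rightarrow> ennreal" where
  "Linf_norm M g = esssup M (\<lambda>x. ennreal (norm (g x)))"

definition Linf :: "'a measure \<Rightarrow> ('a \<Rightarrow> complex) set" where
  "Linf M = {g \<in> borel_measurable M. Linf_norm M g < \<infinity>}"

text \<open>
  The second argument of the transform is an arbitrary function on the group, so that it can be
  evaluated at the zero function as well as at characters.
\<close>

definition fourier :: "'a measure \<Rightarrow> ('a \<Rightarrow> complex) \<Rightarrow> ('a \<Rightarrow> complex) \<Rightarrow> complex" where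
  "fourier M f \<xi> = (\<integral>x. f x * cnj (\<xi> x) \<partial>M)"

definition fourier_conv ::
    "'a::ab_group_add measure \<Rightarrow> ('a \<Rightarrow> complex) \<Rightarrow> ('a \<Rightarrow> complex) \<Rightarrow> 'a \<Rightarrow> complex" where
  "fourier_conv M f g = (\<lambda>x. \<integral>u. f u * g (x - u) \<partial>M)"

definition bounded_linear_L1_Linf ::
    "'a measure \<Rightarrow> 'b measure \<Rightarrow> (('a \<Rightarrow> complex) \<Rightarrow> 'b \<Rightarrow> complex) \<Rightarrow> bool" where
  "bounded_linear_L1_Linf M N T \<longleftrightarrow>
     (\<forall>f\<in>L1 M. T f \<in> Linf N) \<and>
     (\<forall>f\<in>L1 M. \<forall>g\<in>L1 M. (AE x in M. f x = g x) \<longrightarrow> (AE y in N. T f y = T g y)) \<and>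
     (\<forall>f\<in>L1 M. \<forall>g\<in>L1 M. AE y in N. T (\<lambda>x. f x + g x) y = T f y + T g y) \<and>
     (\<forall>c. \<forall>f\<in>L1 M. AE y in N. T (\<lambda>x. c * f x) y = c * T f y) \<and>
     (\<exists>C. \<forall>f\<in>L1 M. Linf_norm N (T f) \<le> ennreal (C * L1_norm M f))"

definition fourier_conv_property ::
    "'a::ab_group_add measure \<Rightarrow> 'b measure \<Rightarrow> (('a \<Rightarrow> complex) \<Rightarrow> 'b \<Rightarrow> complex) \<Rightarrow> bool" where
  "fourier_conv_property M N T \<longleftrightarrow>
     (\<forall>f\<in>L1 M. \<forall>g\<in>L1 M. AE y in N. T (fourier_conv M f g) y = T f y * T g y)"

text \<open>
  The element \<open>T f\<close> has values at points only after a representative has been chosen. The choices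
  \<open>R\<close> admitted here are those for which each of the laws that \<open>T\<close> satisfies almost
  everywhere (well-definedness on classes, linearity, convolution property) holds at every point.
  If \<open>T\<close> itself satisfies the laws at every point, then \<open>R = T\<close> is such a choice.
\<close>

definition pointwise_representatives ::
    "'a::ab_group_add measure \<Rightarrow> 'b measure \<Rightarrow> (('a \<Rightarrow> complex) \<Rightarrow> 'b \<Rightarrow> complex) \<Rightarrow>
     (('a \<Rightarrow> complex) \<Rightarrow> 'b \<Rightarrow> complex) \<Rightarrow> bool" where
  "pointwise_representatives M N T R \<longleftrightarrow>
     (\<forall>f\<in>L1 M. AE y in N. R f y = T f y) \<and>
     (\<forall>f\<in>L1 M. \<forall>g\<in>L1 M. (AE x in M. f x = g x) \<longrightarrow> (\<forall>y. R f y = R g y)) \<and>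
     (\<forall>f\<in>L1 M. \<forall>g\<in>L1 M. \<forall>y. R (\<lambda>x. f x + g x) y = R f y + R g y) \<and>
     (\<forall>c. \<forall>f\<in>L1 M. \<forall>y. R (\<lambda>x. c * f x) y = c * R f y) \<and>
     (\<forall>f\<in>L1 M. \<forall>g\<in>L1 M. \<forall>y. R (fourier_conv M f g) y = R f y * R g y)"

end

theory Submission
  imports Defs
begin

text \<open>
  For almost every point \<open>\<phi>\<close> the functional \<open>f \<mapsto> T f \<phi>\<close> ought to be multiplicative on the convolution algebra
  \<open>L\<^sup>1(G)\<close>, and the nonzero multiplicative functionals of this algebra are the values of the Fourier transform at the
  characters. The point \<open>\<theta> \<phi>\<close> is the character that belongs to \<open>\<phi>\<close>, or \<open>0\<close> if the functional vanishes.
  This argument has two parts of different nature.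

  \<^bold>\<open>Multiplicative functionals.\<close> If representatives \<open>R f\<close> satisfy the algebraic laws at every point, then each
  \<open>\<Phi> f = R f \<phi>\<close> is multiplicative, and hence contractive
  (\<open>multiplicative_functional_bounded\<close>: solve \<open>g = f + f \<star> g\<close> by a geometric series). When \<open>\<Phi> g \<noteq> 0\<close>, the quotient
  \<open>\<xi> u = \<Phi> (shift u g) / \<Phi> g\<close> is a continuous homomorphism to the circle, and
  applying \<open>\<Phi>\<close> to \<open>f \<star> g = \<integral> f(u) shift u g du\<close> gives \<open>\<Phi> f = \<integral> f \<xi>\<close>
  (\<open>multiplicative_functional_is_fourier\<close>). The last formula needs an exchange of \<open>\<Phi>\<close> and an integral.
  Fubini's theorem for product measures is of no help for it, as the group need not be sigma-compact and addition
  need not be measurable for the product of the Borel sigma-algebras. The exchange is first proved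
  for continuous functions of compact support, by uniform approximation with Riemann sums
  (\<open>functional_commutes_with_integral\<close>). It then gives the invariance of \<open>\<mu>\<close> under inversion, Young's
  inequality for convolutions (\<open>fourier_conv_L1\<close>), and the general formula by density (\<open>functional_of_fourier_conv\<close>).

  \<^bold>\<open>Existence of representatives.\<close> A bounded operator determines \<open>T f\<close> only up to null sets that depend on \<open>f\<close>, and
  there are uncountably many \<open>f\<close>. The group structure is what allows a simultaneous choice. Suppose that the measure
  on the target is sigma-finite. Countably many \<open>e\<^sub>n\<close> detect where \<open>T\<close> vanishes
  (\<open>essential_countable_cover\<close>), and the quotients \<open>u\<^sub>g = T (shift g e\<^sub>n) / T e\<^sub>n\<close> form a homomorphism from
  \<open>G\<close> to functions with values in the circle, up to null sets. It is corrected in three steps. An open sigma-compact subgroup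
  has a countable subgroup that is dense for the translation seminorms of the \<open>e\<^sub>n\<close>, and on it a single
  null set contains all exceptions. Uniform continuity extends the correction to the open subgroup
  (\<open>circle_hom_extends_from_dense_subgroup\<close>). From there it extends to all of \<open>G\<close> by Zorn's lemma
  (\<open>circle_hom_choice\<close>), because functions that equal \<open>1\<close> almost everywhere have \<open>n\<close>-th roots
  of the same kind. The result is a character at almost every point where some \<open>T e\<^sub>n\<close> does not vanish, and comparing
  Riemann sums for \<open>f \<star> e\<^sub>n\<close> shows that \<open>T f\<close> is almost everywhere the Fourier transform of \<open>f\<close> at these
  characters (\<open>pointwise_fourier\<close>).

  To drop sigma-finiteness, the dual group is cut into the cosets of an open sigma-compact subgroup,
  which exists since the dual group is locally compact (\<open>dual_locally_compact\<close>). The measure is sigma-finite on each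
  coset, and the uncountably many exceptional null sets together lie in a null set by
  regularity of the measure (\<open>AE_from_cosets\<close>).
\<close>

section \<open>Topological abelian groups\<close>

lemma small_factor:
  fixes c e :: real
  assumes "0 \<le> c" "0 < e"
  obtains d where "0 < d" "c * d \<le> e"
proof (rule that[of "e / (c + 1)"])
  have "c * (e / (c + 1)) = e * (c / (c + 1))" by simp
  also have "\<dots> \<le> e * 1"
    using assms by (intro mult_left_mono) (auto simp: divide_le_eq_1)
  finally show "c * (e / (c + 1)) \<le> e" by simp
qed (use assms in auto)

definition is_subgroup :: "'a::ab_group_add set \<Rightarrow> bool" where
  "is_subgroup H \<longleftrightarrow> 0 \<in> H \<and> (\<forall>x\<in>H. \<forall>y\<in>H. x - y \<in> H)"

lemma is_subgroupD:
  assumes "is_subgroup H"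
  shows "0 \<in> H" "x \<in> H \<Longrightarrow> y \<in> H \<Longrightarrow> x - y \<in> H" "x \<in> H \<Longrightarrow> - x \<in> H"
    "x \<in> H \<Longrightarrow> y \<in> H \<Longrightarrow> x + y \<in> H"
proof -
  show zero: "0 \<in> H" and diff: "x \<in> H \<Longrightarrow> y \<in> H \<Longrightarrow> x - y \<in> H" for x y
    using assms by (auto simp: is_subgroup_def)
  show minus: "x \<in> H \<Longrightarrow> - x \<in> H" for x
    using diff[OF zero, of x] by simp
  show "x \<in> H \<Longrightarrow> y \<in> H \<Longrightarrow> x + y \<in> H" 
    using diff[of x "- y"] minus by simp
qed

lemma symmetric_nbhd:
  fixes U :: "'a::topological_ab_group_add set"
  assumes "open U" "0 \<in> U"
  obtains V where "open V" "0 \<in> V" "V \<subseteq> U" "\<And>x. x \<in> V \<Longrightarrow> - x \<in> V"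
proof (rule that[of "U \<inter> uminus -` U"])
  show "open (U \<inter> uminus -` U)"
    using assms by (intro open_Int open_vimage continuous_intros) auto
qed (use assms in auto)

lemma symmetric_half_nbhd:
  fixes U :: "'a::topological_ab_group_add set"
  assumes "open U" "0 \<in> U"
  obtains V where "open V" "0 \<in> V" "\<And>x. x \<in> V \<Longrightarrow> - x \<in> V"
    "\<And>x y. x \<in> V \<Longrightarrow> y \<in> V \<Longrightarrow> x + y \<in> U"
proof -
  have "open ((\<lambda>p::'a\<times>'a. fst p + snd p) -` U)"
    using assms by (intro open_vimage continuous_intros) auto
  then obtain A B where AB: "open A" "open B" "(0, 0) \<in> A \<times> B" "A \<times> B \<subseteq> (\<lambda>p. fst p + snd p) -` U"
    by (rule open_prod_elim[of _ "(0,0)"]) (use assms in auto)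
  obtain V where "open V" "0 \<in> V" "V \<subseteq> A \<inter> B" "\<And>x. x \<in> V \<Longrightarrow> - x \<in> V"
    using symmetric_nbhd[of "A \<inter> B"] AB by auto
  then show thesis
    using AB(4) by (intro that[of V]) (auto simp: subset_iff)
qed

lemma open_translate:
  fixes U :: "'a::topological_ab_group_add set"
  assumes "open U"
  shows "open ((+) a ` U)"
proof -
  have "(+) a ` U = (\<lambda>x. x - a) -` U"
    by (auto simp: image_iff algebra_simps intro!: bexI[of _ "_ - a"])
  moreover have "open ((\<lambda>x. x - a) -` U)"
    using assms by (intro open_vimage continuous_intros) auto
  ultimately show ?thesis by simp
qed

lemma compact_translate:
  fixes K :: "'a::topological_ab_group_add set"
  assumes "compact K"
  shows "compact ((+) a ` K)"
  using assms by (intro compact_continuous_image continuous_intros)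

lemma compact_add:
  fixes K L :: "'a::topological_ab_group_add set"
  assumes "compact K" "compact L"
  shows "compact ((\<lambda>p. fst p + snd p) ` (K \<times> L))"
  using assms by (intro compact_continuous_image continuous_intros compact_Times)

text \<open>
  Local compactness is used in the form of one open neighbourhood \<open>U\<close> of \<open>0\<close> inside a compact set, which
  translations carry to every point.
\<close>

lemma compact_relatively_compact_nbhd:
  fixes K U :: "'a::topological_ab_group_add set"
  assumes "compact K" "open U" "0 \<in> U" "U \<subseteq> C" "compact C"
  obtains W L where "open W" "compact L" "K \<subseteq> W" "W \<subseteq> L"
proof (rule that[of "\<Union>x\<in>K. (+) x ` U" "(\<lambda>p. fst p + snd p) ` (K \<times> C)"])
  show "K \<subseteq> (\<Union>x\<in>K. (+) x ` U)"
    using assms by (force simp: image_iff)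
  show "(\<Union>x\<in>K. (+) x ` U) \<subseteq> (\<lambda>p. fst p + snd p) ` (K \<times> C)"
    using assms(4) by force
qed (use assms in \<open>auto intro!: open_translate compact_add open_UN\<close>)

text \<open>
  The subgroup generated by a symmetric compact neighbourhood of \<open>0\<close> is the union of its iterated sums.
\<close>

lemma sigma_compact_open_subgroup:
  fixes U :: "'a::topological_ab_group_add set"
  assumes "open U" "0 \<in> U" "U \<subseteq> C" "compact C"
  obtains H and K :: "nat \<Rightarrow> 'a set" where "is_subgroup H" "open H" "\<And>n. compact (K n)" "H = (\<Union>n. K n)"
proof -
  define D where "D = C \<union> uminus ` C"
  have D: "compact D" "\<And>x. x \<in> D \<Longrightarrow> - x \<in> D"
    using assms(4) unfolding D_def
    by (auto intro!: compact_Un compact_continuous_image continuous_intros)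
  define K where "K = rec_nat {0} (\<lambda>_ A. (\<lambda>p. fst p + snd p) ` (A \<times> D))"
  have K0: "K 0 = {0}" and KS: "\<And>n. K (Suc n) = (\<lambda>p. fst p + snd p) ` (K n \<times> D)"
    by (simp_all add: K_def)
  have cK: "compact (K n)" for n
    by (induction n) (simp_all only: K0 KS compact_add D compact_sing)
  have add: "x \<in> K m \<Longrightarrow> y \<in> K n \<Longrightarrow> x + y \<in> K (m + n)" for x y m n
  proof (induction n arbitrary: y)
    case 0
    then show ?case by (simp add: K0)
  next
    case (Suc n)
    then obtain z d where "y = z + d" "z \<in> K n" "d \<in> D"
      by (auto simp: KS)
    then show ?case
      using Suc.IH[of z] Suc.prems by (auto simp: KS add.assoc[symmetric] intro!: image_eqI[of _ _ "(x + z, d)"])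
  qed
  have minus: "x \<in> K n \<Longrightarrow> - x \<in> K n" for x n
  proof (induction n arbitrary: x)
    case (Suc n)
    then obtain z d where zd: "x = z + d" "z \<in> K n" "d \<in> D"
      by (auto simp: KS)
    then have "(- z, - d) \<in> K n \<times> D"
      using Suc.IH D by auto
    moreover have "- x = - z + - d"
      using zd by simp
    ultimately show ?case
      unfolding KS by (intro image_eqI[of _ _ "(- z, - d)"]) auto
  qed (simp add: K0)
  define H where "H = (\<Union>n. K n)"
  have "is_subgroup H"
    unfolding is_subgroup_def
  proof (intro conjI ballI)
    show "0 \<in> H" using K0 by (auto simp: H_def intro: exI[of _ 0])
    fix x y assume "x \<in> H" "y \<in> H"
    then obtain m n where "x \<in> K m" "y \<in> K n" by (auto simp: H_def)
    then show "x - y \<in> H"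
      using add[of x m "- y" n] minus[of y n] by (auto simp: H_def)
  qed
  moreover have "open H"
  proof (rule topological_space_class.openI)
    fix x assume "x \<in> H"
    then obtain n where n: "x \<in> K n" by (auto simp: H_def)
    have "(+) x ` U \<subseteq> K (Suc n)"
      using n assms(3) by (force simp: KS D_def)
    moreover have "x \<in> (+) x ` U"
      using assms(2) by force
    ultimately show "\<exists>T. open T \<and> x \<in> T \<and> T \<subseteq> H"
      using open_translate[OF assms(1), of x] by (auto simp: H_def intro!: exI[of _ "(+) x ` U"])
  qed
  ultimately show thesis
    using that cK H_def by blast
qed

lemma uniformly_continuous_compact_support:
  fixes g :: "'a::topological_ab_group_add \<Rightarrow> complex"
  assumes "continuous_on UNIV g" "compact K" "\<And>x. x \<notin> K \<Longrightarrow> g x = 0" "0 < e"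
  obtains V where "open V" "0 \<in> V" "\<And>x. x \<in> V \<Longrightarrow> - x \<in> V" "\<And>x v. v \<in> V \<Longrightarrow> norm (g (x + v) - g x) < e"
proof -
  have "open {p::'a\<times>'a. norm (g (snd p + fst p) - g (snd p)) < e}"
    by (intro open_Collect_less continuous_intros continuous_on_compose2[OF assms(1)]) auto
  from Elementary_Topology.tube_lemma[OF assms(2) this, of 0] assms(4)
  obtain V0 where V0: "open V0" "0 \<in> V0" "\<And>x v. x \<in> K \<Longrightarrow> v \<in> V0 \<Longrightarrow> norm (g (x + v) - g x) < e"
    by (auto simp: subset_iff)
  obtain V where V: "open V" "0 \<in> V" "V \<subseteq> V0" "\<And>x. x \<in> V \<Longrightarrow> - x \<in> V"
    using symmetric_nbhd V0 by blast
  have "norm (g (x + v) - g x) < e" if "v \<in> V" for x v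
  proof (cases "x \<in> K")
    case True
    then show ?thesis using V0 V that by blast
  next
    case False
    show ?thesis
    proof (cases "x + v \<in> K")
      case True
      then have "norm (g ((x + v) + - v) - g (x + v)) < e"
        using V0(3) V that by blast
      then show ?thesis by (simp add: norm_minus_commute)
    next
      case False
      then show ?thesis using \<open>x \<notin> K\<close> assms by simp
    qed
  qed
  then show thesis using V that by blast
qed

text \<open>The partitions over which Riemann sums are formed: a piece lies near the point that labels it.\<close>

lemma compact_borel_partition:
  fixes K U :: "'a::{topological_ab_group_add, t2_space} set"
  assumes "compact K" "open U" "0 \<in> U"
  obtains I and E :: "'a \<Rightarrow> 'a set" where "finite I" "I \<subseteq> K" "\<And>z. E z \<in> sets borel" "disjoint_family_on E I"
    "(\<Union>z\<in>I. E z) = K" "\<And>z u. z \<in> I \<Longrightarrow> u \<in> E z \<Longrightarrow> u - z \<in> U"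
proof -
  obtain I where I: "I \<subseteq> K" "finite I" "K \<subseteq> (\<Union>z\<in>I. (+) z ` U)"
    by (rule compactE_image[OF assms(1), of K "\<lambda>z. (+) z ` U"])
      (use assms in \<open>force intro: open_translate\<close>)+
  obtain n and p :: "nat \<Rightarrow> 'a" where p: "I = p ` {i. i < n}" "inj_on p {i. i < n}"
    using finite_imp_nat_seg_image_inj_on[OF I(2)] by auto
  define F where "F i = K \<inter> ((+) (p i) ` U - (\<Union>j<i. (+) (p j) ` U))" for i
  define E where "E z = F (the_inv_into {i. i < n} p z)" for z
  have Ep: "E (p i) = F i" if "i < n" for i
    using that p the_inv_into_f_f[OF p(2)] by (simp add: E_def)
  show thesis
  proof (rule that[of I E])
    have "F i \<in> sets borel" for i
      unfolding F_def using assms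
      by (intro sets.Int sets.Diff sets.countable_UN'' borel_open borel_closed open_translate compact_imp_closed) auto
    then show "E z \<in> sets borel" for z
      by (simp add: E_def)
    have F: "F i \<inter> F j = {}" if "i < j" for i j
      using that by (auto simp: F_def)
    show "disjoint_family_on E I"
      unfolding disjoint_family_on_def p(1)
    proof (intro ballI impI)
      fix a b assume "a \<in> p ` {i. i < n}" "b \<in> p ` {i. i < n}" "a \<noteq> b"
      then obtain i j where "a = p i" "b = p j" "i < n" "j < n" "i \<noteq> j" by blast
      then show "E a \<inter> E b = {}"
        using F[of i j] F[of j i] Ep by (metis Int_commute linorder_neqE_nat)
    qed
    show "(\<Union>z\<in>I. E z) = K"
    proof (intro equalityI subsetI)
      fix x assume "x \<in> (\<Union>z\<in>I. E z)"
      then show "x \<in> K" by (auto simp: E_def F_def)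
    next
      fix x assume x: "x \<in> K"
      then obtain i where i: "i < n" "x \<in> (+) (p i) ` U"
        using I(3) p(1) by blast
      define k where "k = (LEAST i. x \<in> (+) (p i) ` U)"
      have "x \<in> (+) (p k) ` U" "k \<le> i" "\<And>j. j < k \<Longrightarrow> x \<notin> (+) (p j) ` U"
        using LeastI[of "\<lambda>i. x \<in> (+) (p i) ` U", OF i(2)] Least_le[of "\<lambda>i. x \<in> (+) (p i) ` U", OF i(2)]
          not_less_Least[of _ "\<lambda>i. x \<in> (+) (p i) ` U"] unfolding k_def by blast+
      then have "x \<in> F k" "k < n"
        using x i by (auto simp: F_def)
      then show "x \<in> (\<Union>z\<in>I. E z)"
        using p(1) Ep by blast
    qed
    show "u - z \<in> U" if "z \<in> I" "u \<in> E z" for z u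
      using that p(1) Ep by (auto simp: F_def)
  qed (use I in auto)
qed

section \<open>Density of continuous functions in mean\<close>

lemma L1_norm_nonneg: "0 \<le> L1_norm M f"
  by (simp add: L1_norm_def)

lemma L1_norm_triangle:
  assumes "integrable M f" "integrable M g"
  shows "L1_norm M (\<lambda>x. f x + g x) \<le> L1_norm M f + L1_norm M g"
proof -
  have "L1_norm M (\<lambda>x. f x + g x) \<le> (\<integral>x. norm (f x) + norm (g x) \<partial>M)"
    unfolding L1_norm_def using assms by (intro integral_mono norm_triangle_ineq) auto
  then show ?thesis using assms by (simp add: L1_norm_def)
qed

lemma L1_norm_minus_commute: "L1_norm M (\<lambda>x. f x - g x) = L1_norm M (\<lambda>x. g x - f x)"
  by (simp add: L1_norm_def norm_minus_commute)

lemma L1_norm_triangle_minus: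
  assumes "integrable M f" "integrable M g" "integrable M h"
  shows "L1_norm M (\<lambda>x. f x - h x) \<le> L1_norm M (\<lambda>x. f x - g x) + L1_norm M (\<lambda>x. g x - h x)"
  using L1_norm_triangle[of M "\<lambda>x. f x - g x" "\<lambda>x. g x - h x"] assms by simp

lemma L1_norm_cmult: "L1_norm M (\<lambda>x. c * f x) = norm c * L1_norm M f"
  by (simp add: L1_norm_def norm_mult)

lemma L1_norm_tendsto_dominated:
  fixes f :: "'a \<Rightarrow> complex"
  assumes "\<And>i. integrable M (s i)" "\<And>x. x \<in> space M \<Longrightarrow> (\<lambda>i. s i x) \<longlonglongrightarrow> f x"
    and "\<And>i x. x \<in> space M \<Longrightarrow> norm (s i x) \<le> 2 * norm (f x)" "integrable M f"
  shows "(\<lambda>i. L1_norm M (\<lambda>x. f x - s i x)) \<longlonglongrightarrow> 0"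
proof -
  have "(\<lambda>i. \<integral>x. norm (f x - s i x) \<partial>M) \<longlonglongrightarrow> (\<integral>x. 0 \<partial>M)"
  proof (rule integral_dominated_convergence[where w = "\<lambda>x. 3 * norm (f x)"])
    show "AE x in M. (\<lambda>i. norm (f x - s i x)) \<longlonglongrightarrow> 0"
      using assms(2) by (intro AE_I2 tendsto_norm_zero) (auto simp: LIM_zero_iff intro!: tendsto_eq_intros)
    show "AE x in M. norm (norm (f x - s i x)) \<le> 3 * norm (f x)" for i
    proof (intro AE_I2)
      fix x assume "x \<in> space M"
      then show "norm (norm (f x - s i x)) \<le> 3 * norm (f x)"
        using norm_triangle_ineq4[of "f x" "s i x"] assms(3)[of x i] by simp
    qed
  qed (use assms in auto)
  then show ?thesis by (simp add: L1_norm_def)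
qed

definition Cc :: "('a::topological_space \<Rightarrow> complex) set" where
  "Cc = {g. continuous_on UNIV g \<and> (\<exists>K. compact K \<and> (\<forall>x. x \<notin> K \<longrightarrow> g x = 0))}"

lemma CcE:
  assumes "g \<in> Cc"
  obtains K B where "continuous_on UNIV g" "compact K" "\<And>x. x \<notin> K \<Longrightarrow> g x = 0" "\<And>x. norm (g x) \<le> B" "0 \<le> B"
proof -
  obtain K where K: "continuous_on UNIV g" "compact K" "\<And>x. x \<notin> K \<Longrightarrow> g x = 0"
    using assms by (auto simp: Cc_def)
  have "bounded (g ` K)"
    using K by (intro compact_imp_bounded compact_continuous_image) (auto intro: continuous_on_subset)
  then obtain B where "\<And>x. x \<in> K \<Longrightarrow> norm (g x) \<le> B" by (auto simp: bounded_iff)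
  then have "norm (g x) \<le> max 0 B" for x
    by (cases "x \<in> K") (auto simp: K(3) le_max_iff_disj)
  then show thesis using K that[of K "max 0 B"] by auto
qed

lemma Cc_add: "f \<in> Cc \<Longrightarrow> g \<in> Cc \<Longrightarrow> (\<lambda>x. f x + g x) \<in> Cc"
  unfolding Cc_def
  by (auto intro!: continuous_intros) (metis Un_iff compact_Un add_0)

lemma Cc_cmult: "g \<in> Cc \<Longrightarrow> (\<lambda>x. c * g x) \<in> Cc"
  unfolding Cc_def by (auto intro!: continuous_intros)

lemma Cc_norm: "g \<in> Cc \<Longrightarrow> (\<lambda>x. complex_of_real (norm (g x))) \<in> Cc"
  unfolding Cc_def by (auto intro!: continuous_intros)

text \<open>
  Local compactness puts an open set of finite measure around every compact set. Inner regularity then passes to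
  complements inside such open sets and gives approximation from outside.
\<close>

locale radon_measure =
  fixes M :: "'a::{topological_ab_group_add, t2_space} measure"
  assumes sets_M [measurable_cong, simp]: "sets M = sets borel"
    and finite_compact: "compact K \<Longrightarrow> emeasure M K < \<infinity>"
    and inner_regular: "A \<in> sets borel \<Longrightarrow> emeasure M A = (SUP K\<in>{K. compact K \<and> K \<subseteq> A}. emeasure M K)"
    and locally_compact: "\<exists>U C. open U \<and> (0::'a) \<in> U \<and> U \<subseteq> C \<and> compact C"
begin

lemma space_M [simp]: "space M = UNIV"
  using sets_eq_imp_space_eq[OF sets_M] by simp

lemma compact_fmeasurable: "compact K \<Longrightarrow> K \<in> fmeasurable M"
  using finite_compact[of K] by (auto simp: fmeasurable_def borel_closed compact_imp_closed)

lemma continuous_borel_measurable: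
  "continuous_on UNIV g \<Longrightarrow> g \<in> borel_measurable M" for g :: "'a \<Rightarrow> 'c::topological_space"
  using borel_measurable_continuous_onI[of g] by (simp cong: measurable_cong_sets)

lemma compact_open_nbhd:
  fixes K :: "'a set"
  assumes "compact K"
  obtains W L where "open W" "compact L" "K \<subseteq> W" "W \<subseteq> L"
proof -
  obtain U C where "open U" "(0::'a) \<in> U" "U \<subseteq> C" "compact C"
    using locally_compact by blast
  from compact_relatively_compact_nbhd[OF assms this] that show thesis by metis
qed

lemma inner_approx:
  assumes "A \<in> fmeasurable M" "0 < e"
  obtains K where "compact K" "K \<subseteq> A" "measure M (A - K) < e"
proof (rule ccontr)
  assume "\<not> thesis"
  then have *: "measure M (A - K) \<ge> e" if "compact K" "K \<subseteq> A" for K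
    using that \<open>\<And>K. compact K \<Longrightarrow> K \<subseteq> A \<Longrightarrow> measure M (A - K) < e \<Longrightarrow> thesis\<close> by force
  have le: "measure M K \<le> measure M A - e" if "compact K" "K \<subseteq> A" for K
    using *[OF that] measure_Diff[of M K A] assms compact_fmeasurable[OF that(1)] that
    by (auto simp: fmeasurable_def measure_Diff)
  have "emeasure M A = (SUP K\<in>{K. compact K \<and> K \<subseteq> A}. emeasure M K)"
    using assms by (intro inner_regular) (auto simp: fmeasurable_def)
  also have "\<dots> \<le> ennreal (measure M A - e)"
    using compact_fmeasurable le by (intro SUP_least) (auto simp: emeasure_eq_measure2 ennreal_leI)
  finally have "ennreal (measure M A) \<le> ennreal (measure M A - e)"
    using assms by (simp add: emeasure_eq_measure2)
  moreover have "0 \<le> measure M A - e"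
    using le[of "{}"] by simp
  ultimately show False using assms by simp
qed

lemma outer_approx:
  assumes "A \<in> sets borel" "A \<subseteq> W" "open W" "W \<in> fmeasurable M" "0 < e"
  obtains V where "open V" "A \<subseteq> V" "V \<subseteq> W" "measure M (V - A) < e"
proof -
  have "W - A \<in> fmeasurable M"
    using assms by (intro fmeasurable_Diff) auto
  from inner_approx[OF this assms(5)] obtain C where C: "compact C" "C \<subseteq> W - A" "measure M (W - A - C) < e"
    by metis
  show thesis
  proof (rule that[of "W - C"])
    have "W - C - A = W - A - C" by auto
    then show "measure M (W - C - A) < e" using C by simp
  qed (use assms C in \<open>auto intro: compact_imp_closed\<close>)
qed

lemma locally_compact_space: "locally_compact_space (euclidean :: 'a topology)"
  unfolding locally_compact_space_def
proof (intro ballI)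
  fix x :: 'a
  obtain W L where "open W" "compact L" "{x} \<subseteq> W" "W \<subseteq> L"
    using compact_open_nbhd[of "{x}"] by auto
  then show "\<exists>U K. openin euclidean U \<and> compactin euclidean K \<and> x \<in> U \<and> U \<subseteq> K"
    by (intro exI[of _ W] exI[of _ L]) simp
qed

lemma urysohn_bump:
  assumes "compact K" "open U" "K \<subseteq> U"
  obtains g :: "'a \<Rightarrow> real" where "continuous_on UNIV g" "\<And>x. 0 \<le> g x" "\<And>x. g x \<le> 1" "\<And>x. x \<in> K \<Longrightarrow> g x = 1"
    "\<And>x. x \<notin> U \<Longrightarrow> g x = 0" "(\<lambda>x. complex_of_real (g x)) \<in> Cc"
proof -
  obtain W L where WL: "open W" "compact L" "K \<subseteq> W" "W \<subseteq> L"
    using compact_open_nbhd[OF assms(1)] by blast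
  have "Hausdorff_space (euclidean :: 'a topology)"
    unfolding Hausdorff_space_def disjnt_def by simp (metis hausdorff)
  then have "completely_regular_space (euclidean :: 'a topology)"
    using locally_compact_regular_imp_completely_regular_space[OF locally_compact_space] by simp
  moreover have "compactin euclidean K" "closedin euclidean (- (U \<inter> W))" "disjnt K (- (U \<inter> W))"
    using assms WL by (simp_all add: disjnt_def disjoint_eq_subset_Compl closed_Un closed_Compl)
  ultimately obtain g :: "'a \<Rightarrow> real" where g: "continuous_map euclidean (top_of_set {0..1}) g"
      "g ` (- (U \<inter> W)) \<subseteq> {0}" "g ` K \<subseteq> {1}"
    using Urysohn_completely_regular_compact_closed[OF zero_le_one, of euclidean K "- (U \<inter> W)"] by metis
  have "continuous_on UNIV g" "\<And>x. g x \<in> {0..1}"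
    using g(1) by (auto simp: continuous_map_in_subtopology)
  moreover have "x \<notin> L \<Longrightarrow> g x = 0" "x \<notin> U \<Longrightarrow> g x = 0" for x
    using g(2) WL by auto
  ultimately show thesis
    using g(3) WL(2) by (intro that[of g]) (auto simp: Cc_def intro!: continuous_intros)
qed

lemma Cc_integrable:
  assumes "g \<in> Cc"
  shows "integrable M g"
proof -
  obtain K B where K: "continuous_on UNIV g" "compact K" "\<And>x. x \<notin> K \<Longrightarrow> g x = 0" "\<And>x. norm (g x) \<le> B"
    using CcE[OF assms] by metis
  show ?thesis
    using compact_fmeasurable[OF K(2)] K
    by (intro integrableI_bounded_set[where A = K and B = B]) (auto simp: fmeasurable_def intro: continuous_borel_measurable)
qed

text \<open>
  By regularity, the indicator of a set of finite measure is close in mean to an Urysohn function of a compact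
  subset. Linear combinations and dominated limits of such indicators exhaust the integrable functions.
\<close>

lemma Cc_dense:
  fixes f :: "'a \<Rightarrow> complex"
  assumes "integrable M f" "0 < e"
  obtains g where "g \<in> Cc" "L1_norm M (\<lambda>x. f x - g x) < e"
proof -
  have "\<forall>e>0. \<exists>g\<in>Cc. L1_norm M (\<lambda>x. f x - g x) < e"
    using assms(1)
  proof (induction rule: integrable_induct)
    case (base A c)
    show ?case
    proof (intro allI impI)
      fix e :: real assume "0 < e"
      define d where "d = e / (2 * (norm c + 1))"
      have d: "0 < d" "2 * d * norm c < e"
        using \<open>0 < e\<close> by (auto simp: d_def field_simps add_pos_nonneg mult_less_cancel_left)
      have A: "A \<in> fmeasurable M" using base by (auto simp: fmeasurable_def)
      obtain K where K: "compact K" "K \<subseteq> A" "measure M (A - K) < d"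
        using inner_approx[OF A d(1)] by blast
      obtain W L where WL: "open W" "compact L" "K \<subseteq> W" "W \<subseteq> L"
        using compact_open_nbhd[OF K(1)] by blast
      have W: "W \<in> fmeasurable M"
        using WL by (intro fmeasurableI2[OF compact_fmeasurable[OF WL(2)]]) auto
      obtain V where V: "open V" "K \<subseteq> V" "V \<subseteq> W" "measure M (V - K) < d"
        using outer_approx[of K W d] K WL W d by (auto simp: compact_imp_closed borel_closed)
      have "V \<in> fmeasurable M"
        using V by (intro fmeasurableI2[OF W]) auto
      then have VK: "V - K \<in> fmeasurable M" "A - K \<in> fmeasurable M"
        using A compact_fmeasurable[OF K(1)] by (auto intro!: fmeasurable_Diff simp: fmeasurableD)
      obtain g :: "'a \<Rightarrow> real" where g: "continuous_on UNIV g" "\<And>x. 0 \<le> g x" "\<And>x. g x \<le> 1" "\<And>x. x \<in> K \<Longrightarrow> g x = 1"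
        "\<And>x. x \<notin> V \<Longrightarrow> g x = 0" "(\<lambda>x. complex_of_real (g x)) \<in> Cc"
        using urysohn_bump[OF K(1) V(1,2)] by metis
      have "L1_norm M (\<lambda>x. indicator A x *\<^sub>R c - c * complex_of_real (g x))
          \<le> (\<integral>x. (indicator (A - K) x + indicator (V - K) x) * norm c \<partial>M)"
        unfolding L1_norm_def
      proof (rule integral_mono)
        show "integrable M (\<lambda>x. norm (indicator A x *\<^sub>R c - c * complex_of_real (g x)))"
          using A Cc_integrable[OF Cc_cmult[OF g(6), of c]]
          by (intro integrable_norm Bochner_Integration.integrable_diff integrable_scaleR_left) (auto simp: fmeasurable_def)
        show "integrable M (\<lambda>x. (indicator (A - K) x + indicator (V - K) x) * norm c)"
          using VK by (intro integrable_mult_left Bochner_Integration.integrable_add) (auto simp: fmeasurable_def)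
        fix x
        have "indicator A x *\<^sub>R c - c * complex_of_real (g x) = (indicator A x - g x) *\<^sub>R c"
          by (simp add: scaleR_conv_of_real algebra_simps)
        moreover have "\<bar>indicator A x - g x\<bar> \<le> indicator (A - K) x + indicator (V - K) x"
          using g(2,3)[of x] g(4,5)[of x] K(2) by (auto simp: indicator_def)
        ultimately show "norm (indicator A x *\<^sub>R c - c * complex_of_real (g x)) \<le> (indicator (A - K) x + indicator (V - K) x) * norm c"
          by (simp add: mult_right_mono)
      qed
      also have "\<dots> = (measure M (A - K) + measure M (V - K)) * norm c"
        using VK by (simp add: fmeasurable_def)
      also have "\<dots> \<le> 2 * d * norm c"
        using K V by (intro mult_right_mono) auto
      finally show "\<exists>g\<in>Cc. L1_norm M (\<lambda>x. indicator A x *\<^sub>R c - g x) < e"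
        using d Cc_cmult[OF g(6), of c] by (intro bexI[of _ "\<lambda>x. c * complex_of_real (g x)"]) auto
    qed
  next
    case (add f g)
    show ?case
    proof (intro allI impI)
      fix e :: real assume "0 < e"
      then obtain f' g' where f': "f' \<in> Cc" "L1_norm M (\<lambda>x. f x - f' x) < e / 2"
        and g': "g' \<in> Cc" "L1_norm M (\<lambda>x. g x - g' x) < e / 2"
        using add.IH half_gt_zero by metis
      have "L1_norm M (\<lambda>x. f x + g x - (f' x + g' x)) \<le> L1_norm M (\<lambda>x. f x - f' x) + L1_norm M (\<lambda>x. g x - g' x)"
        using L1_norm_triangle[of M "\<lambda>x. f x - f' x" "\<lambda>x. g x - g' x"] add.hyps f' g' Cc_integrable
        by (simp add: algebra_simps)
      then show "\<exists>h\<in>Cc. L1_norm M (\<lambda>x. f x + g x - h x) < e"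
        using f' g' Cc_add by (intro bexI[of _ "\<lambda>x. f' x + g' x"]) auto
    qed
  next
    case (lim f s)
    show ?case
    proof (intro allI impI)
      fix e :: real assume e: "0 < e"
      have "(\<lambda>i. L1_norm M (\<lambda>x. f x - s i x)) \<longlonglongrightarrow> 0"
        by (rule L1_norm_tendsto_dominated) (use lim in auto)
      from order_tendstoD(2)[OF this half_gt_zero[OF e]]
      obtain i where i: "L1_norm M (\<lambda>x. f x - s i x) < e / 2"
        by (auto simp: eventually_sequentially)
      obtain g where g: "g \<in> Cc" "L1_norm M (\<lambda>x. s i x - g x) < e / 2"
        using lim.IH[of i] e half_gt_zero by blast
      have "L1_norm M (\<lambda>x. f x - g x) < e"
        using L1_norm_triangle_minus[of M f "s i" g] i g lim.hyps Cc_integrable by auto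
      then show "\<exists>g\<in>Cc. L1_norm M (\<lambda>x. f x - g x) < e"
        using g by blast
    qed
  qed
  then show thesis using that assms by blast
qed

lemma Cc_sequence:
  fixes f :: "'a \<Rightarrow> complex"
  assumes "integrable M f"
  obtains s where "\<And>n::nat. s n \<in> Cc" "(\<lambda>n. L1_norm M (\<lambda>x. f x - s n x)) \<longlonglongrightarrow> 0"
    "AE x in M. (\<lambda>n. s n x) \<longlonglongrightarrow> f x"
proof -
  have "\<exists>g\<in>Cc. L1_norm M (\<lambda>x. f x - g x) < 1 / Suc n" for n
    using Cc_dense[OF assms, of "1 / Suc n"] by (metis of_nat_0_less_iff zero_less_Suc zero_less_divide_1_iff)
  then obtain g where g: "\<And>n. g n \<in> Cc" "\<And>n. L1_norm M (\<lambda>x. f x - g n x) < 1 / Suc n"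
    by metis
  have lim: "(\<lambda>n. L1_norm M (\<lambda>x. f x - g n x)) \<longlonglongrightarrow> 0"
    by (rule tendsto_sandwich[OF _ _ tendsto_const LIMSEQ_inverse_real_of_nat])
      (use less_imp_le[OF g(2)] in \<open>simp_all add: L1_norm_nonneg inverse_eq_divide\<close>)
  obtain r :: "nat \<Rightarrow> nat" where r: "strict_mono r" "AE x in M. (\<lambda>n. f x - g (r n) x) \<longlonglongrightarrow> 0"
    using tendsto_L1_AE_subseq[of M "\<lambda>n x. f x - g n x"] lim assms g(1) Cc_integrable
    by (auto simp: L1_norm_def)
  show thesis
  proof (rule that[of "\<lambda>n. g (r n)"])
    show "AE x in M. (\<lambda>n. g (r n) x) \<longlonglongrightarrow> f x"
      using r(2)
    proof eventually_elim
      case (elim x)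
      from tendsto_diff[OF tendsto_const[of "f x"] this] show ?case by simp
    qed
  qed (use g LIMSEQ_subseq_LIMSEQ[OF lim r(1)] in \<open>auto simp: o_def\<close>)
qed

end

section \<open>Exchanging a functional with an integral\<close>

definition L1_functional :: "'a measure \<Rightarrow> (('a \<Rightarrow> complex) \<Rightarrow> complex) \<Rightarrow> real \<Rightarrow> bool" where
  "L1_functional M \<Phi> C \<longleftrightarrow> 0 \<le> C \<and>
     (\<forall>f g. integrable M f \<longrightarrow> integrable M g \<longrightarrow> \<Phi> (\<lambda>x. f x + g x) = \<Phi> f + \<Phi> g) \<and>
     (\<forall>c f. integrable M f \<longrightarrow> \<Phi> (\<lambda>x. c * f x) = c * \<Phi> f) \<and>
     (\<forall>f. integrable M f \<longrightarrow> norm (\<Phi> f) \<le> C * L1_norm M f)"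

lemma L1_functionalD:
  assumes "L1_functional M \<Phi> C"
  shows "0 \<le> C"
    and "integrable M f \<Longrightarrow> integrable M g \<Longrightarrow> \<Phi> (\<lambda>x. f x + g x) = \<Phi> f + \<Phi> g"
    and "integrable M f \<Longrightarrow> \<Phi> (\<lambda>x. c * f x) = c * \<Phi> f"
    and "integrable M f \<Longrightarrow> norm (\<Phi> f) \<le> C * L1_norm M f"
    and "integrable M f \<Longrightarrow> integrable M g \<Longrightarrow> \<Phi> (\<lambda>x. f x - g x) = \<Phi> f - \<Phi> g"
    and "integrable M f \<Longrightarrow> integrable M g \<Longrightarrow> norm (\<Phi> f - \<Phi> g) \<le> C * L1_norm M (\<lambda>x. f x - g x)"
proof -
  show C: "0 \<le> C"
    and add: "integrable M f \<Longrightarrow> integrable M g \<Longrightarrow> \<Phi> (\<lambda>x. f x + g x) = \<Phi> f + \<Phi> g"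
    and mult: "integrable M f \<Longrightarrow> \<Phi> (\<lambda>x. c * f x) = c * \<Phi> f"
    and bound: "integrable M f \<Longrightarrow> norm (\<Phi> f) \<le> C * L1_norm M f" for f g c
    using assms by (auto simp: L1_functional_def)
  show diff: "integrable M f \<Longrightarrow> integrable M g \<Longrightarrow> \<Phi> (\<lambda>x. f x - g x) = \<Phi> f - \<Phi> g" for f g
    using add[of f "\<lambda>x. - 1 * g x"] mult[of g "-1"] by simp
  show "integrable M f \<Longrightarrow> integrable M g \<Longrightarrow> norm (\<Phi> f - \<Phi> g) \<le> C * L1_norm M (\<lambda>x. f x - g x)"
    using diff bound[of "\<lambda>x. f x - g x"] by simp
qed

lemma L1_functional_sum:
  assumes "L1_functional M \<Phi> C" "finite I" "\<And>i. i \<in> I \<Longrightarrow> integrable M (f i)"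
  shows "\<Phi> (\<lambda>x. \<Sum>i\<in>I. c i * f i x) = (\<Sum>i\<in>I. c i * \<Phi> (f i))"
  using assms(2,3)
proof (induction I)
  case empty
  show ?case using L1_functionalD(3)[OF assms(1), of "\<lambda>_. 0" 0] by simp
next
  case (insert i I)
  then show ?case
    using L1_functionalD(2)[OF assms(1), of "\<lambda>x. c i * f i x" "\<lambda>x. \<Sum>i\<in>I. c i * f i x"]
      L1_functionalD(3)[OF assms(1), of "f i" "c i"] by simp
qed

lemma L1_functional_integral: "L1_functional M (\<lambda>f. \<integral>x. f x \<partial>M) 1"
  unfolding L1_functional_def L1_norm_def
  by (intro conjI allI impI) (simp_all add: integral_norm_bound)

text \<open>
  Riemann sums for \<open>\<integral>f \<psi>\<close>, where \<open>\<psi>\<close> varies little on each piece. What the pieces leave out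
  contributes the first term of the bound.
\<close>

lemma integral_step_approx:
  fixes f \<psi> :: "'a \<Rightarrow> complex"
  assumes f: "integrable M f" and \<psi>: "\<psi> \<in> borel_measurable M" "\<And>u. norm (\<psi> u) \<le> B"
    and E: "finite I" "\<And>z. z \<in> I \<Longrightarrow> E z \<in> sets M" "disjoint_family_on E I"
    and near: "\<And>z u. z \<in> I \<Longrightarrow> u \<in> E z \<Longrightarrow> norm (\<psi> u - \<psi> z) \<le> d" and d: "0 \<le> d"
  shows "norm ((\<integral>u. f u * \<psi> u \<partial>M) - (\<Sum>z\<in>I. (\<integral>u. f u * indicator (E z) u \<partial>M) * \<psi> z))
    \<le> B * (\<integral>u. norm (f u) * indicator (- (\<Union>z\<in>I. E z)) u \<partial>M) + d * L1_norm M f"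
proof -
  have B: "0 \<le> B" using \<psi>(2) norm_ge_zero order_trans by blast
  have U: "space M - (\<Union>z\<in>I. E z) \<in> sets M" using E by auto
  have int1: "integrable M (\<lambda>u. f u * \<psi> u)"
  proof (rule Bochner_Integration.integrable_bound[of M "\<lambda>u. B * norm (f u)"])
    show "AE u in M. norm (f u * \<psi> u) \<le> norm (B * norm (f u))"
      using \<psi>(2) B by (auto simp: norm_mult mult.commute[of B] intro!: mult_left_mono)
  qed (use f \<psi> in auto)
  have int2: "integrable M (\<lambda>u. f u * indicator (E z) u)" if "z \<in> I" for z
  proof -
    have "f u * indicator (E z) u = indicator (E z) u *\<^sub>R f u" for u
      by (simp add: indicator_def)
    then show ?thesis
      using integrable_mult_indicator[OF E(2)[OF that] f] by simp
  qed
  have int3: "integrable M (\<lambda>u. norm (f u) * indicator (space M - (\<Union>z\<in>I. E z)) u)"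
    using integrable_mult_indicator[OF U integrable_norm[OF f]] by (simp add: mult.commute)
  have cong: "integrable M (\<lambda>u. norm (f u) * indicator (- (\<Union>z\<in>I. E z)) u)"
    using int3 by (rule Bochner_Integration.integrable_cong[THEN iffD1, OF refl, rotated]) (auto simp: indicator_def)
  have expand: "f u * (\<psi> u - (\<Sum>z\<in>I. \<psi> z * indicator (E z) u))
      = f u * \<psi> u - (\<Sum>z\<in>I. (f u * indicator (E z) u) * \<psi> z)" for u
    by (simp add: right_diff_distrib sum_distrib_left mult_ac)
  have "(\<integral>u. f u * \<psi> u \<partial>M) - (\<Sum>z\<in>I. (\<integral>u. f u * indicator (E z) u \<partial>M) * \<psi> z)
      = (\<integral>u. f u * (\<psi> u - (\<Sum>z\<in>I. \<psi> z * indicator (E z) u)) \<partial>M)"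
    using int1 int2 by (simp add: expand)
  also have "norm \<dots> \<le> (\<integral>u. B * (norm (f u) * indicator (- (\<Union>z\<in>I. E z)) u) + d * norm (f u) \<partial>M)"
  proof (rule order_trans[OF integral_norm_bound integral_mono])
    show "integrable M (\<lambda>u. norm (f u * (\<psi> u - (\<Sum>z\<in>I. \<psi> z * indicator (E z) u))))"
      using int1 int2 by (intro integrable_norm) (simp add: expand)
    show "integrable M (\<lambda>u. B * (norm (f u) * indicator (- (\<Union>z\<in>I. E z)) u) + d * norm (f u))"
      using cong f by simp
    fix u
    show "norm (f u * (\<psi> u - (\<Sum>z\<in>I. \<psi> z * indicator (E z) u)))
        \<le> B * (norm (f u) * indicator (- (\<Union>z\<in>I. E z)) u) + d * norm (f u)"
    proof (cases "\<exists>z\<in>I. u \<in> E z")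
      case True
      then obtain z where z: "z \<in> I" "u \<in> E z" by blast
      have "(\<Sum>z\<in>I. \<psi> z * indicator (E z) u) = \<psi> z"
        using sum_indicator_disjoint_family[OF E(3) z(2) E(1) z(1), of \<psi>] by simp
      then have "norm (f u * (\<psi> u - (\<Sum>z\<in>I. \<psi> z * indicator (E z) u))) \<le> norm (f u) * d"
        using near[OF z] by (simp add: norm_mult mult_left_mono)
      then show ?thesis using B by (simp add: mult.commute add_increasing)
    next
      case False
      then have "(\<Sum>z\<in>I. \<psi> z * indicator (E z) u) = 0"
        by (intro sum.neutral) auto
      moreover have "norm (f u) * norm (\<psi> u) \<le> norm (f u) * B"
        using \<psi>(2) by (intro mult_left_mono) auto
      moreover have "u \<in> - (\<Union>z\<in>I. E z)" using False by auto
      ultimately show ?thesis using d by (simp add: norm_mult mult.commute add_increasing2)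
    qed
  qed
  also have "\<dots> = B * (\<integral>u. norm (f u) * indicator (- (\<Union>z\<in>I. E z)) u \<partial>M) + d * L1_norm M f"
    using cong f by (simp add: L1_norm_def)
  finally show ?thesis .
qed

lemma continuous_onI_uniform:
  fixes F :: "'a::topological_ab_group_add \<Rightarrow> complex"
  assumes "\<And>e. 0 < e \<Longrightarrow> \<exists>U. open U \<and> 0 \<in> U \<and> (\<forall>u v. u - v \<in> U \<longrightarrow> norm (F u - F v) \<le> e)"
  shows "continuous_on UNIV F"
  unfolding continuous_on_def
proof (intro ballI tendstoI)
  fix v :: 'a and e :: real assume "0 < e"
  then obtain U where U: "open U" "0 \<in> U" "\<And>u v. u - v \<in> U \<Longrightarrow> norm (F u - F v) \<le> e / 2"
    using assms[of "e / 2"] by auto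
  have "open ((\<lambda>u. u - v) -` U)"
    using U(1) by (intro open_vimage continuous_intros) auto
  moreover have "v \<in> (\<lambda>u. u - v) -` U" using U(2) by simp
  moreover have "dist (F u) (F v) < e" if "u \<in> (\<lambda>u. u - v) -` U" for u
    using U(3)[of u v] that \<open>0 < e\<close> by (simp add: dist_norm)
  ultimately show "\<forall>\<^sub>F u in at v. dist (F u) (F v) < e"
    unfolding eventually_at_topological by blast
qed

context radon_measure
begin

lemma L1_norm_le_on_compact:
  assumes "F \<in> borel_measurable M" "compact L" "\<And>x. x \<notin> L \<Longrightarrow> F x = 0" "\<And>x. norm (F x) \<le> e"
  shows "L1_norm M F \<le> e * measure M L"
proof -
  have L: "L \<in> fmeasurable M" by (rule compact_fmeasurable[OF assms(2)])
  have e: "0 \<le> e" using assms(4) norm_ge_zero order_trans by blast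
  have "L1_norm M F \<le> (\<integral>x. e * indicator L x \<partial>M)"
    unfolding L1_norm_def
  proof (rule integral_mono_AE')
    show "integrable M (\<lambda>x. e * indicator L x)"
      using L by (simp add: fmeasurable_def)
    show "AE x in M. norm (F x) \<le> e * indicator L x"
      using assms(3,4) e by (auto simp: indicator_def)
  qed (use e in auto)
  then show ?thesis using L by (simp add: fmeasurable_def)
qed

text \<open>
  Fubini's theorem for product measures does not apply here: the measure need not be sigma-finite, and Borel functions
  on the product of the group with itself need not be measurable for the product of the Borel sigma-algebras. Instead,
  the integral is a uniform limit of Riemann sums, by compact support also a limit in mean, and a bounded
  functional commutes with such limits of sums.
\<close>

lemma functional_commutes_with_integral:
  fixes h :: "'a \<Rightarrow> 'a \<Rightarrow> complex"
  assumes \<Phi>: "L1_functional M \<Phi> C" and K: "compact K" "compact L"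
    and supp: "\<And>u x. u \<notin> K \<or> x \<notin> L \<Longrightarrow> h u x = 0"
    and unif: "\<And>e. 0 < e \<Longrightarrow> \<exists>U. open U \<and> 0 \<in> U \<and>
        (\<forall>u v x y. u - v \<in> U \<longrightarrow> x - y \<in> U \<longrightarrow> norm (h u x - h v y) \<le> e)"
  shows "(\<lambda>x. \<integral>u. h u x \<partial>M) \<in> Cc"
    and "\<Phi> (\<lambda>x. \<integral>u. h u x \<partial>M) = (\<integral>u. \<Phi> (h u) \<partial>M)"
proof -
  have fK: "K \<in> fmeasurable M" and fL: "L \<in> fmeasurable M"
    using K compact_fmeasurable by auto
  have hx: "h u \<in> Cc" for u
  proof -
    have "continuous_on UNIV (h u)"
      by (rule continuous_onI_uniform) (metis diff_self unif)
    then show ?thesis using supp K by (auto simp: Cc_def)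
  qed
  have hu: "(\<lambda>u. h u x) \<in> Cc" for x
  proof -
    have "continuous_on UNIV (\<lambda>u. h u x)"
      by (rule continuous_onI_uniform) (metis diff_self unif)
    then show ?thesis using supp K by (auto simp: Cc_def)
  qed
  have \<Phi>lip: "norm (\<Phi> (h u) - \<Phi> (h v)) \<le> C * (e * measure M L)" if "\<And>x. norm (h u x - h v x) \<le> e" for u v e
  proof -
    have "norm (\<Phi> (h u) - \<Phi> (h v)) \<le> C * L1_norm M (\<lambda>x. h u x - h v x)"
      using L1_functionalD(6)[OF \<Phi>] Cc_integrable[OF hx] by simp
    also have "\<dots> \<le> C * (e * measure M L)"
      using that supp Cc_integrable[OF hx] L1_functionalD(1)[OF \<Phi>]
      by (intro mult_left_mono L1_norm_le_on_compact K) auto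
    finally show ?thesis .
  qed
  have \<Phi>h: "(\<lambda>u. \<Phi> (h u)) \<in> Cc"
  proof -
    have "continuous_on UNIV (\<lambda>u. \<Phi> (h u))"
    proof (rule continuous_onI_uniform)
      fix e :: real assume e: "0 < e"
      have "0 \<le> C * measure M L" using L1_functionalD(1)[OF \<Phi>] by simp
      then obtain d where d: "0 < d" "C * measure M L * d \<le> e"
        using small_factor e by metis
      then have "C * (d * measure M L) \<le> e" by (simp add: mult_ac)
      moreover obtain U where "open U" "0 \<in> U" "\<And>u v x y. u - v \<in> U \<Longrightarrow> x - y \<in> U \<Longrightarrow> norm (h u x - h v y) \<le> d"
        using unif[OF d(1)] by blast
      ultimately show "\<exists>U. open U \<and> 0 \<in> U \<and> (\<forall>u v. u - v \<in> U \<longrightarrow> norm (\<Phi> (h u) - \<Phi> (h v)) \<le> e)"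
        using \<Phi>lip by (metis diff_self order_trans)
    qed
    moreover have "\<Phi> (h u) = 0" if "u \<notin> K" for u
      using that supp L1_functionalD(3)[OF \<Phi>, of "\<lambda>_. 0" 0] by (simp add: fun_eq_iff[of "h u" "\<lambda>_. 0", THEN iffD2])
    ultimately show ?thesis using K(1) by (auto simp: Cc_def)
  qed
  show HCc: "(\<lambda>x. \<integral>u. h u x \<partial>M) \<in> Cc"
  proof -
    have "continuous_on UNIV (\<lambda>x. \<integral>u. h u x \<partial>M)"
    proof (rule continuous_onI_uniform)
      fix e :: real assume e: "0 < e"
      obtain d where d: "0 < d" "measure M K * d \<le> e"
        using small_factor[OF measure_nonneg e] by metis
      obtain U where U: "open U" "0 \<in> U" "\<And>u v x y. u - v \<in> U \<Longrightarrow> x - y \<in> U \<Longrightarrow> norm (h u x - h v y) \<le> d"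
        using unif[OF d(1)] by blast
      have "norm ((\<integral>u. h u x \<partial>M) - (\<integral>u. h u y \<partial>M)) \<le> e" if "x - y \<in> U" for x y
      proof -
        have "norm ((\<integral>u. h u x \<partial>M) - (\<integral>u. h u y \<partial>M)) = norm (\<integral>u. h u x - h u y \<partial>M)"
          using Cc_integrable[OF hu] by simp
        also have "\<dots> \<le> L1_norm M (\<lambda>u. h u x - h u y)"
          unfolding L1_norm_def by (rule integral_norm_bound)
        also have "\<dots> \<le> d * measure M K"
          using U that supp Cc_integrable[OF hu] by (intro L1_norm_le_on_compact K) auto
        finally show ?thesis using d(2) by (simp add: mult.commute)
      qed
      then show "\<exists>U. open U \<and> 0 \<in> U \<and> (\<forall>x y. x - y \<in> U \<longrightarrow> norm ((\<integral>u. h u x \<partial>M) - (\<integral>u. h u y \<partial>M)) \<le> e)"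
        using U by blast
    qed
    then show ?thesis using K supp unfolding Cc_def by (auto intro!: exI[of _ L])
  qed
  have bound: "norm (\<Phi> (\<lambda>x. \<integral>u. h u x \<partial>M) - (\<integral>u. \<Phi> (h u) \<partial>M)) \<le> 2 * C * measure M K * measure M L * e" if e: "0 < e" for e
  proof -
    obtain U where U: "open U" "0 \<in> U" "\<And>u v x y. u - v \<in> U \<Longrightarrow> x - y \<in> U \<Longrightarrow> norm (h u x - h v y) \<le> e"
      using unif[OF e] by blast
    obtain I E where E: "finite I" "I \<subseteq> K" "\<And>z. E z \<in> sets borel" "disjoint_family_on E I"
      "(\<Union>z\<in>I. E z) = K" "\<And>z u. z \<in> I \<Longrightarrow> u \<in> E z \<Longrightarrow> u - z \<in> U"
      by (rule compact_borel_partition[OF K(1) U(1,2)], rule that)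
    define m where "m z = (\<integral>u. indicator K u * indicator (E z) u \<partial>M :: complex)" for z
    have fK': "integrable M (indicator K :: 'a \<Rightarrow> complex)"
    proof -
      have "(indicator K :: 'a \<Rightarrow> complex) = (\<lambda>u. complex_of_real (indicator K u))"
        by (auto simp: indicator_def)
      then show ?thesis using fK by (simp add: fmeasurable_def)
    qed
    have nK: "L1_norm M (indicator K :: 'a \<Rightarrow> complex) = measure M K"
    proof -
      have "norm (indicator K u :: complex) = indicator K u" for u
        by (simp add: indicator_def)
      then show ?thesis using fK by (simp add: L1_norm_def fmeasurable_def)
    qed
    have tail: "(\<integral>u. norm (indicator K u :: complex) * indicator (- (\<Union>z\<in>I. E z)) u \<partial>M) = 0"
      unfolding E(5) by (auto intro!: integral_eq_zero_AE simp: indicator_def)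
    \<comment> \<open>Both integrals over \<open>K\<close> are compared with Riemann sums over the same pieces.\<close>
    have step: "norm ((\<integral>u. \<psi> u \<partial>M) - (\<Sum>z\<in>I. m z * \<psi> z)) \<le> d * measure M K"
      if "\<psi> \<in> Cc" "\<And>u. u \<notin> K \<Longrightarrow> \<psi> u = 0" "\<And>z u. z \<in> I \<Longrightarrow> u \<in> E z \<Longrightarrow> norm (\<psi> u - \<psi> z) \<le> d" "0 \<le> d"
      for \<psi> :: "'a \<Rightarrow> complex" and d
    proof -
      note \<psi> = that
      obtain B where B: "\<And>u. norm (\<psi> u) \<le> B" using CcE[OF \<psi>(1)] by metis
      have eq: "(\<lambda>u. indicator K u * \<psi> u) = \<psi>" using \<psi>(2) by (auto simp: indicator_def fun_eq_iff)
      have "norm ((\<integral>u. \<psi> u \<partial>M) - (\<Sum>z\<in>I. m z * \<psi> z))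
          = norm ((\<integral>u. indicator K u * \<psi> u \<partial>M) - (\<Sum>z\<in>I. (\<integral>u. indicator K u * indicator (E z) u \<partial>M) * \<psi> z))"
        by (simp only: m_def eq)
      also have "\<dots> \<le> B * (\<integral>u. norm (indicator K u :: complex) * indicator (- (\<Union>z\<in>I. E z)) u \<partial>M)
          + d * L1_norm M (indicator K :: 'a \<Rightarrow> complex)"
        using fK' Cc_integrable[OF \<psi>(1)] B E \<psi>(3,4) by (intro integral_step_approx) auto
      finally show ?thesis by (simp only: tail nK mult_zero_right add_0)
    qed
    define S where "S x = (\<Sum>z\<in>I. m z * h z x)" for x
    have S: "integrable M S"
      unfolding S_def using Cc_integrable[OF hx] by simp
    have "norm ((\<integral>u. h u x \<partial>M) - S x) \<le> e * measure M K" for x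
      unfolding S_def using step[OF hu, of x e] E(6) U e supp by (metis diff_self less_imp_le)
    moreover have "(\<integral>u. h u x \<partial>M) - S x = 0" if "x \<notin> L" for x
      using that supp by (simp add: S_def)
    ultimately have "L1_norm M (\<lambda>x. (\<integral>u. h u x \<partial>M) - S x) \<le> (e * measure M K) * measure M L"
      using S Cc_integrable[OF HCc] by (intro L1_norm_le_on_compact K) auto
    then have 1: "norm (\<Phi> (\<lambda>x. \<integral>u. h u x \<partial>M) - \<Phi> S) \<le> C * (e * measure M K * measure M L)"
      using L1_functionalD(6)[OF \<Phi> Cc_integrable[OF HCc] S] mult_left_mono[OF _ L1_functionalD(1)[OF \<Phi>]]
      by (meson order_trans)
    have "norm ((\<integral>u. \<Phi> (h u) \<partial>M) - (\<Sum>z\<in>I. m z * \<Phi> (h z))) \<le> (C * (e * measure M L)) * measure M K"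
    proof (rule step[OF \<Phi>h])
      show "\<Phi> (h u) = 0" if "u \<notin> K" for u
        using that supp L1_functionalD(3)[OF \<Phi>, of "\<lambda>_. 0" 0] by (simp add: fun_eq_iff[of "h u" "\<lambda>_. 0", THEN iffD2])
      show "norm (\<Phi> (h u) - \<Phi> (h z)) \<le> C * (e * measure M L)" if "z \<in> I" "u \<in> E z" for z u
        using \<Phi>lip U E(6)[OF that] by simp
      show "0 \<le> C * (e * measure M L)"
        using e L1_functionalD(1)[OF \<Phi>] by simp
    qed
    moreover have "\<Phi> S = (\<Sum>z\<in>I. m z * \<Phi> (h z))"
      unfolding S_def using L1_functional_sum[OF \<Phi> E(1)] Cc_integrable[OF hx] by simp
    ultimately have 2: "norm ((\<integral>u. \<Phi> (h u) \<partial>M) - \<Phi> S) \<le> C * (e * measure M L) * measure M K" by simp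
    have "norm (\<Phi> (\<lambda>x. \<integral>u. h u x \<partial>M) - (\<integral>u. \<Phi> (h u) \<partial>M))
        \<le> norm (\<Phi> (\<lambda>x. \<integral>u. h u x \<partial>M) - \<Phi> S) + norm ((\<integral>u. \<Phi> (h u) \<partial>M) - \<Phi> S)"
      using norm_triangle_ineq4[of "\<Phi> (\<lambda>x. \<integral>u. h u x \<partial>M) - \<Phi> S" "(\<integral>u. \<Phi> (h u) \<partial>M) - \<Phi> S"] by simp
    then show ?thesis using 1 2 by (simp add: algebra_simps)
  qed
  have "norm (\<Phi> (\<lambda>x. \<integral>u. h u x \<partial>M) - (\<integral>u. \<Phi> (h u) \<partial>M)) \<le> 0"
  proof (rule field_le_epsilon)
    fix e :: real assume e: "0 < e"
    define c where "c = 2 * C * measure M K * measure M L"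
    have c: "0 \<le> c" using L1_functionalD(1)[OF \<Phi>] by (simp add: c_def)
    obtain d where "0 < d" "c * d \<le> e" using small_factor[OF c e] by metis
    then show "norm (\<Phi> (\<lambda>x. \<integral>u. h u x \<partial>M) - (\<integral>u. \<Phi> (h u) \<partial>M)) \<le> 0 + e"
      using bound[of d] by (simp add: c_def)
  qed
  then show "\<Phi> (\<lambda>x. \<integral>u. h u x \<partial>M) = (\<integral>u. \<Phi> (h u) \<partial>M)" by simp
qed

end

section \<open>Invariance under inversion and continuity of translation\<close>

locale haar = radon_measure M for M :: "'a::{topological_ab_group_add, t2_space} measure" +
  assumes nonzero: "emeasure M UNIV \<noteq> 0"
    and translation_invariant: "A \<in> sets borel \<Longrightarrow> emeasure M ((\<lambda>x. a + x) ` A) = emeasure M A"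
begin

lemma measurable_compose_continuous:
  assumes "f \<in> borel_measurable M" "continuous_on UNIV s"
  shows "(\<lambda>u. f (s u)) \<in> borel_measurable M"
  using measurable_compose[OF borel_measurable_continuous_onI[OF assms(2)], of f borel] assms(1)
  by (simp cong: measurable_cong_sets)

lemma distr_translate: "distr M M (\<lambda>x. a + x) = M"
proof (rule measure_eqI)
  fix A assume A: "A \<in> sets (distr M M ((+) a))"
  have meas: "(+) a \<in> measurable M M"
    using borel_measurable_continuous_onI[of "(+) a"] by (simp add: continuous_intros cong: measurable_cong_sets)
  have "(+) a -` A = (\<lambda>x. - a + x) ` A"
    by (auto simp: image_iff intro!: bexI[of _ "a + _"])
  then show "emeasure (distr M M ((+) a)) A = emeasure M A"
    using A meas translation_invariant[of A "- a"] by (simp add: emeasure_distr)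
qed simp

end

lemma (in radon_measure) integrable_distr_invariant:
  fixes g :: "'a \<Rightarrow> 'b::{banach, second_countable_topology}"
  assumes "distr M M s = M" "continuous_on UNIV s" "integrable M g"
  shows "integrable M (\<lambda>x. g (s x))" "(\<integral>x. g (s x) \<partial>M) = (\<integral>x. g x \<partial>M)"
proof -
  have s: "s \<in> measurable M M"
    using borel_measurable_continuous_onI[OF assms(2)] by (simp cong: measurable_cong_sets)
  show "integrable M (\<lambda>x. g (s x))"
    using integrable_distr[OF s, of g] assms by simp
  show "(\<integral>x. g (s x) \<partial>M) = (\<integral>x. g x \<partial>M)"
    using integral_distr[OF s, of g] assms by simp
qed

definition shift :: "'a::ab_group_add \<Rightarrow> ('a \<Rightarrow> complex) \<Rightarrow> 'a \<Rightarrow> complex" where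
  "shift u g = (\<lambda>x. g (x - u))"

lemma shift_shift: "shift u (shift v g) = shift (u + v) g"
  by (simp add: shift_def algebra_simps)

lemma shift_0 [simp]: "shift 0 g = g"
  by (simp add: shift_def)

lemma continuous_on_shift:
  fixes g :: "'a::topological_ab_group_add \<Rightarrow> complex"
  assumes "continuous_on UNIV g"
  shows "continuous_on UNIV (\<lambda>x. g (x - u))" "continuous_on UNIV (\<lambda>u. g (x - u))" "continuous_on UNIV (\<lambda>u. g (- u))"
  by (rule continuous_on_compose2[OF assms]; auto intro!: continuous_intros)+

lemma Cc_shift:
  fixes g :: "'a::topological_ab_group_add \<Rightarrow> complex"
  assumes "g \<in> Cc"
  shows "shift u g \<in> Cc" "(\<lambda>x. g (- x)) \<in> Cc"
proof -
  obtain K B where K: "continuous_on UNIV g" "compact K" "\<And>x. x \<notin> K \<Longrightarrow> g x = 0"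
    using CcE[OF assms] by metis
  have "g (x - u) = 0" if "x \<notin> (+) u ` K" for x
    using that K(3)[of "x - u"] by (force simp: image_iff)
  then show "shift u g \<in> Cc"
    using K compact_translate[OF K(2), of u] continuous_on_shift(1)[OF K(1)]
    by (auto simp: Cc_def shift_def)
  have "g (- x) = 0" if "x \<notin> uminus ` K" for x
    using that K(3)[of "- x"] by (force simp: image_iff)
  moreover have "compact (uminus ` K)"
    using K(2) by (intro compact_continuous_image continuous_intros)
  ultimately show "(\<lambda>x. g (- x)) \<in> Cc"
    using continuous_on_shift(3)[OF K(1)] by (auto simp: Cc_def)
qed

text \<open>
  The two choices of \<open>s\<close> serve the integrands \<open>f(u) g(x + u)\<close> and \<open>f(u) g(x - u)\<close>.
\<close>

lemma uniform_product_family: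
  fixes f g s :: "'a::topological_ab_group_add \<Rightarrow> _"
  assumes f: "f \<in> Cc" and g: "g \<in> Cc" and s: "s = id \<or> s = uminus" and e: "0 < (e::real)"
  shows "\<exists>U. open U \<and> 0 \<in> U \<and> (\<forall>u v x y. u - v \<in> U \<longrightarrow> x - y \<in> U \<longrightarrow>
    norm (f u * g (x + s u) - f v * g (y + s v)) \<le> e)"
proof -
  obtain K A where K: "continuous_on UNIV f" "compact K" "\<And>x. x \<notin> K \<Longrightarrow> f x = 0" "\<And>x. norm (f x) \<le> A" "0 \<le> A"
    using CcE[OF f] by metis
  obtain L B where L: "continuous_on UNIV g" "compact L" "\<And>x. x \<notin> L \<Longrightarrow> g x = 0" "\<And>x. norm (g x) \<le> B" "0 \<le> B"
    using CcE[OF g] by metis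
  obtain d where d: "0 < d" "(A + B) * d \<le> e"
    using small_factor[of "A + B" e] K(5) L(5) e by (metis add_nonneg_nonneg)
  have dd: "d * B + A * d \<le> e" using d(2) by (simp add: algebra_simps)
  obtain V where V: "open V" "0 \<in> V" "\<And>x v. v \<in> V \<Longrightarrow> norm (f (x + v) - f x) < d"
    using uniformly_continuous_compact_support[OF K(1-3) d(1)] by metis
  obtain W where W: "open W" "0 \<in> W" "\<And>x v. v \<in> W \<Longrightarrow> norm (g (x + v) - g x) < d"
    using uniformly_continuous_compact_support[OF L(1-3) d(1)] by metis
  obtain W' where W': "open W'" "0 \<in> W'" "\<And>x. x \<in> W' \<Longrightarrow> - x \<in> W'" "\<And>x y. x \<in> W' \<Longrightarrow> y \<in> W' \<Longrightarrow> x + y \<in> W"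
    using symmetric_half_nbhd[OF W(1,2)] by metis
  show ?thesis
  proof (intro exI[of _ "V \<inter> W'"] conjI allI impI)
    fix u v x y assume uv: "u - v \<in> V \<inter> W'" "x - y \<in> V \<inter> W'"
    have eq: "(x + s u) - (y + s v) = (x - y) + s (u - v)"
      using s by (auto simp: algebra_simps)
    have "s (u - v) \<in> W'" using s uv W'(3)[of "u - v"] by auto
    then have "(x + s u) - (y + s v) \<in> W"
      unfolding eq using W'(4) uv by blast
    then have 1: "norm (g (x + s u) - g (y + s v)) \<le> d"
      using W(3)[of "(x + s u) - (y + s v)" "y + s v"] by simp
    have 2: "norm (f u - f v) \<le> d"
      using V(3)[of "u - v" v] uv by simp
    have "f u * g (x + s u) - f v * g (y + s v) = (f u - f v) * g (x + s u) + f v * (g (x + s u) - g (y + s v))"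
      by (simp add: algebra_simps)
    also have "norm \<dots> \<le> d * B + A * d"
      using 1 2 K(4,5) L(4,5) d(1)
      by (intro order_trans[OF norm_triangle_ineq] add_mono) (auto simp: norm_mult intro!: mult_mono)
    finally show "norm (f u * g (x + s u) - f v * g (y + s v)) \<le> e" using dd by simp
  qed (use V W' in auto)
qed

context haar
begin

lemma functional_of_product_family:
  assumes \<Phi>: "L1_functional M \<Phi> C" and f: "f \<in> Cc" and g: "g \<in> Cc" and s: "s = id \<or> s = uminus"
  shows "(\<lambda>x. \<integral>u. f u * g (x + s u) \<partial>M) \<in> Cc"
    and "\<Phi> (\<lambda>x. \<integral>u. f u * g (x + s u) \<partial>M) = (\<integral>u. f u * \<Phi> (\<lambda>x. g (x + s u)) \<partial>M)"
proof -
  obtain K where K: "compact K" "\<And>x. x \<notin> K \<Longrightarrow> f x = 0"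
    using f by (auto simp: Cc_def)
  obtain L where L: "compact L" "\<And>x. x \<notin> L \<Longrightarrow> g x = 0"
    using g by (auto simp: Cc_def)
  define L' where "L' = (\<lambda>p. fst p + snd p) ` (L \<times> (\<lambda>u. - s u) ` K)"
  have "continuous_on K (\<lambda>u. - s u)"
    using s by (auto intro!: continuous_intros simp: id_def)
  then have "compact L'"
    unfolding L'_def using K L by (intro compact_add compact_continuous_image)
  have supp: "f u * g (x + s u) = 0" if "u \<notin> K \<or> x \<notin> L'" for u x
  proof (cases "u \<in> K \<and> x + s u \<in> L")
    case True
    then have "(x + s u, - s u) \<in> L \<times> (\<lambda>u. - s u) ` K" by auto
    then have "x \<in> L'" unfolding L'_def by (rule rev_image_eqI) simp
    then show ?thesis using that True by auto
  qed (use K L in auto)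
  note fc = functional_commutes_with_integral[OF \<Phi> K(1) \<open>compact L'\<close> supp uniform_product_family[OF f g s]]
  show "(\<lambda>x. \<integral>u. f u * g (x + s u) \<partial>M) \<in> Cc" by (rule fc(1))
  have "integrable M (\<lambda>x. g (x + s u))" for u
    using Cc_integrable[OF Cc_shift(1)[OF g, of "- s u"]] by (simp add: shift_def)
  then have "\<Phi> (\<lambda>x. f u * g (x + s u)) = f u * \<Phi> (\<lambda>x. g (x + s u))" for u
    by (rule L1_functionalD(3)[OF \<Phi>])
  then show "\<Phi> (\<lambda>x. \<integral>u. f u * g (x + s u) \<partial>M) = (\<integral>u. f u * \<Phi> (\<lambda>x. g (x + s u)) \<partial>M)"
    using fc(2) by simp
qed

lemma integral_translate:
  fixes g :: "'a \<Rightarrow> 'b::{banach, second_countable_topology}"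
  assumes "integrable M g"
  shows "integrable M (\<lambda>x. g (a + x))" "(\<integral>x. g (a + x) \<partial>M) = (\<integral>x. g x \<partial>M)"
    and "integrable M (\<lambda>x. g (x + a))" "(\<integral>x. g (x + a) \<partial>M) = (\<integral>x. g x \<partial>M)"
    and "integrable M (\<lambda>x. g (x - a))" "(\<integral>x. g (x - a) \<partial>M) = (\<integral>x. g x \<partial>M)"
proof -
  show *: "integrable M (\<lambda>x. g (a + x))" "(\<integral>x. g (a + x) \<partial>M) = (\<integral>x. g x \<partial>M)" for a
    using integrable_distr_invariant[OF distr_translate _ assms, of a] by (simp_all add: continuous_intros)
  show "integrable M (\<lambda>x. g (x + a))" "(\<integral>x. g (x + a) \<partial>M) = (\<integral>x. g x \<partial>M)"
    using *[of a] by (simp_all add: add.commute)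
  show "integrable M (\<lambda>x. g (x - a))" "(\<integral>x. g (x - a) \<partial>M) = (\<integral>x. g x \<partial>M)"
    using *[of "- a"] by simp_all
qed

lemma Cc_nonzero_integral: "\<exists>f\<in>Cc. (\<integral>x. f x \<partial>M) \<noteq> 0"
proof -
  have "\<exists>K. compact K \<and> emeasure M K \<noteq> 0"
  proof (rule ccontr)
    assume "\<nexists>K. compact K \<and> emeasure M K \<noteq> 0"
    then have "emeasure M UNIV \<le> 0"
      by (subst inner_regular) (auto simp: SUP_constant bot_ennreal)
    then show False using nonzero by simp
  qed
  then obtain K where K: "compact K" "emeasure M K \<noteq> 0" by blast
  obtain g where g: "\<And>x. 0 \<le> g x" "\<And>x. x \<in> K \<Longrightarrow> g x = 1" "(\<lambda>x. complex_of_real (g x)) \<in> Cc"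
    using urysohn_bump[OF K(1) open_UNIV] by (metis subset_UNIV)
  have ig: "integrable M g"
    using integrable_Re[OF Cc_integrable[OF g(3)]] by simp
  have fK: "K \<in> fmeasurable M" by (rule compact_fmeasurable[OF K(1)])
  have "0 < measure M K"
    using K fK by (auto simp: fmeasurable_def zero_less_measure_iff emeasure_eq_measure2[OF fK])
  also have "measure M K = (\<integral>x. indicator K x \<partial>M)" using fK by (simp add: fmeasurable_def)
  also have "\<dots> \<le> (\<integral>x. g x \<partial>M)"
    using fK ig g by (intro integral_mono) (auto simp: fmeasurable_def split: split_indicator)
  finally have "(\<integral>x. complex_of_real (g x) \<partial>M) \<noteq> 0" by simp
  then show ?thesis using g(3) by blast
qed

text \<open>
  For two continuous functions of compact support,
  \<open>\<integral>f \<cdot> \<integral>g(-y) = \<integral>\<integral> f(u) g(u - y) = \<integral>\<integral> f(u + y) g(u) = \<integral>f \<cdot> \<integral>g\<close>, by interchanging the order of integration twice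
  and translating in between. Then \<open>f\<close> is chosen with nonzero integral.
\<close>

lemma integral_reflect_Cc:
  assumes g: "g \<in> Cc"
  shows "(\<integral>y. g (- y) \<partial>M) = (\<integral>y. g y \<partial>M)"
proof -
  obtain f where f: "f \<in> Cc" "(\<integral>x. f x \<partial>M) \<noteq> 0" using Cc_nonzero_integral by blast
  note g' = Cc_shift(2)[OF g]
  have "(\<integral>u. f u \<partial>M) * (\<integral>y. g (- y) \<partial>M) = (\<integral>u. f u * (\<integral>y. g (- (y + - u)) \<partial>M) \<partial>M)"
  proof -
    have "(\<integral>y. g (- (y + - u)) \<partial>M) = (\<integral>y. g (- y) \<partial>M)" for u
      by (rule integral_translate(4)[OF Cc_integrable[OF g']])
    then show ?thesis by (simp only: integral_mult_left_zero)
  qed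
  also have "\<dots> = (\<integral>y. \<integral>u. f u * g (- (y + - u)) \<partial>M \<partial>M)"
    using functional_of_product_family(2)[OF L1_functional_integral f(1) g', of uminus] by simp
  also have "\<dots> = (\<integral>y. \<integral>u. g u * f (y + u) \<partial>M \<partial>M)"
  proof (rule Bochner_Integration.integral_cong[OF refl])
    fix y
    have "(\<lambda>u. f u * g (- (y + - u))) \<in> Cc"
    proof -
      have "continuous_on UNIV (\<lambda>u. f u * g (- (y + - u)))"
        using f(1) g by (auto intro!: continuous_intros continuous_on_compose2[of UNIV g] simp: Cc_def)
      moreover obtain K where "compact K" "\<And>x. x \<notin> K \<Longrightarrow> f x = 0"
        using f(1) by (auto simp: Cc_def)
      ultimately show ?thesis
        unfolding Cc_def by (intro CollectI conjI exI[of _ K]) simp_all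
    qed
    from integral_translate(2)[OF Cc_integrable[OF this], of y]
    show "(\<integral>u. f u * g (- (y + - u)) \<partial>M) = (\<integral>u. g u * f (y + u) \<partial>M)"
      by (simp add: mult.commute)
  qed
  also have "\<dots> = (\<integral>u. g u * (\<integral>y. f (y + u) \<partial>M) \<partial>M)"
    using functional_of_product_family(2)[OF L1_functional_integral g f(1), of id] by simp
  also have "\<dots> = (\<integral>u. f u \<partial>M) * (\<integral>y. g y \<partial>M)"
    using integral_translate(4)[OF Cc_integrable[OF f(1)]] by (simp add: mult.commute)
  finally show ?thesis using f(2) by simp
qed

text \<open>
  An Urysohn function carries the invariance from integrals to the measure of a compact set, by outer regularity.
\<close>

lemma emeasure_reflect_compact:
  assumes "compact K"
  shows "emeasure M (uminus ` K) = emeasure M K"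
proof -
  have le: "measure M (uminus ` A) \<le> measure M A" if A: "compact A" for A
  proof (rule field_le_epsilon)
    fix e :: real assume e: "0 < e"
    obtain W L where WL: "open W" "compact L" "A \<subseteq> W" "W \<subseteq> L"
      using compact_open_nbhd[OF A] by blast
    have fA: "A \<in> fmeasurable M" "uminus ` A \<in> fmeasurable M"
      using A by (auto intro!: compact_fmeasurable compact_continuous_image continuous_intros)
    have W: "W \<in> fmeasurable M"
      using WL by (intro fmeasurableI2[OF compact_fmeasurable[OF WL(2)]]) auto
    obtain V where V: "open V" "A \<subseteq> V" "V \<subseteq> W" "measure M (V - A) < e"
      using outer_approx[of A W e] A WL W e by (auto simp: compact_imp_closed borel_closed)
    have fV: "V \<in> fmeasurable M" using V by (intro fmeasurableI2[OF W]) auto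
    obtain g where g: "\<And>x. 0 \<le> g x" "\<And>x. g x \<le> 1" "\<And>x. x \<in> A \<Longrightarrow> g x = 1" "\<And>x. x \<notin> V \<Longrightarrow> g x = 0"
        "(\<lambda>x. complex_of_real (g x)) \<in> Cc"
      using urysohn_bump[OF A V(1,2)] by metis
    have ig: "integrable M g" "integrable M (\<lambda>x. g (- x))"
      using integrable_Re[OF Cc_integrable[OF g(5)]] integrable_Re[OF Cc_integrable[OF Cc_shift(2)[OF g(5)]]] by simp_all
    have "measure M (uminus ` A) = (\<integral>x. indicator (uminus ` A) x \<partial>M)"
      using fA by (simp add: fmeasurable_def)
    also have "\<dots> \<le> (\<integral>x. g (- x) \<partial>M)"
      using fA ig g by (intro integral_mono) (auto simp: fmeasurable_def split: split_indicator)
    also have "\<dots> = (\<integral>x. g x \<partial>M)"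
      using integral_reflect_Cc[OF g(5)] by simp
    also have "\<dots> \<le> (\<integral>x. indicator V x \<partial>M)"
      using fV ig g by (intro integral_mono) (auto simp: fmeasurable_def split: split_indicator)
    also have "\<dots> = measure M V" using fV by (simp add: fmeasurable_def)
    also have "\<dots> = measure M A + measure M (V - A)"
      using measurable_measure_Diff[OF fV fmeasurableD[OF fA(1)] V(2)] by simp
    finally show "measure M (uminus ` A) \<le> measure M A + e" using V by simp
  qed
  have cK: "compact (uminus ` K)"
    using assms by (intro compact_continuous_image continuous_intros)
  have "measure M (uminus ` K) = measure M K"
    using le[OF assms] le[OF cK] by (simp add: image_image)
  then show ?thesis
    using compact_fmeasurable[OF cK] compact_fmeasurable[OF assms] by (simp add: emeasure_eq_measure2)
qed

lemma distr_reflect: "distr M M uminus = M"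
proof (rule measure_eqI)
  fix A assume "A \<in> sets (distr M M uminus)"
  then have A: "A \<in> sets borel" by simp
  have meas: "uminus \<in> measurable M M"
    using borel_measurable_continuous_onI[of "uminus :: 'a \<Rightarrow> 'a"] by (simp add: continuous_intros cong: measurable_cong_sets)
  have eq: "uminus -` B = uminus ` B" for B :: "'a set"
    by (auto simp: image_iff intro!: bexI[of _ "- _"])
  have meas': "uminus ` B \<in> sets borel" if "B \<in> sets borel" for B :: "'a set"
    using measurable_sets[OF meas, of B] that by (simp add: eq)
  have le: "emeasure M (uminus ` B) \<le> emeasure M B" if B: "B \<in> sets borel" for B
  proof -
    have "emeasure M K \<le> emeasure M B" if K: "compact K" "K \<subseteq> uminus ` B" for K
    proof -
      have "uminus ` K \<subseteq> B" using K(2) by force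
      then have "emeasure M (uminus ` K) \<le> emeasure M B"
        using B by (intro emeasure_mono) auto
      then show ?thesis using emeasure_reflect_compact[OF K(1)] by simp
    qed
    then show ?thesis
      using inner_regular[OF meas'[OF B]] by (auto intro!: SUP_least)
  qed
  have "emeasure M (uminus ` A) = emeasure M A"
    using le[OF A] le[OF meas'[OF A]] by (simp add: image_image)
  then show "emeasure (distr M M uminus) A = emeasure M A"
    using A meas by (simp add: emeasure_distr eq)
qed simp

lemma integral_reflect:
  fixes g :: "'a \<Rightarrow> 'b::{banach, second_countable_topology}"
  assumes "integrable M g"
  shows "integrable M (\<lambda>u. g (x - u))" "(\<integral>u. g (x - u) \<partial>M) = (\<integral>u. g u \<partial>M)"
proof -
  note r = integrable_distr_invariant[OF distr_reflect _ integral_translate(1)[OF assms, of x]]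
  show "integrable M (\<lambda>u. g (x - u))" "(\<integral>u. g (x - u) \<partial>M) = (\<integral>u. g u \<partial>M)"
    using r integral_translate(2)[OF assms, of x] by (simp_all add: continuous_intros)
qed

lemma distr_reflect_translate: "distr M M (\<lambda>u. x - u) = M"
proof -
  have "distr (distr M M uminus) M ((+) x) = distr M M ((+) x \<circ> uminus)"
    using borel_measurable_continuous_onI[of "uminus :: 'a \<Rightarrow> 'a"] borel_measurable_continuous_onI[of "(+) x"]
    by (intro distr_distr) (auto simp: continuous_intros cong: measurable_cong_sets)
  then show ?thesis by (simp add: distr_reflect distr_translate o_def)
qed

lemma AE_reflect:
  assumes "AE u in M. P u"
  shows "AE u in M. P (x - u)"
proof -
  have "(\<lambda>u. x - u) \<in> measurable M M"
    using borel_measurable_continuous_onI[of "\<lambda>u. x - u"] by (simp add: continuous_intros cong: measurable_cong_sets)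
  moreover have "AE u in distr M M (\<lambda>u. x - u). P u"
    by (subst distr_reflect_translate) (rule assms)
  ultimately show ?thesis by (rule AE_distrD)
qed

lemma shift_L1:
  assumes "integrable M g"
  shows "integrable M (shift u g)" "L1_norm M (shift u g) = L1_norm M g"
  using integral_translate(5)[OF assms, of u] integral_translate(6)[OF integrable_norm[OF assms], of u]
  by (simp_all add: shift_def L1_norm_def)

lemma shift_L1_diff:
  assumes "integrable M g" "integrable M h"
  shows "L1_norm M (\<lambda>x. shift u g x - shift u h x) = L1_norm M (\<lambda>x. g x - h x)"
  using shift_L1(2)[of "\<lambda>x. g x - h x" u] assms by (simp add: shift_def)

text \<open>
  For a continuous function of compact support this is uniform continuity, and translation is isometric, so density
  does the rest.
\<close>

lemma translation_continuous:
  assumes g: "integrable M g" and e: "0 < e"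
  obtains U where "open U" "0 \<in> U" "\<And>x. x \<in> U \<Longrightarrow> - x \<in> U" "\<And>u. u \<in> U \<Longrightarrow> L1_norm M (\<lambda>x. shift u g x - g x) < e"
proof -
  obtain h where h: "h \<in> Cc" "L1_norm M (\<lambda>x. g x - h x) < e / 4"
    using Cc_dense[OF g, of "e / 4"] e by auto
  note ih = Cc_integrable[OF h(1)]
  obtain K where K: "continuous_on UNIV h" "compact K" "\<And>x. x \<notin> K \<Longrightarrow> h x = 0"
    using h(1) by (auto simp: Cc_def)
  obtain U0 C where U0: "open U0" "(0::'a) \<in> U0" "U0 \<subseteq> C" "compact C"
    using locally_compact by blast
  define L where "L = (\<lambda>p. fst p + snd p) ` (K \<times> C) \<union> K"
  have L: "compact L" unfolding L_def using compact_add[OF K(2) U0(4)] K(2) by (intro compact_Un)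
  obtain d where d: "0 < d" "measure M L * d \<le> e / 4"
    using small_factor[of "measure M L" "e / 4"] e by (metis measure_nonneg zero_less_divide_iff zero_less_numeral)
  have dL: "d * measure M L \<le> e / 4" using d(2) by (simp add: mult.commute)
  obtain V where V: "open V" "0 \<in> V" "\<And>x. x \<in> V \<Longrightarrow> - x \<in> V" "\<And>x v. v \<in> V \<Longrightarrow> norm (h (x + v) - h x) < d"
    using uniformly_continuous_compact_support[OF K d(1)] by metis
  obtain U where U: "open U" "0 \<in> U" "U \<subseteq> V \<inter> U0" "\<And>x. x \<in> U \<Longrightarrow> - x \<in> U"
    using symmetric_nbhd[of "V \<inter> U0"] V U0 by (metis IntI open_Int)
  show thesis
  proof (rule that[OF U(1,2,4)])
    fix u assume u: "u \<in> U"
    have "L1_norm M (\<lambda>x. shift u h x - h x) \<le> d * measure M L"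
    proof (rule L1_norm_le_on_compact[OF _ L])
      show "(\<lambda>x. shift u h x - h x) \<in> borel_measurable M"
        using ih shift_L1(1)[OF ih, of u] by auto
      fix x
      show "norm (shift u h x - h x) \<le> d"
        using V(4)[of "- u" x] V(3) u U(3) by (force simp: shift_def)
      assume x: "x \<notin> L"
      have "x - u \<notin> K"
      proof
        assume "x - u \<in> K"
        then have "(x - u, u) \<in> K \<times> C" using u U(3) U0(3) by auto
        then have "x \<in> L" unfolding L_def by (intro UnI1) (rule rev_image_eqI, auto)
        then show False using x by simp
      qed
      then show "shift u h x - h x = 0"
        using K(3) x by (auto simp: L_def shift_def)
    qed
    then have 1: "L1_norm M (\<lambda>x. shift u h x - h x) \<le> e / 4" using dL by simp
    have 2: "L1_norm M (\<lambda>x. shift u g x - shift u h x) < e / 4"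
      using h(2) shift_L1_diff[OF g ih] by simp
    have "L1_norm M (\<lambda>x. shift u g x - g x) \<le> L1_norm M (\<lambda>x. shift u g x - shift u h x)
        + (L1_norm M (\<lambda>x. shift u h x - h x) + L1_norm M (\<lambda>x. h x - g x))"
      using L1_norm_triangle_minus[of M "shift u g" "shift u h" g] L1_norm_triangle_minus[of M "shift u h" h g]
        g ih shift_L1(1) by fastforce
    then show "L1_norm M (\<lambda>x. shift u g x - g x) < e"
      using 1 2 h(2) L1_norm_minus_commute[of M h g] e by linarith
  qed
qed

end

section \<open>Convolution\<close>

context haar
begin

lemma fourier_conv_Cc:
  assumes \<Phi>: "L1_functional M \<Phi> C" and f: "f \<in> Cc" and g: "g \<in> Cc"
  shows "fourier_conv M f g \<in> Cc" "\<Phi> (fourier_conv M f g) = (\<integral>u. f u * \<Phi> (shift u g) \<partial>M)"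
proof -
  have conv: "fourier_conv M f g = (\<lambda>x. \<integral>u. f u * g (x + uminus u) \<partial>M)"
    by (simp add: fourier_conv_def)
  have shift: "shift u g = (\<lambda>x. g (x + uminus u))" for u
    by (simp add: shift_def)
  show "fourier_conv M f g \<in> Cc" "\<Phi> (fourier_conv M f g) = (\<integral>u. f u * \<Phi> (shift u g) \<partial>M)"
    unfolding conv shift by (rule functional_of_product_family[OF \<Phi> f g]; simp)+
qed

lemma integrable_bounded_mult_reflect:
  fixes f g :: "'a \<Rightarrow> complex"
  assumes f: "f \<in> borel_measurable M" "\<And>u. norm (f u) \<le> B" and g: "integrable M g"
  shows "integrable M (\<lambda>u. f u * g (x - u))"
proof (rule Bochner_Integration.integrable_bound[of M "\<lambda>u. B * norm (g (x - u))"])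
  show "integrable M (\<lambda>u. B * norm (g (x - u)))"
    using integral_reflect(1)[OF g, of x] by simp
  show "(\<lambda>u. f u * g (x - u)) \<in> borel_measurable M"
    using f(1) borel_measurable_integrable[OF integral_reflect(1)[OF g, of x]] by simp
  have "0 \<le> B" using f(2) norm_ge_zero order_trans by blast
  then show "AE u in M. norm (f u * g (x - u)) \<le> norm (B * norm (g (x - u)))"
    using f(2) by (intro AE_I2) (simp add: norm_mult mult_right_mono)
qed

text \<open>
  A translate of \<open>f \<star> g\<close> is the convolution of \<open>f\<close> with a translate of \<open>g\<close>, which changes little in mean.
\<close>

lemma fourier_conv_continuous:
  fixes f g :: "'a \<Rightarrow> complex"
  assumes f: "f \<in> borel_measurable M" "\<And>u. norm (f u) \<le> B" and g: "integrable M g"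
  shows "continuous_on UNIV (fourier_conv M f g)"
proof (rule continuous_onI_uniform)
  fix e :: real assume e: "0 < e"
  have B: "0 \<le> B" using f(2) norm_ge_zero order_trans by blast
  obtain d where d: "0 < d" "B * d \<le> e" using small_factor[OF B e] by metis
  obtain U where U: "open U" "0 \<in> U" "\<And>x. x \<in> U \<Longrightarrow> - x \<in> U" "\<And>u. u \<in> U \<Longrightarrow> L1_norm M (\<lambda>x. shift u g x - g x) < d"
    using translation_continuous[OF g d(1)] by metis
  have "norm (fourier_conv M f g x - fourier_conv M f g y) \<le> e" if "x - y \<in> U" for x y
  proof -
    have *: "integrable M (\<lambda>t. norm (shift (- (x - y)) g t - g t))"
      using g shift_L1(1)[OF g] by (intro integrable_norm) simp
    have **: "norm (g (x - u) - g (y - u)) = norm (shift (- (x - y)) g (y - u) - g (y - u))" for u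
      by (simp add: shift_def)
    have "norm (fourier_conv M f g x - fourier_conv M f g y) = norm (\<integral>u. f u * (g (x - u) - g (y - u)) \<partial>M)"
      unfolding fourier_conv_def
      using integrable_bounded_mult_reflect[OF f g] by (simp add: right_diff_distrib)
    also have "\<dots> \<le> (\<integral>u. norm (f u * (g (x - u) - g (y - u))) \<partial>M)"
      by (rule integral_norm_bound)
    also have "\<dots> \<le> (\<integral>u. B * norm (g (x - u) - g (y - u)) \<partial>M)"
    proof (rule integral_mono_AE')
      show "integrable M (\<lambda>u. B * norm (g (x - u) - g (y - u)))"
        unfolding ** using integral_reflect(1)[OF *] by (rule integrable_mult_right)
    qed (use f(2) B in \<open>auto simp: norm_mult intro!: mult_right_mono\<close>)
    also have "\<dots> = B * L1_norm M (\<lambda>t. shift (- (x - y)) g t - g t)"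
      unfolding ** integral_mult_right_zero L1_norm_def using integral_reflect(2)[OF *, of y] by simp
    also have "\<dots> \<le> B * d"
      using U(4)[OF U(3)[OF that]] B by (intro mult_left_mono) auto
    finally show ?thesis using d by simp
  qed
  then show "\<exists>U. open U \<and> 0 \<in> U \<and> (\<forall>x y. x - y \<in> U \<longrightarrow> norm (fourier_conv M f g x - fourier_conv M f g y) \<le> e)"
    using U by blast
qed

definition abs_conv :: "('a \<Rightarrow> complex) \<Rightarrow> ('a \<Rightarrow> complex) \<Rightarrow> 'a \<Rightarrow> ennreal" where
  "abs_conv f g x = (\<integral>\<^sup>+u. ennreal (norm (f u) * norm (g (x - u))) \<partial>M)"

lemma reflect_measurable:
  fixes g :: "'a \<Rightarrow> complex"
  assumes "g \<in> borel_measurable M"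
  shows "(\<lambda>u. g (x - u)) \<in> borel_measurable M"
  by (rule measurable_compose_continuous[OF assms]) (auto intro!: continuous_intros)

lemma ennreal_eq_SUP_truncated:
  assumes "0 \<le> a" "0 \<le> b"
  shows "ennreal (a * b) = (SUP n::nat. ennreal (min a (real n) * b))"
proof (rule antisym)
  obtain n :: nat where "a \<le> real n" using real_arch_simple by blast
  then have "a * b = min a (real n) * b" by simp
  then show "ennreal (a * b) \<le> (SUP n::nat. ennreal (min a (real n) * b))"
    by (metis SUP_upper UNIV_I)
  show "(SUP n::nat. ennreal (min a (real n) * b)) \<le> ennreal (a * b)"
    using assms by (intro SUP_least ennreal_leI mult_right_mono) auto
qed

text \<open>
  Truncating \<open>f\<close> makes the convolution continuous, and a supremum of countably many continuous functions is Borel.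
\<close>

lemma abs_conv_measurable:
  fixes f g :: "'a \<Rightarrow> complex"
  assumes f: "f \<in> borel_measurable M" and g: "integrable M g"
  shows "abs_conv f g \<in> borel_measurable M"
proof -
  define F where "F n u = complex_of_real (min (norm (f u)) (real n))" for n u
  define G where "G x = complex_of_real (norm (g x))" for x
  have F: "F n \<in> borel_measurable M" "\<And>u. norm (F n u) \<le> real n" for n
    using f by (auto simp: F_def[abs_def])
  have G: "integrable M G" using g by (simp add: G_def[abs_def])
  have "(\<integral>\<^sup>+u. ennreal (min (norm (f u)) (real n) * norm (g (x - u))) \<partial>M) = ennreal (norm (fourier_conv M (F n) G x))" for n x
  proof -
    have FG: "F n u * G (x - u) = complex_of_real (min (norm (f u)) (real n) * norm (g (x - u)))" for u
      by (simp add: F_def G_def)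
    have int: "integrable M (\<lambda>u. min (norm (f u)) (real n) * norm (g (x - u)))"
      using integrable_bounded_mult_reflect[OF F[of n] G, of x] unfolding FG by (simp only: complex_of_real_integrable_eq)
    have "0 \<le> (\<integral>u. min (norm (f u)) (real n) * norm (g (x - u)) \<partial>M)"
      by (intro integral_nonneg_AE) auto
    moreover have "fourier_conv M (F n) G x = complex_of_real (\<integral>u. min (norm (f u)) (real n) * norm (g (x - u)) \<partial>M)"
      unfolding fourier_conv_def FG by (rule integral_complex_of_real)
    ultimately show ?thesis
      using int by (subst nn_integral_eq_integral) auto
  qed
  moreover have "abs_conv f g x = (SUP n. \<integral>\<^sup>+u. ennreal (min (norm (f u)) (real n) * norm (g (x - u))) \<partial>M)" for x
  proof -
    have "abs_conv f g x = (\<integral>\<^sup>+u. (SUP n::nat. ennreal (min (norm (f u)) (real n) * norm (g (x - u)))) \<partial>M)"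
      unfolding abs_conv_def by (subst ennreal_eq_SUP_truncated) auto
    also have "\<dots> = (SUP n. \<integral>\<^sup>+u. ennreal (min (norm (f u)) (real n) * norm (g (x - u))) \<partial>M)"
      using f reflect_measurable[OF borel_measurable_integrable[OF g], of x]
      by (intro nn_integral_monotone_convergence_SUP)
        (auto simp: incseq_def le_fun_def intro!: ennreal_leI mult_right_mono min.mono)
    finally show ?thesis .
  qed
  ultimately have "abs_conv f g = (\<lambda>x. SUP n. ennreal (norm (fourier_conv M (F n) G x)))"
    by (auto simp: fun_eq_iff)
  moreover have "fourier_conv M (F n) G \<in> borel_measurable M" for n
    by (intro continuous_borel_measurable fourier_conv_continuous[OF F G])
  ultimately show ?thesis by simp
qed

lemma nn_integral_abs_conv_Cc:
  assumes f: "f \<in> Cc" and g: "g \<in> Cc"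
  shows "(\<integral>\<^sup>+x. abs_conv f g x \<partial>M) = ennreal (L1_norm M f * L1_norm M g)"
proof -
  define F where "F u = complex_of_real (norm (f u))" for u
  define G where "G x = complex_of_real (norm (g x))" for x
  have F: "F \<in> Cc" and G: "G \<in> Cc"
    using Cc_norm f g by (auto simp: F_def[abs_def] G_def[abs_def])
  define h where "h x = (\<integral>u. norm (f u) * norm (g (x - u)) \<partial>M)" for x
  have h0: "0 \<le> h x" for x
    unfolding h_def by (intro integral_nonneg_AE) auto
  have FG: "F u * G (x - u) = complex_of_real (norm (f u) * norm (g (x - u)))" for u x
    by (simp add: F_def G_def)
  obtain K B where "\<And>x. norm (f x) \<le> B" using CcE[OF f] by metis
  then have B: "\<And>x. norm (F x) \<le> B" by (simp add: F_def)
  have "integrable M (\<lambda>u. F u * G (x - u))" for x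
    using Cc_integrable[OF F] Cc_integrable[OF G] B by (intro integrable_bounded_mult_reflect[of F B G]) auto
  then have "integrable M (\<lambda>u. norm (f u) * norm (g (x - u)))" for x
    unfolding FG by (simp only: complex_of_real_integrable_eq)
  then have ac: "abs_conv f g x = ennreal (h x)" for x
    unfolding abs_conv_def h_def by (intro nn_integral_eq_integral) auto
  have conv: "fourier_conv M F G x = complex_of_real (h x)" for x
    unfolding fourier_conv_def FG h_def by (rule integral_complex_of_real)
  then have conv': "fourier_conv M F G = (\<lambda>x. complex_of_real (h x))" by auto
  note FC = fourier_conv_Cc[OF L1_functional_integral F G]
  have ih: "integrable M h"
    using Cc_integrable[OF FC(1)] unfolding conv' by (simp only: complex_of_real_integrable_eq)
  have "complex_of_real (\<integral>x. h x \<partial>M) = (\<integral>u. F u * (\<integral>x. shift u G x \<partial>M) \<partial>M)"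
    using FC(2) unfolding conv' by simp
  also have "\<dots> = complex_of_real (L1_norm M f * L1_norm M g)"
    using integral_translate(6)[OF Cc_integrable[OF G]]
    by (simp add: shift_def L1_norm_def F_def[abs_def] G_def[abs_def])
  finally have "(\<integral>x. h x \<partial>M) = L1_norm M f * L1_norm M g"
    by (simp only: of_real_eq_iff)
  then show ?thesis
    unfolding ac using nn_integral_eq_integral[OF ih] h0 by simp
qed

lemma L1_norm_tendsto:
  assumes "integrable M f" "\<And>n. integrable M (s n)" "(\<lambda>n. L1_norm M (\<lambda>x. f x - s n x)) \<longlonglongrightarrow> 0"
  shows "(\<lambda>n. L1_norm M (s n)) \<longlonglongrightarrow> L1_norm M f"
proof -
  have "\<bar>L1_norm M (s n) - L1_norm M f\<bar> \<le> L1_norm M (\<lambda>x. f x - s n x)" for n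
    using L1_norm_triangle[of M "\<lambda>x. f x - s n x" "s n"] L1_norm_triangle[of M "\<lambda>x. s n x - f x" f]
      assms(1) assms(2)[of n] L1_norm_minus_commute[of M f "s n"] by simp
  then have "(\<lambda>n. L1_norm M (s n) - L1_norm M f) \<longlonglongrightarrow> 0"
    by (intro Lim_null_comparison[OF _ assms(3)]) auto
  then show ?thesis by (simp add: LIM_zero_iff)
qed

text \<open>
  Young's inequality. Both factors are approximated in mean and almost everywhere by continuous functions of compact
  support, and Fatou's lemma is applied to the inner integral and then to the outer one.
\<close>

lemma nn_integral_abs_conv_le:
  fixes f g :: "'a \<Rightarrow> complex"
  assumes f: "integrable M f" and g: "integrable M g"
  shows "(\<integral>\<^sup>+x. abs_conv f g x \<partial>M) \<le> ennreal (L1_norm M f * L1_norm M g)"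
proof -
  obtain s where s: "\<And>n. s n \<in> Cc" "(\<lambda>n. L1_norm M (\<lambda>x. f x - s n x)) \<longlonglongrightarrow> 0" "AE x in M. (\<lambda>n. s n x) \<longlonglongrightarrow> f x"
    by (rule Cc_sequence[OF f], rule that)
  obtain t where t: "\<And>n. t n \<in> Cc" "(\<lambda>n. L1_norm M (\<lambda>x. g x - t n x)) \<longlonglongrightarrow> 0" "AE x in M. (\<lambda>n. t n x) \<longlonglongrightarrow> g x"
    by (rule Cc_sequence[OF g], rule that)
  note si = Cc_integrable[OF s(1)] and ti = Cc_integrable[OF t(1)]
  have le: "abs_conv f g x \<le> liminf (\<lambda>n. abs_conv (s n) (t n) x)" for x
  proof -
    have "AE u in M. (\<lambda>n. t n (x - u)) \<longlonglongrightarrow> g (x - u)"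
      using AE_reflect[OF t(3)] .
    with s(3) have "AE u in M. ennreal (norm (f u) * norm (g (x - u)))
        = liminf (\<lambda>n. ennreal (norm (s n u) * norm (t n (x - u))))"
    proof eventually_elim
      case (elim u)
      have "(\<lambda>n. ennreal (norm (s n u) * norm (t n (x - u)))) \<longlonglongrightarrow> ennreal (norm (f u) * norm (g (x - u)))"
        using elim by (intro tendsto_ennrealI tendsto_mult tendsto_norm)
      then show ?case by (rule lim_imp_Liminf[symmetric, rotated]) simp
    qed
    then have "abs_conv f g x = (\<integral>\<^sup>+u. liminf (\<lambda>n. ennreal (norm (s n u) * norm (t n (x - u)))) \<partial>M)"
      unfolding abs_conv_def by (rule nn_integral_cong_AE)
    also have "\<dots> \<le> liminf (\<lambda>n. \<integral>\<^sup>+u. ennreal (norm (s n u) * norm (t n (x - u))) \<partial>M)"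
      using borel_measurable_integrable[OF si] reflect_measurable[OF borel_measurable_integrable[OF ti]]
      by (intro nn_integral_liminf) auto
    finally show ?thesis by (simp add: abs_conv_def)
  qed
  have "(\<integral>\<^sup>+x. abs_conv f g x \<partial>M) \<le> (\<integral>\<^sup>+x. liminf (\<lambda>n. abs_conv (s n) (t n) x) \<partial>M)"
    by (intro nn_integral_mono le)
  also have "\<dots> \<le> liminf (\<lambda>n. \<integral>\<^sup>+x. abs_conv (s n) (t n) x \<partial>M)"
    using si ti by (intro nn_integral_liminf abs_conv_measurable) auto
  also have "\<dots> = liminf (\<lambda>n. ennreal (L1_norm M (s n) * L1_norm M (t n)))"
    using nn_integral_abs_conv_Cc[OF s(1) t(1)] by simp
  also have "\<dots> = ennreal (L1_norm M f * L1_norm M g)"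
    using L1_norm_tendsto[OF f si s(2)] L1_norm_tendsto[OF g ti t(2)]
    by (intro lim_imp_Liminf tendsto_ennrealI tendsto_mult) auto
  finally show ?thesis .
qed

lemma integrable_conv_integrand_iff:
  fixes f g :: "'a \<Rightarrow> complex"
  assumes "f \<in> borel_measurable M" "g \<in> borel_measurable M"
  shows "integrable M (\<lambda>u. f u * g (x - u)) \<longleftrightarrow> abs_conv f g x < \<infinity>"
proof -
  have "(\<lambda>u. f u * g (x - u)) \<in> borel_measurable M"
    using assms(1) reflect_measurable[OF assms(2), of x] by simp
  then show ?thesis
    unfolding integrable_iff_bounded abs_conv_def norm_mult by simp
qed

text \<open>
  Where the integral converges absolutely, it is a limit of continuous functions, and where it does not, it is \<open>0\<close> by
  convention. So the convolution is itself Borel, not only equal to a Borel function almost everywhere.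
\<close>

lemma fourier_conv_measurable:
  fixes f g :: "'a \<Rightarrow> complex"
  assumes f: "f \<in> borel_measurable M" and g: "integrable M g"
  shows "fourier_conv M f g \<in> borel_measurable M"
proof -
  define F where "F n u = (if norm (f u) \<le> real n then f u else 0)" for n :: nat and u
  have F: "F n \<in> borel_measurable M" "\<And>u. norm (F n u) \<le> real n" for n
    using f by (auto simp: F_def[abs_def])
  have gx: "(\<lambda>u. g (x - u)) \<in> borel_measurable M" for x
    by (rule reflect_measurable[OF borel_measurable_integrable[OF g]])
  define H where "H n x = (if abs_conv f g x < \<infinity> then fourier_conv M (F n) g x else 0)" for n x
  have "H n \<in> borel_measurable M" for n
  proof -
    note [measurable] = abs_conv_measurable[OF f g] continuous_borel_measurable[OF fourier_conv_continuous[OF F[of n] g]]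
    show ?thesis unfolding H_def[abs_def] by measurable
  qed
  moreover have "(\<lambda>n. H n x) \<longlonglongrightarrow> fourier_conv M f g x" for x
  proof (cases "abs_conv f g x < \<infinity>")
    case True
    then have int: "integrable M (\<lambda>u. f u * g (x - u))"
      using integrable_conv_integrand_iff[OF f borel_measurable_integrable[OF g]] by simp
    have "(\<lambda>n. \<integral>u. F n u * g (x - u) \<partial>M) \<longlonglongrightarrow> (\<integral>u. f u * g (x - u) \<partial>M)"
    proof (rule integral_dominated_convergence[where w = "\<lambda>u. norm (f u * g (x - u))"])
      show "AE u in M. (\<lambda>n. F n u * g (x - u)) \<longlonglongrightarrow> f u * g (x - u)"
      proof (intro AE_I2 tendsto_mult tendsto_const)
        fix u
        obtain m :: nat where "norm (f u) \<le> real m" using real_arch_simple by blast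
        then have "\<forall>\<^sub>F n in sequentially. F n u = f u"
          unfolding eventually_sequentially F_def by (intro exI[of _ m]) auto
        then show "(\<lambda>n. F n u) \<longlonglongrightarrow> f u" by (rule tendsto_eventually)
      qed
      show "integrable M (\<lambda>u. norm (f u * g (x - u)))" by (rule integrable_norm[OF int])
    qed (use f gx F(1) in \<open>auto simp: F_def norm_mult\<close>)
    then show ?thesis using True by (simp add: H_def fourier_conv_def)
  next
    case False
    then have "\<not> integrable M (\<lambda>u. f u * g (x - u))"
      using integrable_conv_integrand_iff[OF f borel_measurable_integrable[OF g]] by simp
    then show ?thesis using False by (simp add: H_def fourier_conv_def not_integrable_integral_eq)
  qed
  ultimately show ?thesis
    by (rule borel_measurable_LIMSEQ_metric)
qed

lemma fourier_conv_L1: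
  fixes f g :: "'a \<Rightarrow> complex"
  assumes f: "integrable M f" and g: "integrable M g"
  shows "integrable M (fourier_conv M f g)" "L1_norm M (fourier_conv M f g) \<le> L1_norm M f * L1_norm M g"
proof -
  note m = borel_measurable_integrable[OF f] borel_measurable_integrable[OF g]
  have le: "ennreal (norm (fourier_conv M f g x)) \<le> abs_conv f g x" for x
  proof (cases "abs_conv f g x < \<infinity>")
    case True
    then have "integrable M (\<lambda>u. f u * g (x - u))"
      using integrable_conv_integrand_iff[OF m] by simp
    from integral_norm_bound_ennreal[OF this] show ?thesis
      by (simp add: fourier_conv_def abs_conv_def norm_mult)
  qed (simp add: not_less top_unique)
  have "(\<integral>\<^sup>+x. norm (fourier_conv M f g x) \<partial>M) \<le> (\<integral>\<^sup>+x. abs_conv f g x \<partial>M)"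
    by (intro nn_integral_mono le)
  also have "\<dots> \<le> ennreal (L1_norm M f * L1_norm M g)"
    by (rule nn_integral_abs_conv_le[OF f g])
  finally have bound: "(\<integral>\<^sup>+x. norm (fourier_conv M f g x) \<partial>M) \<le> ennreal (L1_norm M f * L1_norm M g)" .
  show int: "integrable M (fourier_conv M f g)"
    by (rule integrableI_bounded[OF fourier_conv_measurable[OF m(1) g]])
      (use le_less_trans[OF bound ennreal_less_top] in simp)
  have "ennreal (L1_norm M (fourier_conv M f g)) \<le> ennreal (L1_norm M f * L1_norm M g)"
    using bound nn_integral_eq_integral[OF integrable_norm[OF int]] by (simp add: L1_norm_def)
  then show "L1_norm M (fourier_conv M f g) \<le> L1_norm M f * L1_norm M g"
    by (simp add: L1_norm_nonneg)
qed

lemma AE_integrable_conv_integrand: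
  fixes f g :: "'a \<Rightarrow> complex"
  assumes f: "integrable M f" and g: "integrable M g"
  shows "AE x in M. integrable M (\<lambda>u. f u * g (x - u))"
proof -
  have "(\<integral>\<^sup>+x. abs_conv f g x \<partial>M) \<noteq> \<infinity>"
    using le_less_trans[OF nn_integral_abs_conv_le[OF f g] ennreal_less_top] by simp
  then have "AE x in M. abs_conv f g x \<noteq> \<infinity>"
    using f g by (intro nn_integral_PInf_AE abs_conv_measurable) auto
  then show ?thesis
    by eventually_elim
      (use integrable_conv_integrand_iff[OF borel_measurable_integrable[OF f] borel_measurable_integrable[OF g]] in \<open>simp add: less_top\<close>)
qed

text \<open>
  Convolution is additive only where the integrals converge absolutely, hence only almost everywhere.
\<close>

lemma fourier_conv_diff_AE:
  fixes f g f' g' :: "'a \<Rightarrow> complex"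
  assumes "integrable M f" "integrable M g" "integrable M f'" "integrable M g'"
  shows "AE x in M. fourier_conv M f g x - fourier_conv M f' g' x
    = fourier_conv M (\<lambda>x. f x - f' x) g x + fourier_conv M f' (\<lambda>x. g x - g' x) x"
  using AE_integrable_conv_integrand[OF assms(1,2)] AE_integrable_conv_integrand[OF assms(3,4)]
    AE_integrable_conv_integrand[OF assms(3,2)]
proof eventually_elim
  case (elim x)
  then show ?case by (simp add: fourier_conv_def left_diff_distrib right_diff_distrib)
qed

lemma fourier_conv_diff_le:
  fixes f g f' g' :: "'a \<Rightarrow> complex"
  assumes "integrable M f" "integrable M g" "integrable M f'" "integrable M g'"
  shows "L1_norm M (\<lambda>x. fourier_conv M f g x - fourier_conv M f' g' x)
    \<le> L1_norm M (\<lambda>x. f x - f' x) * L1_norm M g + L1_norm M f' * L1_norm M (\<lambda>x. g x - g' x)"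
proof -
  define p where "p = fourier_conv M (\<lambda>x. f x - f' x) g"
  define q where "q = fourier_conv M f' (\<lambda>x. g x - g' x)"
  have pq: "integrable M p" "integrable M q" "L1_norm M p \<le> L1_norm M (\<lambda>x. f x - f' x) * L1_norm M g"
    "L1_norm M q \<le> L1_norm M f' * L1_norm M (\<lambda>x. g x - g' x)"
    unfolding p_def q_def using assms by (auto intro!: fourier_conv_L1)
  have "L1_norm M (\<lambda>x. fourier_conv M f g x - fourier_conv M f' g' x) = L1_norm M (\<lambda>x. p x + q x)"
    unfolding L1_norm_def
  proof (rule integral_cong_AE)
    show "AE x in M. norm (fourier_conv M f g x - fourier_conv M f' g' x) = norm (p x + q x)"
      using fourier_conv_diff_AE[OF assms] by eventually_elim (simp add: p_def q_def)
  qed (use pq assms fourier_conv_L1(1) in auto)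
  also have "\<dots> \<le> L1_norm M p + L1_norm M q"
    by (rule L1_norm_triangle[OF pq(1,2)])
  finally show ?thesis using pq by simp
qed

lemma fourier_conv_commute:
  fixes f g :: "'a \<Rightarrow> complex"
  assumes f: "integrable M f" and g: "integrable M g"
  shows "fourier_conv M f g = fourier_conv M g f"
proof
  fix x
  have iff: "integrable M (\<lambda>u. f u * g (x - u))" if "integrable M (\<lambda>u. g u * f (x - u))" for f g :: "'a \<Rightarrow> complex"
    using integral_reflect(1)[OF that, of x] by (simp add: mult.commute)
  show "fourier_conv M f g x = fourier_conv M g f x"
  proof (cases "integrable M (\<lambda>u. g u * f (x - u))")
    case True
    then show ?thesis
      using integral_reflect(2)[OF True, of x] by (simp add: fourier_conv_def mult.commute)
  next
    case False
    then have "\<not> integrable M (\<lambda>u. f u * g (x - u))" using iff by blast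
    then show ?thesis using False by (simp add: fourier_conv_def not_integrable_integral_eq)
  qed
qed

lemma fourier_conv_shift_right: "fourier_conv M f (shift a g) = shift a (fourier_conv M f g)"
  by (simp add: fourier_conv_def shift_def algebra_simps)

lemma fourier_conv_shift:
  fixes f g :: "'a \<Rightarrow> complex"
  assumes "integrable M f" "integrable M g"
  shows "fourier_conv M (shift a f) g = shift a (fourier_conv M f g)"
    and "fourier_conv M (shift a f) (shift b g) = fourier_conv M (shift (a + b) f) g"
proof -
  show *: "fourier_conv M (shift a f) g = shift a (fourier_conv M f g)" for a
    using fourier_conv_commute[OF shift_L1(1)[OF assms(1)] assms(2)] fourier_conv_commute[OF assms]
    by (simp add: fourier_conv_shift_right)
  show "fourier_conv M (shift a f) (shift b g) = fourier_conv M (shift (a + b) f) g"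
    by (simp add: fourier_conv_shift_right * shift_shift add.commute)
qed

lemma functional_shift_bounds:
  assumes \<Phi>: "L1_functional M \<Phi> C" and g: "integrable M g"
  shows "norm (\<Phi> (shift u g)) \<le> C * L1_norm M g" "continuous_on UNIV (\<lambda>u. \<Phi> (shift u g))"
    and "norm (\<Phi> (shift u g) - \<Phi> (shift v g)) \<le> C * L1_norm M (\<lambda>x. shift (u - v) g x - g x)"
proof -
  show "norm (\<Phi> (shift u g)) \<le> C * L1_norm M g" for u
    using L1_functionalD(4)[OF \<Phi> shift_L1(1)[OF g], of u] shift_L1(2)[OF g] by simp
  show lip: "norm (\<Phi> (shift u g) - \<Phi> (shift v g)) \<le> C * L1_norm M (\<lambda>x. shift (u - v) g x - g x)" for u v
  proof -
    have "L1_norm M (\<lambda>x. shift u g x - shift v g x) = L1_norm M (\<lambda>x. shift (u - v) g x - g x)"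
      using shift_L1_diff[of "shift (u - v) g" g v] g shift_L1(1)[OF g] by (simp add: shift_shift)
    then show ?thesis
      using L1_functionalD(6)[OF \<Phi> shift_L1(1)[OF g] shift_L1(1)[OF g], of u v] by simp
  qed
  show "continuous_on UNIV (\<lambda>u. \<Phi> (shift u g))"
  proof (rule continuous_onI_uniform)
    fix e :: real assume e: "0 < e"
    have C: "0 \<le> C" by (rule L1_functionalD(1)[OF \<Phi>])
    obtain d where d: "0 < d" and Cd: "C * d \<le> e" using small_factor[OF C e] by metis
    obtain U where U: "open U" "0 \<in> U" "\<And>u. u \<in> U \<Longrightarrow> L1_norm M (\<lambda>x. shift u g x - g x) < d"
      using translation_continuous[OF g d] by metis
    have "norm (\<Phi> (shift u g) - \<Phi> (shift v g)) \<le> e" if "u - v \<in> U" for u v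
    proof -
      have "C * L1_norm M (\<lambda>x. shift (u - v) g x - g x) \<le> C * d"
        using U(3)[OF that] C by (intro mult_left_mono) auto
      then show ?thesis using lip[of u v] Cd by linarith
    qed
    then show "\<exists>U. open U \<and> 0 \<in> U \<and> (\<forall>u v. u - v \<in> U \<longrightarrow> norm (\<Phi> (shift u g) - \<Phi> (shift v g)) \<le> e)"
      using U by blast
  qed
qed

lemma integrable_mult_bounded_continuous:
  fixes f \<psi> :: "'a \<Rightarrow> complex"
  assumes f: "integrable M f" and \<psi>: "\<psi> \<in> borel_measurable M" "\<And>u. norm (\<psi> u) \<le> B"
  shows "integrable M (\<lambda>u. f u * \<psi> u)" "norm (\<integral>u. f u * \<psi> u \<partial>M) \<le> B * L1_norm M f"
proof -
  have B: "0 \<le> B" using \<psi>(2) norm_ge_zero order_trans by blast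
  have le: "norm (f u * \<psi> u) \<le> B * norm (f u)" for u
    using \<psi>(2)[of u] mult_left_mono[of "norm (\<psi> u)" B "norm (f u)"] by (simp add: norm_mult mult.commute)
  show int: "integrable M (\<lambda>u. f u * \<psi> u)"
    by (rule Bochner_Integration.integrable_bound[of M "\<lambda>u. B * norm (f u)"])
      (use f \<psi>(1) le in \<open>auto intro!: AE_I2 order_trans[OF le]\<close>)
  have "norm (\<integral>u. f u * \<psi> u \<partial>M) \<le> (\<integral>u. norm (f u * \<psi> u) \<partial>M)" by (rule integral_norm_bound)
  also have "\<dots> \<le> (\<integral>u. B * norm (f u) \<partial>M)"
    using int f le by (intro integral_mono) auto
  finally show "norm (\<integral>u. f u * \<psi> u \<partial>M) \<le> B * L1_norm M f" by (simp add: L1_norm_def)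
qed

text \<open>
  Both sides depend continuously on both factors in mean, so the identity for continuous functions of compact support
  extends. In this sense \<open>f \<star> g\<close> is the integral of the translates of \<open>g\<close> against \<open>f\<close>.
\<close>

lemma functional_of_fourier_conv:
  assumes \<Phi>: "L1_functional M \<Phi> C" and f: "integrable M f" and g: "integrable M g"
  shows "\<Phi> (fourier_conv M f g) = (\<integral>u. f u * \<Phi> (shift u g) \<partial>M)"
proof -
  obtain s where s: "\<And>n. s n \<in> Cc" "(\<lambda>n. L1_norm M (\<lambda>x. f x - s n x)) \<longlonglongrightarrow> 0"
    by (rule Cc_sequence[OF f], rule that)
  obtain t where t: "\<And>n. t n \<in> Cc" "(\<lambda>n. L1_norm M (\<lambda>x. g x - t n x)) \<longlonglongrightarrow> 0"
    by (rule Cc_sequence[OF g], rule that)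
  note si = Cc_integrable[OF s(1)] and ti = Cc_integrable[OF t(1)]
  define b where "b n = C * (L1_norm M (\<lambda>x. f x - s n x) * L1_norm M g + L1_norm M (s n) * L1_norm M (\<lambda>x. g x - t n x))" for n
  have "b \<longlonglongrightarrow> C * (0 * L1_norm M g + L1_norm M f * 0)"
    unfolding b_def[abs_def] by (intro tendsto_intros s t L1_norm_tendsto[OF f si s(2)])
  then have b: "b \<longlonglongrightarrow> 0" by simp
  have C: "0 \<le> C" by (rule L1_functionalD(1)[OF \<Phi>])
  have 1: "norm (\<Phi> (fourier_conv M f g) - \<Phi> (fourier_conv M (s n) (t n))) \<le> b n" for n
    using L1_functionalD(6)[OF \<Phi> fourier_conv_L1(1)[OF f g] fourier_conv_L1(1)[OF si ti], of n n]
      mult_left_mono[OF fourier_conv_diff_le[OF f g si ti, of n n] C]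
    unfolding b_def by linarith
  have 2: "norm ((\<integral>u. f u * \<Phi> (shift u g) \<partial>M) - (\<integral>u. s n u * \<Phi> (shift u (t n)) \<partial>M)) \<le> b n" for n
  proof -
    note bg = functional_shift_bounds[OF \<Phi> g] and bt = functional_shift_bounds[OF \<Phi> ti[of n]]
    note mg = continuous_borel_measurable[OF bg(2)] and mt = continuous_borel_measurable[OF bt(2)]
    define d where "d u = \<Phi> (shift u g) - \<Phi> (shift u (t n))" for u
    have md: "d \<in> borel_measurable M" unfolding d_def[abs_def] using mg mt by simp
    have bd: "norm (d u) \<le> C * L1_norm M (\<lambda>x. g x - t n x)" for u
      using L1_functionalD(6)[OF \<Phi> shift_L1(1)[OF g] shift_L1(1)[OF ti], of u u n] shift_L1_diff[OF g ti, of u n]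
      by (simp add: d_def)
    have fs: "integrable M (\<lambda>x. f x - s n x)" using f si by simp
    note i1 = integrable_mult_bounded_continuous[OF fs mg bg(1)] and i2 = integrable_mult_bounded_continuous[OF si[of n] md bd]
      and i3 = integrable_mult_bounded_continuous(1)[OF f mg bg(1)] and i4 = integrable_mult_bounded_continuous(1)[OF si[of n] mt bt(1)]
    have "(\<integral>u. f u * \<Phi> (shift u g) \<partial>M) - (\<integral>u. s n u * \<Phi> (shift u (t n)) \<partial>M)
        = (\<integral>u. (f u - s n u) * \<Phi> (shift u g) \<partial>M) + (\<integral>u. s n u * d u \<partial>M)"
    proof -
      have "(\<integral>u. (f u - s n u) * \<Phi> (shift u g) \<partial>M) + (\<integral>u. s n u * d u \<partial>M)
          = (\<integral>u. (f u - s n u) * \<Phi> (shift u g) + s n u * d u \<partial>M)"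
        using i1(1) i2(1) by (rule Bochner_Integration.integral_add[symmetric])
      also have "\<dots> = (\<integral>u. f u * \<Phi> (shift u g) - s n u * \<Phi> (shift u (t n)) \<partial>M)"
        by (simp add: d_def algebra_simps)
      finally show ?thesis using i3 i4 by simp
    qed
    then show ?thesis
      using i1(2) i2(2) norm_triangle_ineq[of "\<integral>u. (f u - s n u) * \<Phi> (shift u g) \<partial>M" "\<integral>u. s n u * d u \<partial>M"]
      by (simp add: b_def algebra_simps)
  qed
  have "norm (\<Phi> (fourier_conv M f g) - (\<integral>u. f u * \<Phi> (shift u g) \<partial>M)) \<le> 2 * b n" for n
    using 1[of n] 2[of n] fourier_conv_Cc(2)[OF \<Phi> s(1) t(1), of n n]
      norm_triangle_ineq4[of "\<Phi> (fourier_conv M f g) - \<Phi> (fourier_conv M (s n) (t n))"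
        "(\<integral>u. f u * \<Phi> (shift u g) \<partial>M) - (\<integral>u. s n u * \<Phi> (shift u (t n)) \<partial>M)"] by simp
  moreover have "(\<lambda>n. 2 * b n) \<longlonglongrightarrow> 0" using tendsto_mult[OF tendsto_const[of 2] b] by simp
  ultimately have "norm (\<Phi> (fourier_conv M f g) - (\<integral>u. f u * \<Phi> (shift u g) \<partial>M)) \<le> 0"
    using LIMSEQ_le_const[of "\<lambda>n. 2 * b n" 0] by blast
  then show ?thesis by simp
qed

text \<open>
  By duality with bounded measurable functions, the claim reduces to the scalar Riemann sums of \<open>u \<mapsto> \<Phi> (shift u g)\<close>
  for contractive functionals \<open>\<Phi>\<close>.
\<close>

lemma fourier_conv_step_approx:
  fixes f g :: "'a \<Rightarrow> complex"
  assumes f: "integrable M f" and g: "integrable M g"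
    and E: "finite I" "\<And>z. z \<in> I \<Longrightarrow> E z \<in> sets M" "disjoint_family_on E I"
    and near: "\<And>z u. z \<in> I \<Longrightarrow> u \<in> E z \<Longrightarrow> L1_norm M (\<lambda>x. shift (u - z) g x - g x) \<le> d" and d: "0 \<le> d"
  shows "L1_norm M (\<lambda>x. fourier_conv M f g x - (\<Sum>z\<in>I. (\<integral>u. f u * indicator (E z) u \<partial>M) * shift z g x))
    \<le> L1_norm M g * (\<integral>u. norm (f u) * indicator (- (\<Union>z\<in>I. E z)) u \<partial>M) + d * L1_norm M f"
proof -
  define c where "c z = (\<integral>u. f u * indicator (E z) u \<partial>M)" for z
  define D where "D x = fourier_conv M f g x - (\<Sum>z\<in>I. c z * shift z g x)" for x
  have iS: "integrable M (\<lambda>x. \<Sum>z\<in>I. c z * shift z g x)"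
    using shift_L1(1)[OF g] by simp
  have iD: "integrable M D"
    unfolding D_def[abs_def] using iS fourier_conv_L1(1)[OF f g] by simp
  define h where "h x = cnj (sgn (D x))" for x
  have h: "h \<in> borel_measurable M" "\<And>x. norm (h x) \<le> 1"
  proof -
    have "(\<lambda>x. D x /\<^sub>R norm (D x)) \<in> borel_measurable M"
      using iD by measurable
    then show "h \<in> borel_measurable M"
      unfolding h_def[abs_def] sgn_div_norm
      by (intro borel_measurable_continuous_on[OF _ , of cnj]) (auto intro: continuous_intros)
    show "norm (h x) \<le> 1" for x
      by (simp add: h_def norm_sgn)
  qed
  define \<Phi> where "\<Phi> F = (\<integral>x. F x * h x \<partial>M)" for F
  have \<Phi>: "L1_functional M \<Phi> 1"
    unfolding L1_functional_def
  proof (intro conjI allI impI)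
    show "\<Phi> (\<lambda>x. p x + q x) = \<Phi> p + \<Phi> q" if "integrable M p" "integrable M q" for p q
      using integrable_mult_bounded_continuous(1)[OF that(1) h] integrable_mult_bounded_continuous(1)[OF that(2) h]
      by (simp add: \<Phi>_def distrib_right)
    show "\<Phi> (\<lambda>x. c * p x) = c * \<Phi> p" for c p
      by (simp add: \<Phi>_def mult.assoc)
    show "norm (\<Phi> p) \<le> 1 * L1_norm M p" if "integrable M p" for p
      unfolding \<Phi>_def by (rule integrable_mult_bounded_continuous(2)[OF that h])
  qed simp
  note b = functional_shift_bounds[OF \<Phi> g]
  have "D x * h x = complex_of_real (norm (D x))" for x
    by (cases "D x = 0") (simp_all add: h_def sgn_div_norm complex_norm_square[symmetric] scaleR_conv_of_real power2_eq_square divide_simps mult.commute flip: of_real_mult)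
  then have "complex_of_real (L1_norm M D) = \<Phi> D"
    by (simp add: \<Phi>_def L1_norm_def)
  also have "\<Phi> D = \<Phi> (fourier_conv M f g) - (\<Sum>z\<in>I. c z * \<Phi> (shift z g))"
    unfolding D_def[abs_def] L1_functionalD(5)[OF \<Phi> fourier_conv_L1(1)[OF f g] iS]
    using L1_functional_sum[OF \<Phi> E(1), of "\<lambda>z. shift z g" c] shift_L1(1)[OF g] by simp
  also have "\<Phi> (fourier_conv M f g) = (\<integral>u. f u * \<Phi> (shift u g) \<partial>M)"
    by (rule functional_of_fourier_conv[OF \<Phi> f g])
  finally have "L1_norm M D = norm ((\<integral>u. f u * \<Phi> (shift u g) \<partial>M) - (\<Sum>z\<in>I. c z * \<Phi> (shift z g)))"
    by (metis L1_norm_nonneg abs_of_nonneg norm_of_real)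
  also have "\<dots> \<le> L1_norm M g * (\<integral>u. norm (f u) * indicator (- (\<Union>z\<in>I. E z)) u \<partial>M) + d * L1_norm M f"
    unfolding c_def
  proof (rule integral_step_approx[OF f _ _ E _ d])
    show "(\<lambda>u. \<Phi> (shift u g)) \<in> borel_measurable M" by (rule continuous_borel_measurable[OF b(2)])
    show "norm (\<Phi> (shift u g)) \<le> L1_norm M g" for u using b(1) by simp
    show "norm (\<Phi> (shift u g) - \<Phi> (shift z g)) \<le> d" if "z \<in> I" "u \<in> E z" for z u
      using b(3)[of u z] near[OF that] by simp
  qed
  finally show ?thesis by (simp add: D_def[abs_def] c_def)
qed

text \<open>
  The support of a continuous function close to \<open>f\<close> in mean is a compact set outside which \<open>f\<close> has
  little mass.
\<close>

lemma small_pieces: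
  fixes f :: "'a \<Rightarrow> complex"
  assumes f: "integrable M f" and U: "open U" "0 \<in> U" and e: "0 < e"
  obtains I and E :: "'a \<Rightarrow> 'a set" where "finite I" "\<And>z. E z \<in> sets M" "disjoint_family_on E I"
    "\<And>z u. z \<in> I \<Longrightarrow> u \<in> E z \<Longrightarrow> u - z \<in> U"
    "(\<integral>u. norm (f u) * indicator (- (\<Union>z\<in>I. E z)) u \<partial>M) \<le> e"
proof -
  obtain g where g: "g \<in> Cc" "L1_norm M (\<lambda>x. f x - g x) < e"
    using Cc_dense[OF f e] by metis
  obtain K where K: "compact K" "\<And>x. x \<notin> K \<Longrightarrow> g x = 0"
    using g(1) by (auto simp: Cc_def)
  have "(\<integral>u. norm (f u) * indicator (- K) u \<partial>M) \<le> L1_norm M (\<lambda>x. f x - g x)"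
    unfolding L1_norm_def
  proof (rule integral_mono_AE')
    show "integrable M (\<lambda>x. norm (f x - g x))" using f Cc_integrable[OF g(1)] by simp
  qed (use K(2) in \<open>auto simp: indicator_def\<close>)
  then have tail: "(\<integral>u. norm (f u) * indicator (- K) u \<partial>M) \<le> e" using g(2) by simp
  obtain I E where E: "finite I" "I \<subseteq> K" "\<And>z. E z \<in> sets borel" "disjoint_family_on E I"
      "(\<Union>z\<in>I. E z) = K" "\<And>z u. z \<in> I \<Longrightarrow> u \<in> E z \<Longrightarrow> u - z \<in> U"
    by (rule compact_borel_partition[OF K(1) U], rule that)
  show thesis
    using that[of I E] E tail by simp
qed

end

section \<open>Multiplicative functionals on the convolution algebra\<close>

text \<open>
  Completeness, in the form that the fixed point of a contraction requires. The limit is the sum of the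
  series of differences, which converges absolutely almost everywhere.
\<close>

lemma L1_complete:
  fixes s :: "nat \<Rightarrow> 'a \<Rightarrow> complex"
  assumes s: "\<And>n. integrable M (s n)" and r: "0 \<le> r" "r < 1"
    and Cauchy: "\<And>n. L1_norm M (\<lambda>x. s (Suc n) x - s n x) \<le> c * r ^ n"
  obtains g where "integrable M g" "(\<lambda>n. L1_norm M (\<lambda>x. g x - s n x)) \<longlonglongrightarrow> 0"
proof -
  define p where "p n x = s (Suc n) x - s n x" for n x
  have p: "integrable M (p n)" for n
    unfolding p_def[abs_def] using s by simp
  have sum_int: "summable (\<lambda>n. \<integral>x. norm (p n x) \<partial>M)"
  proof (rule summable_comparison_test')
    show "summable (\<lambda>n. c * r ^ n)" using r by (intro summable_mult summable_geometric) simp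
    show "norm (\<integral>x. norm (p n x) \<partial>M) \<le> c * r ^ n" for n
      using Cauchy[of n] by (simp add: p_def[abs_def] L1_norm_def)
  qed
  have AE: "AE x in M. summable (\<lambda>n. norm (p n x))"
  proof -
    have "(\<integral>\<^sup>+x. (\<Sum>n. ennreal (norm (p n x))) \<partial>M) = (\<Sum>n. ennreal (\<integral>x. norm (p n x) \<partial>M))"
      using p by (subst nn_integral_suminf) (auto simp: nn_integral_eq_integral)
    also have "\<dots> \<noteq> \<infinity>"
      using sum_int by (simp add: suminf_ennreal2)
    finally have "AE x in M. (\<Sum>n. ennreal (norm (p n x))) \<noteq> \<infinity>"
      using p by (intro nn_integral_PInf_AE) auto
    then show ?thesis
      by eventually_elim (auto intro: summable_suminf_not_top)
  qed
  define g where "g x = s 0 x + (\<Sum>n. p n x)" for x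
  define W where "W x = (\<Sum>n. norm (p n x))" for x
  have iW: "integrable M W"
    unfolding W_def[abs_def] using p AE sum_int by (intro integrable_suminf) auto
  have ig: "integrable M g"
    unfolding g_def[abs_def] using p AE sum_int s by (intro Bochner_Integration.integrable_add integrable_suminf) auto
  have partial: "s n x = s 0 x + (\<Sum>k<n. p k x)" for n x
    by (induction n) (auto simp: p_def)
  have "(\<lambda>n. \<integral>x. norm (g x - s n x) \<partial>M) \<longlonglongrightarrow> (\<integral>x. 0 \<partial>M)"
  proof (rule integral_dominated_convergence[OF _ _ iW])
    show "AE x in M. (\<lambda>n. norm (g x - s n x)) \<longlonglongrightarrow> 0"
      using AE
    proof eventually_elim
      case (elim x)
      then have "(\<lambda>n. \<Sum>k<n. p k x) \<longlonglongrightarrow> (\<Sum>n. p n x)"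
        by (rule summable_LIMSEQ[OF summable_norm_cancel])
      then have "(\<lambda>n. (\<Sum>n. p n x) - (\<Sum>k<n. p k x)) \<longlonglongrightarrow> (\<Sum>n. p n x) - (\<Sum>n. p n x)"
        by (intro tendsto_diff tendsto_const)
      moreover have "g x - s n x = (\<Sum>n. p n x) - (\<Sum>k<n. p k x)" for n
        by (simp add: g_def partial[of n])
      ultimately show ?case
        by (intro tendsto_norm_zero) simp
    qed
    show "AE x in M. norm (norm (g x - s n x)) \<le> W x" for n
      using AE
    proof eventually_elim
      case (elim x)
      have "g x - s n x = (\<Sum>k. p (k + n) x)"
        unfolding g_def by (subst partial) (use suminf_split_initial_segment[OF summable_norm_cancel[OF elim], of n] in simp)
      also have "norm \<dots> \<le> (\<Sum>k. norm (p (k + n) x))"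
        using elim by (intro summable_norm) (simp add: summable_iff_shift[of "\<lambda>n. norm (p n x)"])
      also have "\<dots> \<le> W x"
        unfolding W_def using suminf_split_initial_segment[OF elim, of n] by (simp add: sum_nonneg)
      finally show ?case by simp
    qed
  qed (use ig s in auto)
  then show thesis
    using that[OF ig] by (simp add: L1_norm_def)
qed

lemma L1_norm_eq_0_AE:
  fixes f :: "'a \<Rightarrow> complex"
  assumes "integrable M f" "L1_norm M f \<le> 0"
  shows "AE x in M. f x = 0"
proof -
  have "(\<integral>x. norm (f x) \<partial>M) = 0"
    using assms(2) L1_norm_nonneg[of M f] unfolding L1_norm_def by linarith
  then show ?thesis
    using integral_nonneg_eq_0_iff_AE[of M "\<lambda>x. norm (f x)"] assms(1) by simp
qed

definition multiplicative_functional :: "'a::ab_group_add measure \<Rightarrow> (('a \<Rightarrow> complex) \<Rightarrow> complex) \<Rightarrow> bool" where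
  "multiplicative_functional M \<Phi> \<longleftrightarrow>
     (\<forall>f g. integrable M f \<longrightarrow> integrable M g \<longrightarrow> (AE x in M. f x = g x) \<longrightarrow> \<Phi> f = \<Phi> g) \<and>
     (\<forall>f g. integrable M f \<longrightarrow> integrable M g \<longrightarrow> \<Phi> (\<lambda>x. f x + g x) = \<Phi> f + \<Phi> g) \<and>
     (\<forall>c f. integrable M f \<longrightarrow> \<Phi> (\<lambda>x. c * f x) = c * \<Phi> f) \<and>
     (\<forall>f g. integrable M f \<longrightarrow> integrable M g \<longrightarrow> \<Phi> (fourier_conv M f g) = \<Phi> f * \<Phi> g)"

lemma multiplicative_functionalD:
  assumes "multiplicative_functional M \<Phi>"
  shows "integrable M f \<Longrightarrow> integrable M g \<Longrightarrow> AE x in M. f x = g x \<Longrightarrow> \<Phi> f = \<Phi> g"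
    and "integrable M f \<Longrightarrow> integrable M g \<Longrightarrow> \<Phi> (\<lambda>x. f x + g x) = \<Phi> f + \<Phi> g"
    and "integrable M f \<Longrightarrow> \<Phi> (\<lambda>x. c * f x) = c * \<Phi> f"
    and "integrable M f \<Longrightarrow> integrable M g \<Longrightarrow> \<Phi> (fourier_conv M f g) = \<Phi> f * \<Phi> g"
proof -
  note * = assms[unfolded multiplicative_functional_def]
  note ** = *[THEN conjunct2] note *** = **[THEN conjunct2]
  show "integrable M f \<Longrightarrow> integrable M g \<Longrightarrow> AE x in M. f x = g x \<Longrightarrow> \<Phi> f = \<Phi> g"
    by (rule *[THEN conjunct1, rule_format])
  show "integrable M f \<Longrightarrow> integrable M g \<Longrightarrow> \<Phi> (\<lambda>x. f x + g x) = \<Phi> f + \<Phi> g"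
    by (rule **[THEN conjunct1, rule_format])
  show "integrable M f \<Longrightarrow> \<Phi> (\<lambda>x. c * f x) = c * \<Phi> f"
    by (rule ***[THEN conjunct1, rule_format])
  show "integrable M f \<Longrightarrow> integrable M g \<Longrightarrow> \<Phi> (fourier_conv M f g) = \<Phi> f * \<Phi> g"
    by (rule ***[THEN conjunct2, rule_format])
qed

text \<open>
  If one value had norm above \<open>1\<close>, its powers would be unbounded values; values of norm below \<open>1\<close> are
  excluded by passing to inverses.
\<close>

lemma norm_eq_1_of_bounded_hom:
  fixes v :: "'a::ab_group_add \<Rightarrow> complex"
  assumes D: "is_subgroup D" and v: "v 0 = 1" "\<And>s t. s \<in> D \<Longrightarrow> t \<in> D \<Longrightarrow> v (s + t) = v s * v t"
    and B: "\<And>s. s \<in> D \<Longrightarrow> norm (v s) \<le> B" and s: "s \<in> D"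
  shows "norm (v s) = 1"
proof -
  have le: "norm (v t) \<le> 1" if t: "t \<in> D" for t
  proof (rule ccontr)
    assume "\<not> norm (v t) \<le> 1"
    then obtain n where n: "B < norm (v t) ^ n" using real_arch_pow[of "norm (v t)" B] by auto
    have "\<exists>w\<in>D. v w = v t ^ n" for n
    proof (induction n)
      case 0
      then show ?case using v(1) is_subgroupD(1)[OF D] by auto
    next
      case (Suc n)
      then obtain w where "w \<in> D" "v w = v t ^ n" by blast
      then show ?case
        using v(2)[OF t] is_subgroupD(4)[OF D t] by (intro bexI[of _ "t + w"]) auto
    qed
    then obtain w where "w \<in> D" "v w = v t ^ n" by blast
    then show False using B[of w] n by (simp add: norm_power)
  qed
  have "v s * v (- s) = 1" using v(2)[OF s is_subgroupD(3)[OF D s]] v(1) by simp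
  then have "norm (v s) * norm (v (- s)) = 1" by (metis norm_mult norm_one)
  moreover have "norm (v s) * norm (v (- s)) \<le> norm (v s) * 1"
    using le[OF is_subgroupD(3)[OF D s]] by (intro mult_left_mono) auto
  ultimately show ?thesis using le[OF s] by linarith
qed

lemma is_subgroup_UNIV: "is_subgroup UNIV"
  by (simp add: is_subgroup_def)

lemma charactersD:
  assumes "\<xi> \<in> characters"
  shows "continuous_on UNIV \<xi>" "norm (\<xi> x) = 1" "\<xi> (x + y) = \<xi> x * \<xi> y" "\<xi> 0 = 1"
    "\<xi> (- x) = cnj (\<xi> x)" "\<xi> (x - y) = \<xi> x * cnj (\<xi> y)"
proof -
  show "continuous_on UNIV \<xi>" and n: "norm (\<xi> x) = 1" and m: "\<xi> (x + y) = \<xi> x * \<xi> y" for x y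
    using assms by (auto simp: characters_def)
  have "\<xi> 0 \<noteq> 0" using n[of 0] by auto
  then show zero: "\<xi> 0 = 1" using m[of 0 0] by simp
  have unit: "\<xi> x * cnj (\<xi> x) = 1" for x
    using n[of x] by (simp add: complex_norm_square[symmetric])
  show minus: "\<xi> (- x) = cnj (\<xi> x)" for x
  proof -
    have "\<xi> (- x) = \<xi> (- x) * (\<xi> x * cnj (\<xi> x))" using unit by simp
    also have "\<dots> = \<xi> (- x + x) * cnj (\<xi> x)" by (simp only: m mult.assoc)
    finally show ?thesis using zero by simp
  qed
  show "\<xi> (x - y) = \<xi> x * cnj (\<xi> y)"
    using m[of x "- y"] minus by simp
qed

lemma charactersI:
  assumes "continuous_on UNIV \<xi>" "\<And>x. norm (\<xi> x) = 1" "\<And>x y. \<xi> (x + y) = \<xi> x * \<xi> y"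
  shows "\<xi> \<in> characters"
  using assms by (simp add: characters_def)

lemma cnj_character: "\<xi> \<in> characters \<Longrightarrow> (\<lambda>x. cnj (\<xi> x)) \<in> characters"
  by (auto simp: characters_def intro!: continuous_intros)

lemma zero_not_character: "(\<lambda>_. 0) \<notin> characters"
  by (simp add: characters_def)

context haar
begin

text \<open>
  If \<open>\<Phi> f = 1\<close> and \<open>f\<close> had norm below \<open>1\<close>, then \<open>g = f + f \<star> g\<close> would have a solution, and applying \<open>\<Phi>\<close> would give
  \<open>\<Phi> g = 1 + \<Phi> g\<close>.
\<close>

lemma multiplicative_functional_bounded:
  assumes \<Phi>: "multiplicative_functional M \<Phi>"
  shows "L1_functional M \<Phi> 1"
proof -
  have ae: "integrable M f \<Longrightarrow> integrable M g \<Longrightarrow> AE x in M. f x = g x \<Longrightarrow> \<Phi> f = \<Phi> g"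
    and add: "integrable M f \<Longrightarrow> integrable M g \<Longrightarrow> \<Phi> (\<lambda>x. f x + g x) = \<Phi> f + \<Phi> g"
    and scale: "integrable M f \<Longrightarrow> \<Phi> (\<lambda>x. c * f x) = c * \<Phi> f"
    and mult: "integrable M f \<Longrightarrow> integrable M g \<Longrightarrow> \<Phi> (fourier_conv M f g) = \<Phi> f * \<Phi> g" for f g c
    by (fact multiplicative_functionalD[OF \<Phi>])+
  have "norm (\<Phi> f) \<le> L1_norm M f" if f: "integrable M f" for f
  proof (rule ccontr)
    assume *: "\<not> norm (\<Phi> f) \<le> L1_norm M f"
    then have \<Phi>f: "\<Phi> f \<noteq> 0" using L1_norm_nonneg[of M f] by auto
    define k where "k x = inverse (\<Phi> f) * f x" for x
    have k: "integrable M k" using f by (simp add: k_def[abs_def])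
    have \<Phi>k: "\<Phi> k = 1" using scale[OF f] \<Phi>f by (simp add: k_def[abs_def])
    define r where "r = L1_norm M k"
    have "r = inverse (norm (\<Phi> f)) * L1_norm M f"
      unfolding r_def k_def[abs_def] L1_norm_cmult by (simp add: norm_inverse)
    then have "r * norm (\<Phi> f) < 1 * norm (\<Phi> f)"
      using * \<Phi>f by (simp add: field_simps)
    then have r: "0 \<le> r" "r < 1"
      using \<Phi>f by (simp_all only: r_def L1_norm_nonneg mult_less_cancel_right) auto
    define s where "s = rec_nat k (\<lambda>_ h x. k x + fourier_conv M k h x)"
    have s0: "s 0 = k" and sS: "s (Suc n) = (\<lambda>x. k x + fourier_conv M k (s n) x)" for n
      by (simp_all add: s_def)
    have s: "integrable M (s n)" for n
      by (induction n) (auto simp: s0 sS intro!: k fourier_conv_L1)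
    have step: "L1_norm M (\<lambda>x. fourier_conv M k p x - fourier_conv M k q x) \<le> r * L1_norm M (\<lambda>x. p x - q x)"
      if "integrable M p" "integrable M q" for p q
      using fourier_conv_diff_le[OF k that(1) k that(2)] by (simp add: r_def L1_norm_def)
    have Cauchy: "L1_norm M (\<lambda>x. s (Suc n) x - s n x) \<le> r * r * r ^ n" for n
    proof (induction n)
      case 0
      then show ?case using fourier_conv_L1(2)[OF k k] by (simp add: s0 sS r_def)
    next
      case (Suc n)
      have "L1_norm M (\<lambda>x. s (Suc (Suc n)) x - s (Suc n) x) \<le> r * L1_norm M (\<lambda>x. s (Suc n) x - s n x)"
        using step[OF s[of "Suc n"] s[of n]] by (simp add: sS[of "Suc n"]) (simp add: sS)
      also have "\<dots> \<le> r * (r * r * r ^ n)" using Suc r by (intro mult_left_mono) auto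
      finally show ?case by (simp add: mult_ac)
    qed
    obtain g where g: "integrable M g" "(\<lambda>n. L1_norm M (\<lambda>x. g x - s n x)) \<longlonglongrightarrow> 0"
      by (rule L1_complete[OF s r Cauchy], rule that)
    define h where "h x = k x + fourier_conv M k g x" for x
    have h: "integrable M h" unfolding h_def[abs_def] using k fourier_conv_L1(1)[OF k g(1)] by simp
    have le: "L1_norm M (\<lambda>x. h x - g x) \<le> r * L1_norm M (\<lambda>x. g x - s n x) + L1_norm M (\<lambda>x. g x - s (Suc n) x)" for n
    proof -
      have "L1_norm M (\<lambda>x. h x - s (Suc n) x) \<le> r * L1_norm M (\<lambda>x. g x - s n x)"
        using step[OF g(1) s[of n]] by (simp add: h_def sS)
      then show ?thesis
        using L1_norm_triangle_minus[OF h s[of "Suc n"] g(1)] L1_norm_minus_commute[of M "s (Suc n)" g] by linarith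
    qed
    have "(\<lambda>n. r * L1_norm M (\<lambda>x. g x - s n x) + L1_norm M (\<lambda>x. g x - s (Suc n) x)) \<longlonglongrightarrow> r * 0 + 0"
      by (intro tendsto_add tendsto_mult tendsto_const g(2) LIMSEQ_Suc[OF g(2)])
    then have "L1_norm M (\<lambda>x. h x - g x) \<le> r * 0 + 0"
      by (rule LIMSEQ_le_const) (use le in blast)
    then have "AE x in M. h x - g x = 0"
      using h g(1) by (intro L1_norm_eq_0_AE) auto
    then have "\<Phi> h = \<Phi> g"
      by (intro ae h g(1)) simp
    moreover have "\<Phi> h = 1 + \<Phi> g"
      unfolding h_def[abs_def] using add[OF k fourier_conv_L1(1)[OF k g(1)]] mult[OF k g(1)] \<Phi>k by simp
    ultimately show False by simp
  qed
  then show ?thesis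
    unfolding L1_functional_def using add scale by simp
qed

text \<open>
  If \<open>\<Phi> g \<noteq> 0\<close>, the translates of \<open>g\<close> give the character \<open>\<xi> u = \<Phi> (shift u g) / \<Phi> g\<close>, and applying
  \<open>\<Phi>\<close> to \<open>f \<star> g\<close> shows that \<open>\<Phi> f\<close> is the integral of \<open>f\<close> against \<open>\<xi>\<close>.
\<close>

lemma multiplicative_functional_is_fourier:
  assumes \<Phi>: "multiplicative_functional M \<Phi>" and g: "integrable M g" "\<Phi> g \<noteq> 0"
  obtains \<xi> where "\<xi> \<in> characters" "\<And>f. integrable M f \<Longrightarrow> \<Phi> f = fourier M f \<xi>"
proof -
  note lin = multiplicative_functional_bounded[OF \<Phi>]
  have mult: "integrable M f \<Longrightarrow> integrable M g \<Longrightarrow> \<Phi> (fourier_conv M f g) = \<Phi> f * \<Phi> g" for f g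
    by (rule multiplicative_functionalD(4)[OF \<Phi>])
  define \<xi> where "\<xi> u = \<Phi> (shift u g) / \<Phi> g" for u
  note b = functional_shift_bounds[OF lin g(1)]
  have hom: "\<xi> (u + v) = \<xi> u * \<xi> v" for u v
  proof -
    have "\<Phi> (shift u g) * \<Phi> (shift v g) = \<Phi> (shift (u + v) g) * \<Phi> g"
      using mult[OF shift_L1(1)[OF g(1)] shift_L1(1)[OF g(1)], of u v] mult[OF shift_L1(1)[OF g(1)] g(1), of "u + v"]
        fourier_conv_shift(2)[OF g(1) g(1), of u v] by simp
    then show ?thesis using g(2) by (simp add: \<xi>_def field_simps)
  qed
  have "norm (\<xi> u) \<le> L1_norm M g / norm (\<Phi> g)" for u
    using b(1)[of u] by (simp add: \<xi>_def norm_divide divide_right_mono)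
  then have "norm (\<xi> u) = 1" for u
    using hom g(2) by (intro norm_eq_1_of_bounded_hom[OF is_subgroup_UNIV]) (auto simp: \<xi>_def)
  moreover have "continuous_on UNIV \<xi>"
    unfolding \<xi>_def[abs_def] using b(2) g(2) by (intro continuous_intros) auto
  ultimately have \<xi>: "\<xi> \<in> characters"
    using hom by (intro charactersI) auto
  have "\<Phi> f = fourier M f (\<lambda>x. cnj (\<xi> x))" if f: "integrable M f" for f
  proof -
    have "\<Phi> f * \<Phi> g = (\<integral>u. f u * \<Phi> (shift u g) \<partial>M)"
      using functional_of_fourier_conv[OF lin f g(1)] mult[OF f g(1)] by simp
    also have "\<dots> = (\<integral>u. (f u * \<xi> u) * \<Phi> g \<partial>M)"
      using g(2) by (simp add: \<xi>_def)
    also have "\<dots> = (\<integral>u. f u * \<xi> u \<partial>M) * \<Phi> g"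
      by (rule integral_mult_left_zero)
    finally show ?thesis using g(2) by (simp add: fourier_def)
  qed
  then show thesis using that[OF cnj_character[OF \<xi>]] by blast
qed

lemma integrable_mult_character:
  assumes "integrable M f" "\<xi> \<in> characters \<union> {\<lambda>_. 0}"
  shows "integrable M (\<lambda>x. f x * cnj (\<xi> x))" "norm (fourier M f \<xi>) \<le> L1_norm M f"
proof -
  have "continuous_on UNIV (\<lambda>x. cnj (\<xi> x))" "\<And>x. norm (cnj (\<xi> x)) \<le> 1"
    using assms(2) charactersD[of \<xi>] by (auto intro!: continuous_intros)
  from integrable_mult_bounded_continuous[OF assms(1) continuous_borel_measurable[OF this(1)] this(2)]
  show "integrable M (\<lambda>x. f x * cnj (\<xi> x))" "norm (fourier M f \<xi>) \<le> L1_norm M f"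
    by (simp_all add: fourier_def)
qed

text \<open>
  Translating \<open>g\<close> by \<open>u\<close> multiplies its transform at \<open>\<xi>\<close> by the conjugate of \<open>\<xi> u\<close>, so the integral of the transforms of the
  translates against \<open>f\<close> is a product.
\<close>

lemma fourier_multiplicative:
  assumes \<xi>: "\<xi> \<in> characters \<union> {\<lambda>_. 0}"
  shows "multiplicative_functional M (\<lambda>f. fourier M f \<xi>)"
  unfolding multiplicative_functional_def
proof (intro conjI allI impI)
  note int = integrable_mult_character(1)[OF _ \<xi>]
  show "fourier M f \<xi> = fourier M g \<xi>" if "integrable M f" "integrable M g" "AE x in M. f x = g x" for f g
    unfolding fourier_def using int[OF that(1)] int[OF that(2)] that(3) by (intro integral_cong_AE) auto
  show add: "fourier M (\<lambda>x. f x + g x) \<xi> = fourier M f \<xi> + fourier M g \<xi>" if "integrable M f" "integrable M g" for f g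
    using int[OF that(1)] int[OF that(2)] by (simp add: fourier_def distrib_right)
  show scale: "fourier M (\<lambda>x. c * f x) \<xi> = c * fourier M f \<xi>" for c f
    by (simp add: fourier_def mult.assoc)
  fix f g :: "'a \<Rightarrow> complex" assume f: "integrable M f" and g: "integrable M g"
  show "fourier M (fourier_conv M f g) \<xi> = fourier M f \<xi> * fourier M g \<xi>"
  proof (cases "\<xi> \<in> characters")
    case True
    have lin: "L1_functional M (\<lambda>f. fourier M f \<xi>) 1"
      unfolding L1_functional_def using add scale integrable_mult_character(2)[OF _ \<xi>] by simp
    have "fourier M (shift u g) \<xi> = cnj (\<xi> u) * fourier M g \<xi>" for u
    proof -
      have "fourier M (shift u g) \<xi> = (\<integral>x. cnj (\<xi> u) * (g (x - u) * cnj (\<xi> (x - u))) \<partial>M)"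
      proof -
        have "\<xi> x = \<xi> u * \<xi> (x - u)" for x
          using charactersD(3)[OF True, of u "x - u"] by simp
        then show ?thesis unfolding fourier_def shift_def
          by (intro Bochner_Integration.integral_cong refl) (metis complex_cnj_mult mult.left_commute)
      qed
      also have "\<dots> = cnj (\<xi> u) * (\<integral>x. g x * cnj (\<xi> x) \<partial>M)"
        using integral_translate(6)[OF int[OF g], of u] by simp
      finally show ?thesis by (simp add: fourier_def)
    qed
    then show ?thesis
      using functional_of_fourier_conv[OF lin f g] by (simp add: fourier_def mult.assoc[symmetric])
  qed (use \<xi> in \<open>simp add: fourier_def\<close>)
qed

lemma multiplicative_functional_cases:
  assumes \<Phi>: "multiplicative_functional M \<Phi>"
  obtains \<xi> where "\<xi> \<in> characters \<union> {\<lambda>_. 0}" "\<And>f. integrable M f \<Longrightarrow> \<Phi> f = fourier M f \<xi>"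
    "\<xi> = (\<lambda>_. 0) \<longleftrightarrow> (\<forall>f. integrable M f \<longrightarrow> \<Phi> f = 0)"
proof (cases "\<forall>f. integrable M f \<longrightarrow> \<Phi> f = 0")
  case True
  then show thesis by (intro that[of "\<lambda>_. 0"]) (auto simp: fourier_def)
next
  case False
  then obtain g where g: "integrable M g" "\<Phi> g \<noteq> 0" by blast
  obtain \<xi> where \<xi>: "\<xi> \<in> characters" "\<And>f. integrable M f \<Longrightarrow> \<Phi> f = fourier M f \<xi>"
    by (rule multiplicative_functional_is_fourier[OF \<Phi> g], rule that)
  then have "\<xi> \<noteq> (\<lambda>_. 0)" using zero_not_character by auto
  then show thesis using that[of \<xi>] \<xi> g by blast
qed

end

section \<open>The dual group is a locally compact topological group\<close>

lemma char_of_character: "char_of \<xi> \<in> characters"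
  by (rule char_of)

lemmas char_ofD = charactersD[OF char_of_character]

lemma char_of_ops:
  "char_of 0 x = 1" "char_of (\<xi> + \<psi>) x = char_of \<xi> x * char_of \<psi> x" "char_of (- \<xi>) x = cnj (char_of \<xi> x)"
  by (simp_all add: zero_dual.rep_eq plus_dual.rep_eq uminus_dual.rep_eq)

lemma dual_eqI:
  assumes "\<And>x. char_of \<xi> x = char_of \<psi> x"
  shows "\<xi> = \<psi>"
  using assms char_of_inject[of \<xi> \<psi>] by (simp add: fun_eq_iff)

lemma open_dual_subbasic: "compact K \<Longrightarrow> open U \<Longrightarrow> open {\<xi>. char_of \<xi> ` K \<subseteq> U}"
  unfolding open_dual_def by (rule generate_topology.Basis) auto

text \<open>
  Together with the next lemma: the compact-open topology is the topology of uniform convergence on compact sets.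
  For this half, the compact set is covered by finitely many pieces on which \<open>\<xi>0\<close> is nearly constant.
\<close>

lemma dual_uniform_nbhd:
  fixes \<xi>0 :: "'a::topological_ab_group_add dual"
  assumes K: "compact K" and e: "0 < e"
  obtains W where "open W" "\<xi>0 \<in> W" "\<And>\<xi> x. \<xi> \<in> W \<Longrightarrow> x \<in> K \<Longrightarrow> norm (char_of \<xi> x - char_of \<xi>0 x) < e"
proof -
  let ?f = "char_of \<xi>0"
  note cont = char_ofD(1)[of \<xi>0]
  define A where "A x = {y. norm (?f y - ?f x) < e / 3}" for x
  define C where "C x = K \<inter> {y. norm (?f y - ?f x) \<le> e / 3}" for x
  have "open (A x)" for x
    unfolding A_def by (intro open_Collect_less continuous_intros cont)
  moreover have "x \<in> A x" for x using e by (simp add: A_def)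
  ultimately obtain D where D: "D \<subseteq> K" "finite D" "K \<subseteq> (\<Union>x\<in>D. A x)"
    by (metis compactE_image[OF K, of K A] UN_I subsetI)
  have C: "compact (C x)" for x
    unfolding C_def using K by (intro compact_Int_closed closed_Collect_le continuous_intros cont)
  define W where "W = (\<Inter>x\<in>D. {\<xi>. char_of \<xi> ` C x \<subseteq> ball (?f x) (e / 2)})"
  show thesis
  proof (rule that[of W])
    show "open W"
      unfolding W_def using D(2) C by (intro open_INT ballI open_dual_subbasic) auto
    show "\<xi>0 \<in> W"
      using e by (auto simp: W_def C_def dist_norm norm_minus_commute)
    fix \<xi> y assume "\<xi> \<in> W" "y \<in> K"
    then obtain x where x: "x \<in> D" "norm (?f y - ?f x) < e / 3" using D(3) by (auto simp: A_def)
    then have "y \<in> C x" using \<open>y \<in> K\<close> by (simp add: C_def)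
    then have "char_of \<xi> y \<in> ball (?f x) (e / 2)"
      using \<open>\<xi> \<in> W\<close> x(1) unfolding W_def by blast
    then have "norm (char_of \<xi> y - ?f x) < e / 2"
      by (simp add: dist_norm norm_minus_commute)
    then show "norm (char_of \<xi> y - ?f y) < e"
      using x(2) e norm_triangle_ineq4[of "char_of \<xi> y - ?f x" "?f y - ?f x"] by simp
  qed
qed

lemma open_dual_uniform:
  fixes S :: "'a::topological_ab_group_add dual set"
  assumes "open S" "\<xi>0 \<in> S"
  shows "\<exists>K e. compact K \<and> 0 < e \<and> (\<forall>\<xi>. (\<forall>x\<in>K. norm (char_of \<xi> x - char_of \<xi>0 x) < e) \<longrightarrow> \<xi> \<in> S)"
  using assms unfolding open_dual_def
proof (induction rule: generate_topology.induct)
  case UNIV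
  then show ?case by (intro exI[of _ "{}"] exI[of _ 1]) auto
next
  case (Int S T)
  then obtain K e L d where K: "compact K" "0 < e" "\<And>\<xi>. (\<forall>x\<in>K. norm (char_of \<xi> x - char_of \<xi>0 x) < e) \<Longrightarrow> \<xi> \<in> S"
    and L: "compact L" "0 < d" "\<And>\<xi>. (\<forall>x\<in>L. norm (char_of \<xi> x - char_of \<xi>0 x) < d) \<Longrightarrow> \<xi> \<in> T"
    by blast
  show ?case
    by (intro exI[of _ "K \<union> L"] exI[of _ "min e d"] conjI compact_Un allI impI IntI K L) (use K L in auto)
next
  case (UN \<S>)
  then obtain S where S: "S \<in> \<S>" "\<xi>0 \<in> S" by blast
  from UN.IH[OF this] S(1) show ?case by blast
next
  case (Basis S)
  then obtain K U where S: "S = {\<xi>. char_of \<xi> ` K \<subseteq> U}" "compact K" "open U" by blast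
  have "compact (char_of \<xi>0 ` K)"
    using S(2) char_ofD(1)[of \<xi>0] by (intro compact_continuous_image) (auto intro: continuous_on_subset)
  moreover have "char_of \<xi>0 ` K \<subseteq> U" using Basis S by auto
  ultimately obtain e where e: "0 < e" "(\<Union>z\<in>char_of \<xi>0 ` K. ball z e) \<subseteq> U"
    using compact_subset_open_imp_ball_epsilon_subset[OF _ S(3)] by metis
  show ?case
  proof (intro exI[of _ K] exI[of _ e] conjI allI impI)
    fix \<xi> assume near: "\<forall>x\<in>K. norm (char_of \<xi> x - char_of \<xi>0 x) < e"
    have "char_of \<xi> x \<in> U" if "x \<in> K" for x
    proof -
      have "char_of \<xi> x \<in> ball (char_of \<xi>0 x) e"
        using near that by (simp add: dist_norm norm_minus_commute)
      then show ?thesis using e(2) that by blast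
    qed
    then show "\<xi> \<in> S" using S(1) by auto
  qed (use S e in auto)
qed

lemma open_dual_uniformE:
  fixes S :: "'a::topological_ab_group_add dual set"
  assumes "open S" "\<xi>0 \<in> S"
  obtains K e where "compact K" "0 < e" "\<And>\<xi>. (\<forall>x\<in>K. norm (char_of \<xi> x - char_of \<xi>0 x) < e) \<Longrightarrow> \<xi> \<in> S"
  using open_dual_uniform[OF assms] that by (elim exE conjE) simp

instance dual :: (topological_ab_group_add) t2_space
proof
  fix \<xi> \<psi> :: "'a dual" assume "\<xi> \<noteq> \<psi>"
  then obtain x where x: "char_of \<xi> x \<noteq> char_of \<psi> x" using dual_eqI by blast
  obtain U V where UV: "open U" "open V" "char_of \<xi> x \<in> U" "char_of \<psi> x \<in> V" "U \<inter> V = {}"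
    using hausdorff[OF x] by blast
  show "\<exists>U V. open U \<and> open V \<and> \<xi> \<in> U \<and> \<psi> \<in> V \<and> U \<inter> V = {}"
  proof (intro exI conjI)
    show "open {\<xi>. char_of \<xi> ` {x} \<subseteq> U}" "open {\<xi>. char_of \<xi> ` {x} \<subseteq> V}"
      using UV by (simp_all only: open_dual_subbasic compact_sing)
  qed (use UV in auto)
qed

instance dual :: (topological_ab_group_add) topological_ab_group_add
proof
  fix a b :: "'a dual"
  show "((\<lambda>p. fst p + snd p) \<longlongrightarrow> a + b) (nhds a \<times>\<^sub>F nhds b)"
  proof (rule topological_tendstoI)
    fix S :: "'a dual set" assume "open S" "a + b \<in> S"
    obtain K e where K: "compact K" "0 < e"
        "\<And>\<xi>. (\<forall>x\<in>K. norm (char_of \<xi> x - char_of (a + b) x) < e) \<Longrightarrow> \<xi> \<in> S"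
      by (rule open_dual_uniformE[OF \<open>open S\<close> \<open>a + b \<in> S\<close>], rule that)
    obtain V where V: "open V" "a \<in> V" "\<And>\<xi> x. \<xi> \<in> V \<Longrightarrow> x \<in> K \<Longrightarrow> norm (char_of \<xi> x - char_of a x) < e / 2"
      by (rule dual_uniform_nbhd[OF K(1) half_gt_zero[OF K(2)]], rule that)
    obtain W where W: "open W" "b \<in> W" "\<And>\<xi> x. \<xi> \<in> W \<Longrightarrow> x \<in> K \<Longrightarrow> norm (char_of \<xi> x - char_of b x) < e / 2"
      by (rule dual_uniform_nbhd[OF K(1) half_gt_zero[OF K(2)]], rule that)
    have "c + d \<in> S" if "c \<in> V" "d \<in> W" for c d
    proof (rule K(3), intro ballI)
      fix x assume x: "x \<in> K"
      have "char_of (c + d) x - char_of (a + b) x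
          = (char_of c x - char_of a x) * char_of d x + char_of a x * (char_of d x - char_of b x)"
        by (simp add: char_of_ops algebra_simps)
      also have "norm \<dots> \<le> norm (char_of c x - char_of a x) + norm (char_of d x - char_of b x)"
        by (rule order_trans[OF norm_triangle_ineq]) (simp add: norm_mult char_ofD)
      also have "\<dots> < e" using V(3)[OF that(1) x] W(3)[OF that(2) x] by simp
      finally show "norm (char_of (c + d) x - char_of (a + b) x) < e" .
    qed
    then show "\<forall>\<^sub>F p in nhds a \<times>\<^sub>F nhds b. fst p + snd p \<in> S"
      unfolding eventually_prod_filter
      using eventually_nhds_in_open[OF V(1,2)] eventually_nhds_in_open[OF W(1,2)] by (metis fst_conv snd_conv)
  qed
next
  fix a :: "'a dual"
  show "(uminus \<longlongrightarrow> - a) (nhds a)"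
  proof (rule topological_tendstoI)
    fix S :: "'a dual set" assume "open S" "- a \<in> S"
    obtain K e where K: "compact K" "0 < e"
        "\<And>\<xi>. (\<forall>x\<in>K. norm (char_of \<xi> x - char_of (- a) x) < e) \<Longrightarrow> \<xi> \<in> S"
      by (rule open_dual_uniformE[OF \<open>open S\<close> \<open>- a \<in> S\<close>], rule that)
    obtain V where V: "open V" "a \<in> V" "\<And>\<xi> x. \<xi> \<in> V \<Longrightarrow> x \<in> K \<Longrightarrow> norm (char_of \<xi> x - char_of a x) < e"
      by (rule dual_uniform_nbhd[OF K(1,2)], rule that)
    have "- c \<in> S" if "c \<in> V" for c
    proof (rule K(3), intro ballI)
      fix x assume "x \<in> K"
      then show "norm (char_of (- c) x - char_of (- a) x) < e"
        using V(3)[OF that, of x] by (simp add: char_of_ops flip: complex_cnj_diff)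
    qed
    with eventually_nhds_in_open[OF V(1,2)] show "\<forall>\<^sub>F c in nhds a. - c \<in> S"
      by (rule eventually_mono)
  qed
qed

lemma unit_circle_doubling:
  fixes z :: complex
  assumes "norm z = 1" "norm (z - 1) \<le> 1"
  shows "norm (z - 1) \<le> 2 / 3 * norm (z * z - 1)"
proof -
  have "(norm (z - 1))\<^sup>2 = (norm z)\<^sup>2 + 1 - 2 * Re z"
    unfolding cmod_power2 by (simp add: power2_eq_square algebra_simps)
  moreover have "(norm (z - 1))\<^sup>2 \<le> 1"
    using assms(2) by (simp add: power_le_one)
  ultimately have "1 / 2 \<le> Re z" using assms(1) by simp
  then have "3 / 2 \<le> norm (z + 1)"
    using complex_Re_le_cmod[of "z + 1"] by simp
  then have "norm (z - 1) * (3 / 2) \<le> norm (z - 1) * norm (z + 1)"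
    by (intro mult_left_mono) auto
  also have "\<dots> = norm (z * z - 1)"
    by (simp add: norm_mult[symmetric] algebra_simps)
  finally show ?thesis by simp
qed

definition circle_homs_near_1 :: "'a::ab_group_add set \<Rightarrow> ('a \<Rightarrow> complex) set" where
  "circle_homs_near_1 K = {f. (\<forall>x. norm (f x) = 1) \<and> (\<forall>x y. f (x + y) = f x * f y) \<and> (\<forall>x\<in>K. norm (f x - 1) \<le> 1)}"

text \<open>
  Doubling a point of the circle near \<open>1\<close> multiplies its distance to \<open>1\<close> by at least \<open>3/2\<close>. So a homomorphism that
  stays within distance \<open>1\<close> of \<open>1\<close> on a neighbourhood of \<open>0\<close> is within \<open>(2/3)\<^sup>j\<close> of \<open>1\<close> at points whose
  first \<open>j\<close> doublings remain in the neighbourhood.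
\<close>

lemma circle_homs_equicontinuous:
  fixes U :: "'a::topological_ab_group_add set"
  assumes "open U" "0 \<in> U" "U \<subseteq> K" "0 < e"
  obtains V where "open V" "0 \<in> V" "\<And>f h. f \<in> circle_homs_near_1 K \<Longrightarrow> h \<in> V \<Longrightarrow> norm (f h - 1) < e"
proof -
  have *: "\<exists>V. open V \<and> 0 \<in> V \<and> (\<forall>f\<in>circle_homs_near_1 K. \<forall>h\<in>V. norm (f h - 1) \<le> (2 / 3) ^ j)" for j
  proof (induction j)
    case 0
    then show ?case
      using assms by (intro exI[of _ U]) (auto simp: circle_homs_near_1_def)
  next
    case (Suc j)
    then obtain V where V: "open V" "0 \<in> V" "\<And>f h. f \<in> circle_homs_near_1 K \<Longrightarrow> h \<in> V \<Longrightarrow> norm (f h - 1) \<le> (2 / 3) ^ j"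
      by blast
    have "open (U \<inter> (\<lambda>h. h + h) -` V)"
      using assms(1) V(1) by (intro open_Int open_vimage continuous_intros) auto
    moreover have "norm (f h - 1) \<le> (2 / 3) ^ Suc j" if f: "f \<in> circle_homs_near_1 K" and h: "h \<in> U \<inter> (\<lambda>h. h + h) -` V" for f h
    proof -
      have "norm (f h - 1) \<le> 2 / 3 * norm (f h * f h - 1)"
        using f h assms(3) by (intro unit_circle_doubling) (auto simp: circle_homs_near_1_def)
      also have "f h * f h = f (h + h)" using f by (simp add: circle_homs_near_1_def)
      also have "2 / 3 * norm (f (h + h) - 1) \<le> 2 / 3 * (2 / 3) ^ j"
        using V(3)[OF f] h by (intro mult_left_mono) auto
      finally show ?thesis by simp
    qed
    ultimately show ?case
      using assms(2) V(2) by (intro exI[of _ "U \<inter> (\<lambda>h. h + h) -` V"]) auto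
  qed
  obtain j where j: "(2 / 3 :: real) ^ j < e"
    using real_arch_pow_inv[OF assms(4), of "2 / 3"] by auto
  show thesis
    using *[of j] j that by (meson le_less_trans)
qed

lemma circle_homs_subset_characters:
  fixes U :: "'a::topological_ab_group_add set"
  assumes "open U" "0 \<in> U" "U \<subseteq> K"
  shows "circle_homs_near_1 K \<subseteq> characters"
proof
  fix f assume f: "f \<in> circle_homs_near_1 K"
  have "continuous_on UNIV f"
  proof (rule continuous_onI_uniform)
    fix e :: real assume "0 < e"
    then obtain V where V: "open V" "0 \<in> V" "\<And>f h. f \<in> circle_homs_near_1 K \<Longrightarrow> h \<in> V \<Longrightarrow> norm (f h - 1) < e"
      using circle_homs_equicontinuous[OF assms] by metis
    have "norm (f u - f v) \<le> e" if "u - v \<in> V" for u v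
    proof -
      have "f u = f v * f (u - v)"
        using f by (simp add: circle_homs_near_1_def flip: mult.commute) (metis add.commute diff_add_cancel mult.commute)
      then have "f u - f v = f v * (f (u - v) - 1)" by (simp add: algebra_simps)
      then have "norm (f u - f v) = norm (f (u - v) - 1)"
        using f by (simp add: norm_mult circle_homs_near_1_def)
      then show ?thesis using V(3)[OF f that] by simp
    qed
    then show "\<exists>U. open U \<and> 0 \<in> U \<and> (\<forall>u v. u - v \<in> U \<longrightarrow> norm (f u - f v) \<le> e)"
      using V by blast
  qed
  then show "f \<in> characters" using f by (simp add: characters_def circle_homs_near_1_def)
qed

lemma compact_circle_homs: "compact (circle_homs_near_1 K)"
proof -
  have "compactin (product_topology (\<lambda>_. euclidean) UNIV) (PiE UNIV (\<lambda>_::'a. sphere (0::complex) 1))"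
    by (simp add: compactin_PiE)
  then have 1: "compact (PiE UNIV (\<lambda>_::'a. sphere (0::complex) 1))"
    by (simp add: euclidean_product_topology)
  have coord: "continuous_on UNIV (\<lambda>f :: 'a \<Rightarrow> complex. f x)" for x
    by (rule continuous_on_product_coordinates)
  have "closed ((\<Inter>x. \<Inter>y. {f :: 'a \<Rightarrow> complex. f (x + y) = f x * f y}) \<inter> (\<Inter>x\<in>K. {f. norm (f x - 1) \<le> 1}))"
    by (intro closed_Int closed_INT ballI closed_Collect_eq closed_Collect_le continuous_intros coord)
  from compact_Int_closed[OF 1 this] show ?thesis
    by (rule arg_cong[of _ _ compact, THEN iffD1, rotated]) (auto simp: circle_homs_near_1_def)
qed

text \<open>
  On an equicontinuous set the pointwise topology and the compact-open topology agree, so that the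
  dual group inherits a compact neighbourhood of \<open>0\<close> from Tychonoff's theorem.
\<close>

lemma dual_locally_compact:
  fixes U :: "'a::topological_ab_group_add set"
  assumes U: "open U" "0 \<in> U" "U \<subseteq> K" and K: "compact K"
  shows "\<exists>V C. open V \<and> (0 :: 'a dual) \<in> V \<and> V \<subseteq> C \<and> compact C"
proof -
  let ?P = "circle_homs_near_1 K"
  note chars = circle_homs_subset_characters[OF U]
  have DP: "char_of (Dual f) = f" if "f \<in> ?P" for f
    using chars that by (auto intro: Dual_inverse)
  have "continuous_on ?P Dual"
    unfolding continuous_on_topological
  proof (intro ballI allI impI)
    fix f0 and B :: "'a dual set" assume f0: "f0 \<in> ?P" and B: "open B" "Dual f0 \<in> B"
    obtain L e where L: "compact L" "0 < e"
        "\<And>\<xi>. (\<forall>x\<in>L. norm (char_of \<xi> x - char_of (Dual f0) x) < e) \<Longrightarrow> \<xi> \<in> B"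
      by (rule open_dual_uniformE[OF B], rule that)
    obtain V where V: "open V" "0 \<in> V" "\<And>f h. f \<in> ?P \<Longrightarrow> h \<in> V \<Longrightarrow> norm (f h - 1) < e / 3"
      using circle_homs_equicontinuous[OF U, of "e / 3"] L(2) by (metis zero_less_divide_iff zero_less_numeral)
    obtain D where D: "finite D" "L \<subseteq> (\<Union>x\<in>D. (+) x ` V)"
      by (rule compactE_image[OF L(1), of L "\<lambda>x. (+) x ` V"]) (use V in \<open>force intro: open_translate\<close>)+
    define A where "A = (\<Inter>x\<in>D. {f :: 'a \<Rightarrow> complex. norm (f x - f0 x) < e / 3})"
    have "open A"
      unfolding A_def using D(1)
      by (intro open_INT ballI open_Collect_less continuous_intros continuous_on_product_coordinates)
    moreover have "f0 \<in> A" using L(2) by (simp add: A_def)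
    moreover have "Dual f \<in> B" if f: "f \<in> ?P" "f \<in> A" for f
    proof (rule L(3), intro ballI)
      fix y assume "y \<in> L"
      then obtain x h where xh: "x \<in> D" "h \<in> V" "y = x + h" using D(2) by blast
      have "f y - f0 y = f x * (f h - 1) + (f x - f0 x) - f0 x * (f0 h - 1)"
        using f f0 xh(3) by (simp add: circle_homs_near_1_def algebra_simps)
      also have "norm \<dots> \<le> norm (f x * (f h - 1)) + norm (f x - f0 x) + norm (f0 x * (f0 h - 1))"
        by (meson add_right_mono norm_triangle_ineq norm_triangle_ineq4 order_trans)
      also have "\<dots> < e / 3 + e / 3 + e / 3"
        using V(3)[OF f(1) xh(2)] V(3)[OF f0 xh(2)] f f0 xh(1)
        by (intro add_strict_mono) (auto simp: norm_mult circle_homs_near_1_def A_def)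
      finally show "norm (char_of (Dual f) y - char_of (Dual f0) y) < e"
        using DP f(1) f0 by simp
    qed
    ultimately show "\<exists>A. open A \<and> f0 \<in> A \<and> (\<forall>f\<in>?P. f \<in> A \<longrightarrow> Dual f \<in> B)" by blast
  qed
  then have "compact (Dual ` ?P)"
    by (rule compact_continuous_image[OF _ compact_circle_homs])
  moreover obtain W where W: "open W" "(0 :: 'a dual) \<in> W"
      "\<And>\<xi> x. \<xi> \<in> W \<Longrightarrow> x \<in> K \<Longrightarrow> norm (char_of \<xi> x - char_of 0 x) < 1"
    by (rule dual_uniform_nbhd[OF K zero_less_one], rule that)
  moreover have "W \<subseteq> Dual ` ?P"
  proof
    fix \<xi> assume "\<xi> \<in> W"
    then have "char_of \<xi> \<in> ?P"
      using W(3) by (auto simp: circle_homs_near_1_def char_ofD char_of_ops intro: less_imp_le)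
    then show "\<xi> \<in> Dual ` ?P" by (metis char_of_inverse imageI)
  qed
  ultimately show ?thesis by blast
qed

section \<open>Choosing representatives of homomorphisms to the circle\<close>

lemma countable_subgroup_generated:
  fixes H :: "'a::ab_group_add set"
  assumes "is_subgroup H" "countable S" "S \<subseteq> H"
  obtains D where "is_subgroup D" "countable D" "S \<subseteq> D" "D \<subseteq> H"
proof -
  define D where "D = sum_list ` lists (S \<union> uminus ` S)"
  have "is_subgroup D"
    unfolding is_subgroup_def
  proof (intro conjI ballI)
    show "0 \<in> D" unfolding D_def by (rule image_eqI[of _ _ "[]"]) auto
    fix x y assume "x \<in> D" "y \<in> D"
    then obtain xs ys where xs: "x = sum_list xs" "xs \<in> lists (S \<union> uminus ` S)"
      and ys: "y = sum_list ys" "ys \<in> lists (S \<union> uminus ` S)"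
      by (auto simp: D_def)
    have minus: "- sum_list ys = sum_list (map uminus ys)"
      by (induction ys) auto
    have "x - y = sum_list (xs @ map uminus ys)"
      by (simp add: xs(1) ys(1) flip: minus)
    moreover have "xs @ map uminus ys \<in> lists (S \<union> uminus ` S)"
      using xs(2) ys(2) by (auto simp: lists_eq_set)
    ultimately show "x - y \<in> D" unfolding D_def by (rule image_eqI)
  qed
  moreover have "countable D"
    unfolding D_def using assms(2) by (intro countable_image countable_lists) auto
  moreover have "S \<subseteq> D"
  proof
    fix x assume "x \<in> S"
    then show "x \<in> D" unfolding D_def by (intro image_eqI[of _ _ "[x]"]) auto
  qed
  moreover have "D \<subseteq> H"
  proof
    fix x assume "x \<in> D"
    then obtain xs where xs: "x = sum_list xs" "xs \<in> lists (S \<union> uminus ` S)" by (auto simp: D_def)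
    from xs(2) have "sum_list xs \<in> H"
      using assms(3) is_subgroupD[OF assms(1)] by (induction xs) auto
    then show "x \<in> H" using xs by simp
  qed
  ultimately show thesis by (rule that)
qed

text \<open>
  The extension is the limit along points of \<open>D\<close> that approach in the seminorm \<open>p\<close>. Distances are measured by \<open>p\<close>
  rather than by a topology because the seminorm will vary with the point of the target space.
\<close>

lemma circle_hom_extends_from_dense_subgroup:
  fixes v :: "'a::ab_group_add \<Rightarrow> complex" and p :: "'a \<Rightarrow> real"
  assumes D: "is_subgroup D" and v1: "\<And>s. s \<in> D \<Longrightarrow> norm (v s) = 1"
    and vm: "\<And>s t. s \<in> D \<Longrightarrow> t \<in> D \<Longrightarrow> v (s + t) = v s * v t"
    and lip: "\<And>s t. s \<in> D \<Longrightarrow> t \<in> D \<Longrightarrow> norm (v s - v t) \<le> c * p (s - t)" and c: "0 \<le> c"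
    and p: "p 0 = 0" "\<And>a. p (- a) = p a" "\<And>a b. p (a + b) \<le> p a + p b"
    and dense: "\<And>h e. h \<in> H \<Longrightarrow> 0 < e \<Longrightarrow> \<exists>s\<in>D. p (h - s) < e" and H: "is_subgroup H"
  shows "\<exists>w. (\<forall>h\<in>H. norm (w h) = 1) \<and> (\<forall>h\<in>H. \<forall>k\<in>H. w (h + k) = w h * w k) \<and>
    (\<forall>h\<in>H. \<forall>s\<in>D. norm (w h - v s) \<le> c * p (h - s)) \<and>
    (\<forall>h\<in>H. \<forall>k\<in>H. norm (w h - w k) \<le> c * p (h - k))"
proof -
  have "\<forall>h\<in>H. \<forall>n. \<exists>s\<in>D. p (h - s) < inverse (real (Suc n))"
    using dense by simp
  then obtain s where s: "\<And>h n. h \<in> H \<Longrightarrow> s h n \<in> D" "\<And>h n. h \<in> H \<Longrightarrow> p (h - s h n) < inverse (real (Suc n))"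
    by metis
  have p3: "p (a - b) \<le> p (d - a) + p (d - b)" for a b d
    using p(3)[of "- (d - a)" "d - b"] p(2)[of "d - a"] by simp
  have p0: "0 \<le> p a" for a using p(3)[of a "- a"] p(1,2) by simp
  have ps: "(\<lambda>n. p (h - s h n)) \<longlonglongrightarrow> 0" if "h \<in> H" for h
    using s(2)[OF that] p0
    by (intro tendsto_sandwich[OF _ _ tendsto_const LIMSEQ_inverse_real_of_nat]) (auto intro!: always_eventually less_imp_le)
  have "convergent (\<lambda>n. v (s h n))" if h: "h \<in> H" for h
  proof (rule Cauchy_convergent, rule metric_CauchyI)
    fix e :: real assume e: "0 < e"
    have "(\<lambda>n. c * p (h - s h n)) \<longlonglongrightarrow> c * 0"
      by (intro tendsto_mult tendsto_const ps h)
    then have "\<forall>\<^sub>F n in sequentially. c * p (h - s h n) < e / 2"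
      using e by (intro order_tendstoD(2)) auto
    then obtain n0 where n0: "\<And>n. n \<ge> n0 \<Longrightarrow> c * p (h - s h n) < e / 2"
      by (auto simp: eventually_sequentially)
    have "dist (v (s h m)) (v (s h n)) < e" if "m \<ge> n0" "n \<ge> n0" for m n
    proof -
      have "dist (v (s h m)) (v (s h n)) \<le> c * p (s h m - s h n)"
        using lip s(1)[OF h] by (simp add: dist_norm)
      also have "\<dots> \<le> c * (p (h - s h m) + p (h - s h n))"
        using c p3 by (intro mult_left_mono) auto
      finally show ?thesis using n0[OF that(1)] n0[OF that(2)] by (simp add: distrib_left)
    qed
    then show "\<exists>M. \<forall>m\<ge>M. \<forall>n\<ge>M. dist (v (s h m)) (v (s h n)) < e" by blast
  qed
  then have "\<exists>w. \<forall>h\<in>H. (\<lambda>n. v (s h n)) \<longlonglongrightarrow> w h"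
    unfolding convergent_def by (intro bchoice ballI) auto
  then obtain w where w: "\<And>h. h \<in> H \<Longrightarrow> (\<lambda>n. v (s h n)) \<longlonglongrightarrow> w h" by blast
  have wv: "norm (w h - v t) \<le> c * p (h - t)" if h: "h \<in> H" and t: "t \<in> D" for h t
  proof (rule LIMSEQ_le)
    show "(\<lambda>n. norm (v (s h n) - v t)) \<longlonglongrightarrow> norm (w h - v t)"
      by (intro tendsto_intros w h)
    have "(\<lambda>n. c * (p (h - s h n) + p (h - t))) \<longlonglongrightarrow> c * (0 + p (h - t))"
      by (intro tendsto_mult tendsto_add tendsto_const ps h)
    then show "(\<lambda>n. c * (p (h - s h n) + p (h - t))) \<longlonglongrightarrow> c * p (h - t)" by simp
    have "norm (v (s h n) - v t) \<le> c * (p (h - s h n) + p (h - t))" for n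
      using lip[OF s(1)[OF h] t, of n] mult_left_mono[OF p3[of "s h n" t h] c] by linarith
    then show "\<exists>N. \<forall>n\<ge>N. norm (v (s h n) - v t) \<le> c * (p (h - s h n) + p (h - t))" by blast
  qed
  have ww: "norm (w h - w k) \<le> c * p (h - k)" if h: "h \<in> H" and k: "k \<in> H" for h k
  proof (rule LIMSEQ_le)
    show "(\<lambda>n. norm (w h - v (s k n))) \<longlonglongrightarrow> norm (w h - w k)"
      by (intro tendsto_intros w k)
    have "(\<lambda>n. c * (p (h - k) + p (k - s k n))) \<longlonglongrightarrow> c * (p (h - k) + 0)"
      by (intro tendsto_mult tendsto_add tendsto_const ps k)
    then show "(\<lambda>n. c * (p (h - k) + p (k - s k n))) \<longlonglongrightarrow> c * p (h - k)" by simp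
    have "norm (w h - v (s k n)) \<le> c * (p (h - k) + p (k - s k n))" for n
      using wv[OF h s(1)[OF k], of n] mult_left_mono[OF p(3)[of "h - k" "k - s k n"] c] by simp
    then show "\<exists>N. \<forall>n\<ge>N. norm (w h - v (s k n)) \<le> c * (p (h - k) + p (k - s k n))" by blast
  qed
  have mult: "w (h + k) = w h * w k" if h: "h \<in> H" and k: "k \<in> H" for h k
  proof (rule LIMSEQ_unique)
    show "(\<lambda>n. v (s h n) * v (s k n)) \<longlonglongrightarrow> w h * w k"
      by (intro tendsto_mult w h k)
    have hk: "h + k \<in> H" using is_subgroupD(4)[OF H h k] .
    have bound: "norm (w (h + k) - v (s h n) * v (s k n)) \<le> c * (p (h - s h n) + p (k - s k n))" for n
    proof -
      have "norm (w (h + k) - v (s h n) * v (s k n)) \<le> c * p ((h - s h n) + (k - s k n))"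
        using wv[OF hk is_subgroupD(4)[OF D s(1)[OF h] s(1)[OF k]], of n n] vm[OF s(1)[OF h] s(1)[OF k], of n n]
        by (simp add: algebra_simps)
      then show ?thesis using mult_left_mono[OF p(3)[of "h - s h n" "k - s k n"] c] by linarith
    qed
    have "(\<lambda>n. c * (p (h - s h n) + p (k - s k n))) \<longlonglongrightarrow> 0"
      using tendsto_mult[OF tendsto_const[of c] tendsto_add[OF ps[OF h] ps[OF k]]] by simp
    then have "(\<lambda>n. w (h + k) - v (s h n) * v (s k n)) \<longlonglongrightarrow> 0"
      by (rule Lim_null_comparison[OF always_eventually[OF allI[OF bound]]])
    from tendsto_diff[OF tendsto_const[of "w (h + k)"] this]
    show "(\<lambda>n. v (s h n) * v (s k n)) \<longlonglongrightarrow> w (h + k)" by simp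
  qed
  have "norm (w h) = 1" if h: "h \<in> H" for h
  proof (rule LIMSEQ_unique)
    show "(\<lambda>n. norm (v (s h n))) \<longlonglongrightarrow> norm (w h)" by (intro tendsto_norm w h)
    show "(\<lambda>n. norm (v (s h n))) \<longlonglongrightarrow> 1" using v1[OF s(1)[OF h]] by simp
  qed
  then show ?thesis using wv ww mult by blast
qed

primrec nmul :: "nat \<Rightarrow> 'a::ab_group_add \<Rightarrow> 'a" where
  "nmul 0 g = 0"
| "nmul (Suc n) g = g + nmul n g"

lemma nmul_add: "nmul (m + n) g = nmul m g + nmul n g"
  by (induction m) (auto simp: add.assoc)

lemma nmul_mult: "nmul (m * n) g = nmul m (nmul n g)"
  by (induction m) (auto simp: nmul_add)

lemma circle_root:
  fixes z :: complex
  assumes "norm z = 1" "0 < q"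
  shows "\<exists>r. norm r = 1 \<and> r ^ q = z"
proof (intro exI conjI)
  have "cis (Arg z / real q) ^ q = cis (real q * (Arg z / real q))" by (rule Complex.DeMoivre)
  also have "\<dots> = z" using rcis_cmod_Arg[of z] assms by (simp add: rcis_def)
  finally show "cis (Arg z / real q) ^ q = z" .
qed simp

lemma circle_inverse: "norm z = 1 \<Longrightarrow> z * cnj z = 1" for z :: complex
  by (simp add: complex_norm_square[symmetric])

lemma AE_hom_nmul:
  fixes u :: "'a::ab_group_add \<Rightarrow> 'b \<Rightarrow> complex"
  assumes u1: "\<And>g. AE y in N. norm (u g y) = 1"
    and um: "\<And>g h. AE y in N. u (g + h) y = u g y * u h y"
  shows "AE y in N. u (nmul n g) y = u g y ^ n"
proof (induction n)
  case 0
  show ?case using um[of 0 0] u1[of 0]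
    by eventually_elim auto
next
  case (Suc n)
  show ?case using Suc um[of g "nmul n g"] by eventually_elim auto
qed

text \<open>
  The graph of a homomorphism from a subgroup to circle-valued functions that represents \<open>u\<close>. The last clause makes
  the graph single-valued. Working with graphs turns the union of a chain of partial homomorphisms into a union of sets.
\<close>

definition partial_choice :: "'b measure \<Rightarrow> ('a::ab_group_add \<Rightarrow> 'b \<Rightarrow> complex) \<Rightarrow> ('a \<times> ('b \<Rightarrow> complex)) set \<Rightarrow> bool" where
  "partial_choice N u \<Gamma> \<longleftrightarrow>
    (\<forall>g a h b. (g, a) \<in> \<Gamma> \<longrightarrow> (h, b) \<in> \<Gamma> \<longrightarrow> (g - h, \<lambda>y. a y * cnj (b y)) \<in> \<Gamma>) \<and>
    (\<forall>g a. (g, a) \<in> \<Gamma> \<longrightarrow> (\<forall>y. norm (a y) = 1) \<and> (AE y in N. a y = u g y)) \<and>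
    (\<forall>a. (0, a) \<in> \<Gamma> \<longrightarrow> a = (\<lambda>_. 1))"

lemma partial_choiceD:
  assumes "partial_choice N u \<Gamma>"
  shows "(g, a) \<in> \<Gamma> \<Longrightarrow> (h, b) \<in> \<Gamma> \<Longrightarrow> (g - h, \<lambda>y. a y * cnj (b y)) \<in> \<Gamma>"
    and "(g, a) \<in> \<Gamma> \<Longrightarrow> norm (a y) = 1" and "(g, a) \<in> \<Gamma> \<Longrightarrow> AE y in N. a y = u g y"
    and "(0, a) \<in> \<Gamma> \<Longrightarrow> a = (\<lambda>_. 1)"
proof -
  note * = assms[unfolded partial_choice_def]
  show "(g, a) \<in> \<Gamma> \<Longrightarrow> (h, b) \<in> \<Gamma> \<Longrightarrow> (g - h, \<lambda>y. a y * cnj (b y)) \<in> \<Gamma>"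
    by (rule *[THEN conjunct1, rule_format])
  show "(g, a) \<in> \<Gamma> \<Longrightarrow> norm (a y) = 1"
    by (rule *[THEN conjunct2, THEN conjunct1, rule_format, THEN conjunct1, THEN spec])
  show "(g, a) \<in> \<Gamma> \<Longrightarrow> AE y in N. a y = u g y"
    by (rule *[THEN conjunct2, THEN conjunct1, rule_format, THEN conjunct2])
  show "(0, a) \<in> \<Gamma> \<Longrightarrow> a = (\<lambda>_. 1)"
    by (rule *[THEN conjunct2, THEN conjunct2, rule_format])
qed

lemma partial_choice_ops:
  assumes \<Gamma>: "partial_choice N u \<Gamma>" and g: "(g, a) \<in> \<Gamma>"
  shows "(0, \<lambda>_. 1) \<in> \<Gamma>" "(h, b) \<in> \<Gamma> \<Longrightarrow> (g + h, \<lambda>y. a y * b y) \<in> \<Gamma>" "(nmul n g, \<lambda>y. a y ^ n) \<in> \<Gamma>"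
    "(g, b) \<in> \<Gamma> \<Longrightarrow> b = a"
proof -
  note diff = partial_choiceD(1)[OF \<Gamma>] and norm = partial_choiceD(2)[OF \<Gamma>]
  show zero: "(0, \<lambda>_. 1) \<in> \<Gamma>"
    using diff[OF g g] circle_inverse norm[OF g] by simp
  have add: "(h + k, \<lambda>y. b y * c y) \<in> \<Gamma>" if "(h, b) \<in> \<Gamma>" "(k, c) \<in> \<Gamma>" for h b k c
    using diff[OF that(1) diff[OF zero that(2)]] by simp
  then show "(h, b) \<in> \<Gamma> \<Longrightarrow> (g + h, \<lambda>y. a y * b y) \<in> \<Gamma>" using g by blast
  show "(nmul n g, \<lambda>y. a y ^ n) \<in> \<Gamma>"
    by (induction n) (use zero add[OF g] in auto)
  assume b: "(g, b) \<in> \<Gamma>"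
  have "(\<lambda>y. b y * cnj (a y)) = (\<lambda>_. 1)"
    using diff[OF b g] partial_choiceD(4)[OF \<Gamma>] by simp
  then have 1: "b y * cnj (a y) = 1" for y by meson
  have "b y = a y" for y
  proof -
    have "b y = b y * (a y * cnj (a y))" using circle_inverse[OF norm[OF g]] by simp
    also have "\<dots> = (b y * cnj (a y)) * a y" by (simp add: mult_ac)
    finally show ?thesis using 1 by simp
  qed
  then show "b = a" by blast
qed

text \<open>
  The functions that are \<open>1\<close> almost everywhere form a divisible group, because roots can be taken pointwise. If
  \<open>q\<close> is the order of \<open>g\<close> modulo the domain, then any representative of \<open>u g\<close> has almost everywhere the prescribed
  \<open>q\<close>-th power; on the exceptional null set it is replaced by a root of the prescribed value.
\<close>

lemma partial_choice_extend:
  fixes u :: "'a::ab_group_add \<Rightarrow> 'b \<Rightarrow> complex"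
  assumes u1: "\<And>g. AE y in N. norm (u g y) = 1"
    and um: "\<And>g h. AE y in N. u (g + h) y = u g y * u h y"
    and \<Gamma>: "partial_choice N u \<Gamma>" and ne: "\<Gamma> \<noteq> {}"
  obtains \<Delta> z where "partial_choice N u \<Delta>" "\<Gamma> \<subseteq> \<Delta>" "(g, z) \<in> \<Delta>"
proof -
  note diff = partial_choiceD(1)[OF \<Gamma>] and norm = partial_choiceD(2)[OF \<Gamma>] and ae = partial_choiceD(3)[OF \<Gamma>]
    and one = partial_choiceD(4)[OF \<Gamma>] and ops = partial_choice_ops[OF \<Gamma>]
  have zero: "(0, \<lambda>_. 1) \<in> \<Gamma>" using ne ops(1) by fast
  define In where "In n \<longleftrightarrow> (\<exists>b. (nmul n g, b) \<in> \<Gamma>)" for n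
  \<comment> \<open>The order of \<open>g\<close> modulo the domain of \<open>\<Gamma>\<close>, with \<open>0\<close> standing for infinite order.\<close>
  define q where "q = (if \<exists>n>0. In n then (LEAST n. 0 < n \<and> In n) else 0)"
  have q_In: "In q"
  proof (cases "\<exists>n>0. In n")
    case True
    from LeastI_ex[OF this] show ?thesis using True unfolding q_def by simp
  next
    case False
    then have "q = 0" unfolding q_def by (rule if_not_P)
    then show ?thesis using zero by (auto simp: In_def)
  qed
  have q_dvd: "q dvd n" if "In n" for n
  proof (cases "\<exists>n>0. In n")
    case True
    from LeastI_ex[OF this] have q0: "0 < q" using True unfolding q_def by simp
    have least: "q \<le> m" if "0 < m" "In m" for m
      using that True Least_le[of "\<lambda>n. 0 < n \<and> In n" m] unfolding q_def by simp
    obtain b where b: "(nmul n g, b) \<in> \<Gamma>" using \<open>In n\<close> by (auto simp: In_def)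
    obtain c where c: "(nmul q g, c) \<in> \<Gamma>" using q_In by (auto simp: In_def)
    have "(nmul (n div q * q) g, \<lambda>y. c y ^ (n div q)) \<in> \<Gamma>"
      using ops(3)[OF c, of "n div q"] by (simp add: nmul_mult)
    from diff[OF b this] have "In (n mod q)"
      using nmul_add[of "n div q * q" "n mod q" g] by (auto simp: In_def)
    then have "n mod q = 0" using least[of "n mod q"] q0 by (metis gr0I mod_less_divisor not_le)
    then show ?thesis by auto
  next
    case False
    then have "n = 0" using that gr0I[of n] by metis
    then show ?thesis by simp
  qed
  obtain b where b: "(nmul q g, b) \<in> \<Gamma>" using q_In by (auto simp: In_def)
  have b1: "b = (\<lambda>_. 1)" if "q = 0" using one b that by simp
  have "\<forall>y. \<exists>r. norm r = 1 \<and> r ^ q = b y"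
  proof
    fix y
    show "\<exists>r. norm r = 1 \<and> r ^ q = b y"
      using circle_root[of "b y" q] norm[OF b] b1 by (cases "q = 0") (auto intro: exI[of _ 1])
  qed
  then obtain r where r: "\<And>y. norm (r y) = 1" "\<And>y. r y ^ q = b y" by metis
  define z where "z y = (if norm (u g y) = 1 \<and> u g y ^ q = b y then u g y else r y)" for y
  have z1: "norm (z y) = 1" and zq: "z y ^ q = b y" for y
    using r by (auto simp: z_def)
  have zae: "AE y in N. z y = u g y"
    using u1[of g] AE_hom_nmul[OF u1 um, of q g] ae[OF b] by eventually_elim (auto simp: z_def)
  define \<Delta> where "\<Delta> = {(d + nmul m g - nmul n g, \<lambda>y. a y * z y ^ m * cnj (z y) ^ n) | d a m n. (d, a) \<in> \<Gamma>}"
  have \<Delta>I: "(h, c) \<in> \<Delta>" if "(d, a) \<in> \<Gamma>" "h = d + nmul m g - nmul n g" "\<And>y. c y = a y * z y ^ m * cnj (z y) ^ n" for h c d a m n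
    unfolding \<Delta>_def using that by (intro CollectI exI[of _ d] exI[of _ a] exI[of _ m] exI[of _ n]) auto
  have \<Delta>E: thesis if "(h, c) \<in> \<Delta>" "\<And>d a m n. (d, a) \<in> \<Gamma> \<Longrightarrow> h = d + nmul m g - nmul n g \<Longrightarrow>
      c = (\<lambda>y. a y * z y ^ m * cnj (z y) ^ n) \<Longrightarrow> thesis" for h c thesis
    using that(1) unfolding \<Delta>_def by (auto intro: that(2))
  have "partial_choice N u \<Delta>"
    unfolding partial_choice_def
  proof (intro conjI allI impI)
    fix h c k e assume hc: "(h, c) \<in> \<Delta>" and ke: "(k, e) \<in> \<Delta>"
    obtain d a m n where *: "(d, a) \<in> \<Gamma>" "h = d + nmul m g - nmul n g" "c = (\<lambda>y. a y * z y ^ m * cnj (z y) ^ n)"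
      by (rule \<Delta>E[OF hc], rule that)
    obtain d' a' m' n' where **: "(d', a') \<in> \<Gamma>" "k = d' + nmul m' g - nmul n' g" "e = (\<lambda>y. a' y * z y ^ m' * cnj (z y) ^ n')"
      by (rule \<Delta>E[OF ke], rule that)
    show "(h - k, \<lambda>y. c y * cnj (e y)) \<in> \<Delta>"
      by (rule \<Delta>I[OF diff[OF *(1) **(1)], of _ "m + n'" "n + m'"])
        (simp_all add: *(2,3) **(2,3) nmul_add power_add algebra_simps)
  next
    fix h c y assume hc: "(h, c) \<in> \<Delta>"
    obtain d a m n where *: "(d, a) \<in> \<Gamma>" "h = d + nmul m g - nmul n g" "c = (\<lambda>y. a y * z y ^ m * cnj (z y) ^ n)"
      by (rule \<Delta>E[OF hc], rule that)
    show "norm (c y) = 1"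
      using norm[OF *(1)] z1 by (simp add: *(3) norm_mult norm_power)
  next
    fix h c assume hc: "(h, c) \<in> \<Delta>"
    obtain d a m n where *: "(d, a) \<in> \<Gamma>" "h = d + nmul m g - nmul n g" "c = (\<lambda>y. a y * z y ^ m * cnj (z y) ^ n)"
      by (rule \<Delta>E[OF hc], rule that)
    have h: "h + nmul n g = d + nmul m g" using *(2) by simp
    show "AE y in N. c y = u h y"
      using ae[OF *(1)] zae AE_hom_nmul[OF u1 um, of m g] AE_hom_nmul[OF u1 um, of n g]
        um[of d "nmul m g"] um[of h "nmul n g"]
    proof eventually_elim
      case (elim y)
      have "c y = (a y * z y ^ m) * cnj (z y) ^ n" by (simp add: *(3))
      also have "a y * z y ^ m = u h y * z y ^ n"
        using elim unfolding h by simp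
      also have "u h y * z y ^ n * cnj (z y) ^ n = u h y * (z y * cnj (z y)) ^ n"
        by (simp add: power_mult_distrib)
      finally show ?case using circle_inverse[OF z1] by simp
    qed
  next
    fix c assume hc: "(0, c) \<in> \<Delta>"
    obtain d a m n where *: "(d, a) \<in> \<Gamma>" "0 = d + nmul m g - nmul n g" "c = (\<lambda>y. a y * z y ^ m * cnj (z y) ^ n)"
      by (rule \<Delta>E[OF hc], rule that)
    have zz: "z y ^ k * cnj (z y) ^ k = 1" for y k
      using circle_inverse[OF z1[of y]] by (simp flip: power_mult_distrib)
    have multiple: "(nmul j g, \<lambda>y. z y ^ j) \<in> \<Gamma>" if "In j" for j
    proof -
      from q_dvd[OF that] obtain t where t: "j = t * q" by (auto simp: dvd_def mult.commute)
      show ?thesis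
        using ops(3)[OF b, of t] unfolding t nmul_mult by (simp add: zq[symmetric] power_mult mult.commute flip: power_mult)
    qed
    show "c = (\<lambda>_. 1)"
    proof (cases "n \<le> m")
      case True
      then obtain j where j: "m = n + j" using le_Suc_ex by blast
      have dd: "d + nmul j g = 0" using *(2) by (simp add: j nmul_add algebra_simps)
      then have d: "0 - d = nmul j g" using minus_unique[of d "nmul j g"] by simp
      have In: "In j" using diff[OF zero *(1)] unfolding d In_def by blast
      have "(\<lambda>y. a y * z y ^ j) = (\<lambda>_. 1)"
        by (rule one) (use ops(2)[OF *(1) multiple[OF In]] dd in simp)
      then have "a y * z y ^ j = 1" for y by meson
      moreover have "c y = (a y * z y ^ j) * (z y ^ n * cnj (z y) ^ n)" for y
        by (simp add: *(3) j power_add mult_ac)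
      ultimately show ?thesis using zz by auto
    next
      case False
      then obtain j where j: "n = m + j" using le_Suc_ex[of m n] by auto
      have d: "d = nmul j g" using *(2) by (simp add: j nmul_add algebra_simps)
      have "In j" using *(1) unfolding d In_def by blast
      from ops(4)[OF *(1)[unfolded d] multiple[OF this]] have "a y = z y ^ j" for y by (metis)
      then have "c y = (z y ^ j * cnj (z y) ^ j) * (z y ^ m * cnj (z y) ^ m)" for y
        by (simp add: *(3) j power_add mult_ac)
      then show ?thesis using zz by auto
    qed
  qed
  moreover have "\<Gamma> \<subseteq> \<Delta>"
  proof
    fix x assume "x \<in> \<Gamma>"
    then show "x \<in> \<Delta>" using \<Delta>I[of "fst x" "snd x" "fst x" 0 0 "snd x"] by simp
  qed
  moreover have "(g, z) \<in> \<Delta>"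
    by (rule \<Delta>I[OF zero, of _ 1 0]) auto
  ultimately show thesis by (rule that)
qed

text \<open>
  A maximal partial choice is total, because one that omits an element extends further.
\<close>

lemma circle_hom_choice:
  fixes u w :: "'a::ab_group_add \<Rightarrow> 'b \<Rightarrow> complex"
  assumes u1: "\<And>g. AE y in N. norm (u g y) = 1"
    and um: "\<And>g h. AE y in N. u (g + h) y = u g y * u h y"
    and H: "is_subgroup H" and w1: "\<And>h y. h \<in> H \<Longrightarrow> norm (w h y) = 1"
    and wm: "\<And>h k y. h \<in> H \<Longrightarrow> k \<in> H \<Longrightarrow> w (h + k) y = w h y * w k y"
    and wu: "\<And>h. h \<in> H \<Longrightarrow> AE y in N. w h y = u h y"
  obtains W where "\<And>g y. norm (W g y) = 1" "\<And>g h y. W (g + h) y = W g y * W h y"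
    "\<And>h. h \<in> H \<Longrightarrow> W h = w h" "\<And>g. AE y in N. W g y = u g y"
proof -
  define \<Gamma>0 where "\<Gamma>0 = (\<lambda>h. (h, w h)) ` H"
  have w0: "w 0 y = 1" for y
    using wm[OF is_subgroupD(1)[OF H] is_subgroupD(1)[OF H], of y] w1[OF is_subgroupD(1)[OF H], of y] by auto
  have \<Gamma>0: "partial_choice N u \<Gamma>0"
    unfolding partial_choice_def
  proof (intro conjI allI impI)
    fix g a h b assume "(g, a) \<in> \<Gamma>0" "(h, b) \<in> \<Gamma>0"
    then have *: "g \<in> H" "a = w g" "h \<in> H" "b = w h" by (auto simp: \<Gamma>0_def)
    have gh: "g - h \<in> H" using is_subgroupD(2)[OF H] * by blast
    have "w (g - h) y = a y * cnj (b y)" for y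
    proof -
      have "w (g - h) y = w (g - h) y * (w h y * cnj (w h y))"
        using circle_inverse[OF w1[OF *(3)]] by simp
      also have "\<dots> = w ((g - h) + h) y * cnj (w h y)"
        using wm[OF gh *(3)] by (simp add: mult.assoc)
      finally show ?thesis by (simp add: *)
    qed
    then have "w (g - h) = (\<lambda>y. a y * cnj (b y))" by blast
    then show "(g - h, \<lambda>y. a y * cnj (b y)) \<in> \<Gamma>0" using gh by (auto simp: \<Gamma>0_def)
  qed (use w0 w1 wu in \<open>auto simp: \<Gamma>0_def\<close>)
  have zero0: "(0, w 0) \<in> \<Gamma>0" using is_subgroupD(1)[OF H] by (auto simp: \<Gamma>0_def)
  let ?A = "{\<Gamma>. partial_choice N u \<Gamma> \<and> \<Gamma>0 \<subseteq> \<Gamma>}"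
  have "\<exists>\<Gamma>\<in>?A. \<forall>X\<in>?A. \<Gamma> \<subseteq> X \<longrightarrow> X = \<Gamma>"
  proof (rule subset_Zorn_nonempty)
    show "?A \<noteq> {}" using \<Gamma>0 by blast
    fix \<C> assume ne: "\<C> \<noteq> {}" and chain: "subset.chain ?A \<C>"
    have mem: "partial_choice N u \<Gamma>" "\<Gamma>0 \<subseteq> \<Gamma>" if "\<Gamma> \<in> \<C>" for \<Gamma>
      using chain that unfolding subset_chain_def by blast+
    have "partial_choice N u (\<Union>\<C>)"
      unfolding partial_choice_def
    proof (intro conjI allI impI)
      fix g a h b assume "(g, a) \<in> \<Union>\<C>" "(h, b) \<in> \<Union>\<C>"
      then obtain X Y where XY: "X \<in> \<C>" "(g, a) \<in> X" "Y \<in> \<C>" "(h, b) \<in> Y" by blast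
      then have "X \<subseteq> Y \<or> Y \<subseteq> X" using chain unfolding subset_chain_def by blast
      then have "(g - h, \<lambda>y. a y * cnj (b y)) \<in> X \<or> (g - h, \<lambda>y. a y * cnj (b y)) \<in> Y"
        using XY partial_choiceD(1)[OF mem(1)] by (metis subsetD)
      then show "(g - h, \<lambda>y. a y * cnj (b y)) \<in> \<Union>\<C>" using XY by blast
    next
      fix g a y assume "(g, a) \<in> \<Union>\<C>"
      then show "norm (a y) = 1" using partial_choiceD(2)[OF mem(1)] by blast
    next
      fix g a assume "(g, a) \<in> \<Union>\<C>"
      then show "AE y in N. a y = u g y" using partial_choiceD(3)[OF mem(1)] by blast
    next
      fix a assume "(0, a) \<in> \<Union>\<C>"
      then show "a = (\<lambda>_. 1)" using partial_choiceD(4)[OF mem(1)] by blast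
    qed
    then show "\<Union>\<C> \<in> ?A" using ne mem(2) by blast
  qed
  then obtain \<Gamma> where \<Gamma>A: "\<Gamma> \<in> ?A" and maxA: "\<forall>X\<in>?A. \<Gamma> \<subseteq> X \<longrightarrow> X = \<Gamma>"
    by (elim bexE)
  have \<Gamma>: "partial_choice N u \<Gamma>" "\<Gamma>0 \<subseteq> \<Gamma>" using \<Gamma>A by simp_all
  have max: "X = \<Gamma>" if "partial_choice N u X" "\<Gamma> \<subseteq> X" for X
    using maxA that \<Gamma>(2) by simp
  note ops = partial_choice_ops[OF \<Gamma>(1)]
  have "\<exists>a. (g, a) \<in> \<Gamma>" for g
  proof -
    have "\<Gamma> \<noteq> {}" using zero0 \<Gamma>(2) by fast
    obtain \<Delta> z where \<Delta>: "partial_choice N u \<Delta>" "\<Gamma> \<subseteq> \<Delta>" "(g, z) \<in> \<Delta>"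
      by (rule partial_choice_extend[OF u1 um \<Gamma>(1) \<open>\<Gamma> \<noteq> {}\<close>, of g], rule that)
    then show ?thesis using max[OF \<Delta>(1,2)] by blast
  qed
  then obtain W where W: "\<And>g. (g, W g) \<in> \<Gamma>" by metis
  show thesis
  proof (rule that[of W])
    show "norm (W g y) = 1" for g y by (rule partial_choiceD(2)[OF \<Gamma>(1) W])
    show "AE y in N. W g y = u g y" for g by (rule partial_choiceD(3)[OF \<Gamma>(1) W])
    show "W h = w h" if "h \<in> H" for h
      using that ops(4)[OF W[of h], of "w h"] \<Gamma>(2) by (auto simp: \<Gamma>0_def)
    show "W (g + h) y = W g y * W h y" for g h y
      using ops(4)[OF ops(2)[OF W[of g] W[of h]] W[of "g + h"]] by simp
  qed
qed

text \<open>
  Among the countable subfamilies, one has a union of largest measure with respect to an equivalent finite measure.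
  No member of the family can add a set of positive measure to this union.
\<close>

lemma (in sigma_finite_measure) essential_countable_cover:
  assumes S: "\<And>i. i \<in> I \<Longrightarrow> S i \<in> sets M" and ne: "i0 \<in> I"
  obtains e :: "nat \<Rightarrow> 'i" where "\<And>n. e n \<in> I" "\<And>i. i \<in> I \<Longrightarrow> AE y in M. y \<in> S i \<longrightarrow> (\<exists>n. y \<in> S (e n))"
proof -
  obtain f :: "'a \<Rightarrow> real" where f: "f \<in> borel_measurable M" "\<And>x. f x > 0" "\<And>x. f x \<le> 1" "integrable M f"
    by (rule obtain_positive_integrable_function, rule that)
  define N where "N = density M (\<lambda>x. ennreal (f x))"
  have [simp]: "sets N = sets M" "space N = space M" by (auto simp: N_def)
  interpret N: finite_measure N
  proof
    have "emeasure N (space N) = (\<integral>\<^sup>+x. ennreal (f x) \<partial>M)"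
      unfolding N_def using f by (simp add: emeasure_density cong: nn_integral_cong)
    also have "\<dots> = ennreal (\<integral>x. f x \<partial>M)"
      using f by (intro nn_integral_eq_integral) (auto intro: less_imp_le)
    finally show "emeasure N (space N) \<noteq> \<infinity>" by simp
  qed
  define m where "m J = measure N (\<Union>i\<in>J. S i)" for J
  define \<J> where "\<J> = {J. countable J \<and> J \<subseteq> I}"
  have meas: "(\<Union>i\<in>J. S i) \<in> sets M" if "J \<in> \<J>" for J
    using that S by (intro sets.countable_UN'') (auto simp: \<J>_def)
  have bdd: "bdd_above (m ` \<J>)"
    using N.bounded_measure by (intro bdd_aboveI[of _ "measure N (space M)"]) (auto simp: m_def)
  define s where "s = (SUP J\<in>\<J>. m J)"
  have "{} \<in> \<J>" by (simp add: \<J>_def)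
  have "\<exists>J\<in>\<J>. s - inverse (real (Suc k)) < m J" for k
    unfolding s_def using \<open>{} \<in> \<J>\<close> by (intro less_cSUP_iff[THEN iffD1, OF _ bdd]) (auto simp: s_def[symmetric])
  then obtain J where J: "\<And>k. J k \<in> \<J>" "\<And>k. s - inverse (real (Suc k)) < m (J k)" by metis
  define K where "K = insert i0 (\<Union>k. J k)"
  have K: "K \<in> \<J>" using J(1) ne by (auto simp: K_def \<J>_def)
  have "s \<le> m K"
  proof (rule field_le_epsilon)
    fix e :: real assume "0 < e"
    then obtain k where k: "inverse (real (Suc k)) < e" using reals_Archimedean by blast
    have "m (J k) \<le> m K"
      unfolding m_def using meas[OF K] by (intro N.finite_measure_mono) (auto simp: K_def)
    then show "s \<le> m K + e" using J(2)[of k] k by simp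
  qed
  have cover: "AE y in M. y \<in> S i \<longrightarrow> (\<exists>k\<in>K. y \<in> S k)" if i: "i \<in> I" for i
  proof -
    have iK: "insert i K \<in> \<J>" using K i by (auto simp: \<J>_def)
    then have "m (insert i K) \<le> s" unfolding s_def by (rule cSUP_upper[OF _ bdd])
    then have "m (insert i K) \<le> m K" using \<open>s \<le> m K\<close> by simp
    moreover have "measure N ((\<Union>k\<in>insert i K. S k) - (\<Union>k\<in>K. S k)) = m (insert i K) - m K"
      unfolding m_def using meas[OF K] meas[OF iK] by (intro N.finite_measure_Diff) auto
    ultimately have "measure N ((\<Union>k\<in>insert i K. S k) - (\<Union>k\<in>K. S k)) = 0"
      using measure_nonneg[of N "(\<Union>k\<in>insert i K. S k) - (\<Union>k\<in>K. S k)"] by linarith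
    then have "(\<Union>k\<in>insert i K. S k) - (\<Union>k\<in>K. S k) \<in> null_sets N"
      using meas[OF K] meas[OF iK] by (intro null_setsI) (auto simp: N.emeasure_eq_measure)
    then have "AE y in N. y \<notin> (\<Union>k\<in>insert i K. S k) - (\<Union>k\<in>K. S k)"
      by (rule AE_not_in)
    then have "AE y in M. y \<notin> (\<Union>k\<in>insert i K. S k) - (\<Union>k\<in>K. S k)"
      unfolding N_def using f by (subst (asm) AE_density) auto
    then show ?thesis by eventually_elim auto
  qed
  show thesis
  proof (rule that[of "from_nat_into K"])
    have K': "countable K" "K \<noteq> {}" "K \<subseteq> I" using K by (auto simp: \<J>_def K_def)
    show "from_nat_into K n \<in> I" for n using from_nat_into[OF K'(2)] K'(3) by blast
    fix i assume "i \<in> I"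
    from cover[OF this] show "AE y in M. y \<in> S i \<longrightarrow> (\<exists>n. y \<in> S (from_nat_into K n))"
      by eventually_elim (use from_nat_into_surj[OF K'(1)] in metis)
  qed
qed

section \<open>Homomorphisms into the bounded functions of a sigma-finite space\<close>

text \<open>
  The target is an arbitrary sigma-finite space, so that the results apply to the measure on one coset in the dual group.
  The exceptional null set of each law depends on the functions in it.
\<close>

locale conv_homomorphism = haar M + N: sigma_finite_measure N
  for M :: "'a::{topological_ab_group_add, t2_space} measure" and N :: "'b measure" +
  fixes T :: "('a \<Rightarrow> complex) \<Rightarrow> 'b \<Rightarrow> complex" and C :: real
  assumes T_measurable: "integrable M f \<Longrightarrow> T f \<in> borel_measurable N"
    and T_bound: "integrable M f \<Longrightarrow> AE y in N. norm (T f y) \<le> C * L1_norm M f"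
    and C_nonneg: "0 \<le> C"
    and T_add: "integrable M f \<Longrightarrow> integrable M g \<Longrightarrow> AE y in N. T (\<lambda>x. f x + g x) y = T f y + T g y"
    and T_scale: "integrable M f \<Longrightarrow> AE y in N. T (\<lambda>x. c * f x) y = c * T f y"
    and T_conv: "integrable M f \<Longrightarrow> integrable M g \<Longrightarrow> AE y in N. T (fourier_conv M f g) y = T f y * T g y"
begin

lemma T_diff:
  assumes f: "integrable M f" and g: "integrable M g"
  shows "AE y in N. T (\<lambda>x. f x - g x) y = T f y - T g y"
proof -
  have g': "integrable M (\<lambda>x. - 1 * g x)" using g by simp
  show ?thesis
    using T_add[OF f g'] T_scale[OF g, of "- 1"] by eventually_elim simp
qed

lemma T_lipschitz:
  assumes f: "integrable M f" and g: "integrable M g"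
  shows "AE y in N. norm (T f y - T g y) \<le> C * L1_norm M (\<lambda>x. f x - g x)"
proof -
  have "integrable M (\<lambda>x. f x - g x)" using f g by simp
  from T_bound[OF this] T_diff[OF f g] show ?thesis by eventually_elim simp
qed

lemma T_sum:
  assumes "finite I" "\<And>i. i \<in> I \<Longrightarrow> integrable M (f i)"
  shows "AE y in N. T (\<lambda>x. \<Sum>i\<in>I. c i * f i x) y = (\<Sum>i\<in>I. c i * T (f i) y)"
  using assms
proof (induction I)
  case empty
  have "integrable M (\<lambda>_. 0)" by simp
  from T_scale[OF this, of 0] show ?case by eventually_elim simp
next
  case (insert i I)
  have 1: "integrable M (\<lambda>x. c i * f i x)" "integrable M (\<lambda>x. \<Sum>i\<in>I. c i * f i x)"
    using insert.prems by simp_all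
  have 2: "integrable M (f i)" using insert.prems by simp
  have "AE y in N. T (\<lambda>x. \<Sum>i\<in>I. c i * f i x) y = (\<Sum>i\<in>I. c i * T (f i) y)"
    using insert by simp
  with T_add[OF 1] T_scale[OF 2, of "c i"] show ?case
    unfolding sum.insert[OF insert.hyps] by eventually_elim simp
qed

text \<open>
  The convolution of two translates depends only on the sum of the translations.
\<close>

lemma T_shift_mult:
  assumes f: "integrable M f" and g: "integrable M g"
  shows "AE y in N. T (shift a f) y * T (shift b g) y = T (shift (a + b) f) y * T g y"
  using T_conv[OF shift_L1(1)[OF f] shift_L1(1)[OF g], of a b] T_conv[OF shift_L1(1)[OF f] g, of "a + b"]
  unfolding fourier_conv_shift(2)[OF f g] by eventually_elim simp

definition modulus :: "('a \<Rightarrow> complex) \<Rightarrow> 'a \<Rightarrow> real" where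
  "modulus f h = L1_norm M (\<lambda>x. shift h f x - f x)"

lemma modulus_diff:
  assumes "integrable M f"
  shows "L1_norm M (\<lambda>x. shift s f x - shift t f x) = modulus f (s - t)"
  using shift_L1_diff[of "shift (s - t) f" f t] assms shift_L1(1)[OF assms]
  by (simp add: modulus_def shift_shift)

lemma modulus_props:
  assumes f: "integrable M f"
  shows "modulus f 0 = 0" "modulus f (- h) = modulus f h" "modulus f (h + k) \<le> modulus f h + modulus f k"
proof -
  show "modulus f 0 = 0" by (simp add: modulus_def L1_norm_def)
  show "modulus f (- h) = modulus f h"
    using modulus_diff[OF f, of 0 h] L1_norm_minus_commute[of M f "shift h f"] by (simp add: modulus_def)
  have "modulus f (h + k) \<le> L1_norm M (\<lambda>x. shift (h + k) f x - shift k f x) + modulus f k"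
    unfolding modulus_def using L1_norm_triangle_minus[of M "shift (h + k) f" "shift k f" f] f shift_L1(1)[OF f] by simp
  then show "modulus f (h + k) \<le> modulus f h + modulus f k"
    using modulus_diff[OF f, of "h + k" k] by simp
qed

text \<open>
  A compact set is covered, for each \<open>n\<close> and each radius, by finitely many balls of the seminorm \<open>modulus (e n)\<close>,
  since translation is continuous in mean. The centres generate a countable subgroup.
\<close>

lemma countable_modulus_dense_subgroup:
  fixes e :: "nat \<Rightarrow> 'a \<Rightarrow> complex" and K :: "nat \<Rightarrow> 'a set"
  assumes e: "\<And>n. integrable M (e n)" and H: "is_subgroup H" "H = (\<Union>m. K m)" "\<And>m. compact (K m)"
  obtains D where "is_subgroup D" "countable D" "D \<subseteq> H" "\<And>n h \<epsilon>. h \<in> H \<Longrightarrow> 0 < \<epsilon> \<Longrightarrow> \<exists>s\<in>D. modulus (e n) (h - s) < \<epsilon>"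
proof -
  have "\<exists>F. finite F \<and> F \<subseteq> K m \<and> (\<forall>h\<in>K m. \<exists>s\<in>F. modulus (e n) (h - s) < inverse (real (Suc k)))" for m n k
  proof -
    have pos: "0 < inverse (real (Suc k))" by simp
    obtain U where U: "open U" "0 \<in> U" "\<And>u. u \<in> U \<Longrightarrow> L1_norm M (\<lambda>x. shift u (e n) x - e n x) < inverse (real (Suc k))"
      using translation_continuous[OF e pos] by metis
    obtain F where F: "F \<subseteq> K m" "finite F" "K m \<subseteq> (\<Union>x\<in>F. (+) x ` U)"
      by (rule compactE_image[OF H(3), of "K m" "\<lambda>x. (+) x ` U"]) (use U in \<open>force intro: open_translate\<close>)+
    show ?thesis
      by (intro exI[of _ F] conjI ballI F) (use F(3) U(3) in \<open>force simp: modulus_def\<close>)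
  qed
  then obtain F where F: "\<And>m n k. finite (F m n k)" "\<And>m n k. F m n k \<subseteq> K m"
    "\<And>m n k h. h \<in> K m \<Longrightarrow> \<exists>s\<in>F m n k. modulus (e n) (h - s) < inverse (real (Suc k))"
    by metis
  obtain D where D: "is_subgroup D" "countable D" "(\<Union>m n k. F m n k) \<subseteq> D" "D \<subseteq> H"
  proof (rule countable_subgroup_generated[OF H(1), of "\<Union>m n k. F m n k"])
    show "countable (\<Union>m n k. F m n k)" using F(1) by (intro countable_UN) (auto intro: countable_finite)
    show "(\<Union>m n k. F m n k) \<subseteq> H" using F(2) H(2) by blast
  qed (rule that)
  show thesis
  proof (rule that[OF D(1,2,4)])
    fix n h and \<epsilon> :: real assume "h \<in> H" "0 < \<epsilon>"
    then obtain m k where m: "h \<in> K m" and k: "inverse (real (Suc k)) < \<epsilon>"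
      using H(2) reals_Archimedean by blast
    obtain s where "s \<in> F m n k" "modulus (e n) (h - s) < inverse (real (Suc k))"
      using F(3)[OF m] by blast
    moreover have "s \<in> D" if "s \<in> F m n k" for s using D(3) that by blast
    ultimately show "\<exists>s\<in>D. modulus (e n) (h - s) < \<epsilon>"
      using k by (intro bexI[of _ s]) auto
  qed
qed

text \<open>
  The conditions at \<open>y\<close> under which the ratio \<open>T (shift s f) y / T f y\<close>, as a function of \<open>s \<in> D\<close>, is a bounded
  homomorphism with \<open>modulus f\<close> as modulus of continuity. For countable \<open>D\<close> they hold almost everywhere.
\<close>

definition regular_at :: "'a set \<Rightarrow> ('a \<Rightarrow> complex) \<Rightarrow> 'b \<Rightarrow> bool" where
  "regular_at D f y \<longleftrightarrow> (\<forall>s\<in>D. \<forall>t\<in>D.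
     T (shift s f) y * T (shift t f) y = T (shift (s + t) f) y * T f y \<and>
     norm (T (shift s f) y) \<le> C * L1_norm M f \<and>
     norm (T (shift s f) y - T (shift t f) y) \<le> C * modulus f (s - t))"

lemma AE_regular_at:
  assumes f: "integrable M f" and D: "countable D"
  shows "AE y in N. regular_at D f y"
  unfolding regular_at_def
proof (intro AE_ball_countable' D)
  fix s t
  show "AE y in N. T (shift s f) y * T (shift t f) y = T (shift (s + t) f) y * T f y \<and>
     norm (T (shift s f) y) \<le> C * L1_norm M f \<and>
     norm (T (shift s f) y - T (shift t f) y) \<le> C * modulus f (s - t)"
    using T_shift_mult[OF f f, of s t] T_bound[OF shift_L1(1)[OF f], of s]
      T_lipschitz[OF shift_L1(1)[OF f] shift_L1(1)[OF f], of s t]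
    unfolding shift_L1(2)[OF f] modulus_diff[OF f]
    by eventually_elim blast
qed

lemma regular_at_ratio:
  assumes y: "regular_at D f y" and nz: "T f y \<noteq> 0" and D: "is_subgroup D"
  shows "\<And>s. s \<in> D \<Longrightarrow> norm (T (shift s f) y / T f y) = 1"
    and "\<And>s t. s \<in> D \<Longrightarrow> t \<in> D \<Longrightarrow> T (shift (s + t) f) y / T f y = (T (shift s f) y / T f y) * (T (shift t f) y / T f y)"
    and "\<And>s t. s \<in> D \<Longrightarrow> t \<in> D \<Longrightarrow>
      norm (T (shift s f) y / T f y - T (shift t f) y / T f y) \<le> (C / norm (T f y)) * modulus f (s - t)"
proof -
  note r = y[unfolded regular_at_def, rule_format]
  show mult: "T (shift (s + t) f) y / T f y = (T (shift s f) y / T f y) * (T (shift t f) y / T f y)" if "s \<in> D" "t \<in> D" for s t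
    using r[OF that] nz by (simp add: field_simps)
  show "norm (T (shift s f) y / T f y) = 1" if "s \<in> D" for s
  proof (rule norm_eq_1_of_bounded_hom[OF D _ _ _ that, of "\<lambda>s. T (shift s f) y / T f y" "C * L1_norm M f / norm (T f y)"])
    show "norm (T (shift s f) y / T f y) \<le> C * L1_norm M f / norm (T f y)" if "s \<in> D" for s
      using r[OF that that] by (simp add: norm_divide divide_right_mono)
  qed (use mult nz in auto)
  show "norm (T (shift s f) y / T f y - T (shift t f) y / T f y) \<le> (C / norm (T f y)) * modulus f (s - t)" if "s \<in> D" "t \<in> D" for s t
  proof -
    have "norm (T (shift s f) y / T f y - T (shift t f) y / T f y) = norm (T (shift s f) y - T (shift t f) y) / norm (T f y)"
      by (simp add: norm_divide flip: diff_divide_distrib)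
    also have "\<dots> \<le> (C * modulus f (s - t)) / norm (T f y)"
      using r[OF that] by (intro divide_right_mono) auto
    finally show ?thesis by simp
  qed
qed

text \<open>
  Here \<open>\<kappa>\<close> selects for each point one of the functions \<open>e n\<close>, and \<open>Z\<close> consists of the points where all \<open>e n\<close> are
  regular for a countable dense subgroup of \<open>H\<close> and the selected one has nonzero image. On \<open>Z\<close> the
  ratios extend from that subgroup to \<open>H\<close> by density, which keeps the bound by the modulus of translation and will make
  \<open>W\<close> continuous. Outside \<open>Z\<close> the value \<open>1\<close> is used. The extension from \<open>H\<close> to the whole group is a choice of
  representatives; it preserves continuity because \<open>H\<close> is open.
\<close>

lemma exists_pointwise_characters:
  fixes e :: "nat \<Rightarrow> 'a \<Rightarrow> complex" and \<kappa> :: "'b \<Rightarrow> nat"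
  assumes e: "\<And>n. integrable M (e n)"
  obtains H W Z where "open H" "is_subgroup H" "\<And>g y. norm (W g y) = 1" "\<And>g h y. W (g + h) y = W g y * W h y"
    "\<And>y. y \<in> Z \<Longrightarrow> T (e (\<kappa> y)) y \<noteq> 0" "AE y in N. T (e (\<kappa> y)) y \<noteq> 0 \<longrightarrow> y \<in> Z"
    "\<And>h y. y \<in> Z \<Longrightarrow> h \<in> H \<Longrightarrow> norm (W h y - 1) * norm (T (e (\<kappa> y)) y) \<le> C * modulus (e (\<kappa> y)) h"
    "\<And>g. AE y in N. y \<in> Z \<longrightarrow> W g y * T (e (\<kappa> y)) y = T (shift g (e (\<kappa> y))) y"
proof -
  obtain U0 C0 where U0: "open U0" "(0::'a) \<in> U0" "U0 \<subseteq> C0" "compact C0"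
    using locally_compact by blast
  obtain H and K :: "nat \<Rightarrow> 'a set" where H: "is_subgroup H" "open H" "\<And>n. compact (K n)" "H = (\<Union>n. K n)"
    by (rule sigma_compact_open_subgroup[OF U0], rule that)
  obtain D where D: "is_subgroup D" "countable D" "D \<subseteq> H" "\<And>n h \<epsilon>. h \<in> H \<Longrightarrow> 0 < \<epsilon> \<Longrightarrow> \<exists>s\<in>D. modulus (e n) (h - s) < \<epsilon>"
    by (rule countable_modulus_dense_subgroup[OF e H(1,4,3)], rule that)
  define Z where "Z = {y. T (e (\<kappa> y)) y \<noteq> 0 \<and> (\<forall>n. regular_at D (e n) y)}"
  define v where "v s y = T (shift s (e (\<kappa> y))) y / T (e (\<kappa> y)) y" for s y
  define c where "c y = C / norm (T (e (\<kappa> y)) y)" for y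
  have c: "0 \<le> c y" for y using C_nonneg by (simp add: c_def)
  have AE_Z: "AE y in N. T (e (\<kappa> y)) y \<noteq> 0 \<longrightarrow> y \<in> Z"
  proof -
    have "AE y in N. \<forall>n. regular_at D (e n) y"
      using AE_regular_at[OF e D(2)] by (simp add: AE_all_countable)
    then show ?thesis by eventually_elim (simp add: Z_def)
  qed
  have "\<exists>w. (\<forall>h\<in>H. norm (w h) = 1) \<and> (\<forall>h\<in>H. \<forall>k\<in>H. w (h + k) = w h * w k) \<and>
      (y \<in> Z \<longrightarrow> (\<forall>h\<in>H. \<forall>s\<in>D. norm (w h - v s y) \<le> c y * modulus (e (\<kappa> y)) (h - s)) \<and>
        (\<forall>h\<in>H. \<forall>k\<in>H. norm (w h - w k) \<le> c y * modulus (e (\<kappa> y)) (h - k)))" for y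
  proof (cases "y \<in> Z")
    case True
    then have y: "regular_at D (e (\<kappa> y)) y" "T (e (\<kappa> y)) y \<noteq> 0" by (auto simp: Z_def)
    note ratio = regular_at_ratio[OF y D(1), folded v_def c_def]
    note props = modulus_props[OF e]
    have "\<exists>w. (\<forall>h\<in>H. norm (w h) = 1) \<and> (\<forall>h\<in>H. \<forall>k\<in>H. w (h + k) = w h * w k) \<and>
        (\<forall>h\<in>H. \<forall>s\<in>D. norm (w h - v s y) \<le> c y * modulus (e (\<kappa> y)) (h - s)) \<and>
        (\<forall>h\<in>H. \<forall>k\<in>H. norm (w h - w k) \<le> c y * modulus (e (\<kappa> y)) (h - k))"
      by (rule circle_hom_extends_from_dense_subgroup[OF D(1) ratio(1,2,3) c props D(4) H(1)])
    then show ?thesis by blast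
  next
    case False
    then show ?thesis by (intro exI[of _ "\<lambda>_. 1"]) simp
  qed
  then obtain w' where w': "\<And>y. (\<forall>h\<in>H. norm (w' y h) = 1) \<and> (\<forall>h\<in>H. \<forall>k\<in>H. w' y (h + k) = w' y h * w' y k) \<and>
      (y \<in> Z \<longrightarrow> (\<forall>h\<in>H. \<forall>s\<in>D. norm (w' y h - v s y) \<le> c y * modulus (e (\<kappa> y)) (h - s)) \<and>
        (\<forall>h\<in>H. \<forall>k\<in>H. norm (w' y h - w' y k) \<le> c y * modulus (e (\<kappa> y)) (h - k)))"
    by metis
  define w where "w h y = (if y \<in> Z then w' y h else 1)" for h y
  have w1: "norm (w h y) = 1" if "h \<in> H" for h y using w' that by (simp add: w_def)
  have wm: "w (h + k) y = w h y * w k y" if "h \<in> H" "k \<in> H" for h k y using w' that by (simp add: w_def)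
  have wv: "norm (w h y - v s y) \<le> c y * modulus (e (\<kappa> y)) (h - s)" if "y \<in> Z" "h \<in> H" "s \<in> D" for h s y
    using w' that by (simp add: w_def)
  have ww: "norm (w h y - w k y) \<le> c y * modulus (e (\<kappa> y)) (h - k)" if "y \<in> Z" "h \<in> H" "k \<in> H" for h k y
    using w' that by (simp add: w_def)
  define u where "u g y = (if y \<in> Z then v g y else 1)" for g y
  have u1: "AE y in N. norm (u g y) = 1" for g
  proof -
    obtain G where G: "is_subgroup G" "countable G" "{g} \<subseteq> G" "G \<subseteq> UNIV"
      by (rule countable_subgroup_generated[OF is_subgroup_UNIV, of "{g}"]) (auto intro: that)
    have "AE y in N. \<forall>n. regular_at G (e n) y"
      using AE_regular_at[OF e G(2)] by (simp add: AE_all_countable)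
    then show ?thesis
    proof eventually_elim
      case (elim y)
      then show ?case
        using regular_at_ratio(1)[OF elim[rule_format] _ G(1), of "\<kappa> y" g] G(3) by (auto simp: u_def v_def Z_def)
    qed
  qed
  have um: "AE y in N. u (g + h) y = u g y * u h y" for g h
  proof -
    have "AE y in N. \<forall>n. T (shift g (e n)) y * T (shift h (e n)) y = T (shift (g + h) (e n)) y * T (e n) y"
      using T_shift_mult[OF e e] by (simp add: AE_all_countable)
    then show ?thesis
    proof eventually_elim
      case (elim y)
      from elim[rule_format, of "\<kappa> y"] show ?case by (auto simp: u_def v_def Z_def field_simps)
    qed
  qed
  have wu: "AE y in N. w h y = u h y" if h: "h \<in> H" for h
  proof -
    have "AE y in N. \<forall>n. \<forall>s\<in>D. norm (T (shift h (e n)) y - T (shift s (e n)) y) \<le> C * modulus (e n) (h - s)"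
      unfolding AE_all_countable
    proof (intro allI AE_ball_countable' D)
      show "AE y in N. norm (T (shift h (e n)) y - T (shift s (e n)) y) \<le> C * modulus (e n) (h - s)" for n s
        using T_lipschitz[OF shift_L1(1)[OF e] shift_L1(1)[OF e], of h n s n] unfolding modulus_diff[OF e] .
    qed
    then show ?thesis
    proof eventually_elim
      case (elim y)
      show "w h y = u h y"
      proof (cases "y \<in> Z")
        case True
        then have nz: "T (e (\<kappa> y)) y \<noteq> 0" by (simp add: Z_def)
        have le: "norm (w h y - v h y) \<le> 2 * c y * modulus (e (\<kappa> y)) (h - s)" if s: "s \<in> D" for s
        proof -
          have "norm (v h y - v s y) = norm (T (shift h (e (\<kappa> y))) y - T (shift s (e (\<kappa> y))) y) / norm (T (e (\<kappa> y)) y)"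
            by (simp add: v_def norm_divide flip: diff_divide_distrib)
          also have "\<dots> \<le> (C * modulus (e (\<kappa> y)) (h - s)) / norm (T (e (\<kappa> y)) y)"
            using elim s by (intro divide_right_mono) auto
          finally have "norm (v h y - v s y) \<le> c y * modulus (e (\<kappa> y)) (h - s)" by (simp add: c_def)
          then show ?thesis
            using wv[OF True h s] norm_triangle_ineq4[of "w h y - v s y" "v h y - v s y"] by simp
        qed
        have "norm (w h y - v h y) \<le> 0"
        proof (rule field_le_epsilon)
          fix \<epsilon> :: real assume \<epsilon>: "0 < \<epsilon>"
          obtain d where d: "0 < d" "2 * c y * d \<le> \<epsilon>"
            using small_factor[of "2 * c y" \<epsilon>] c[of y] \<epsilon> by auto
          obtain s where s: "s \<in> D" "modulus (e (\<kappa> y)) (h - s) < d"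
            using D(4)[OF h d(1)] by blast
          have "2 * c y * modulus (e (\<kappa> y)) (h - s) \<le> 2 * c y * d"
            using s(2) c[of y] by (intro mult_left_mono) auto
          then show "norm (w h y - v h y) \<le> 0 + \<epsilon>" using le[OF s(1)] d(2) by simp
        qed
        then show ?thesis using True by (simp add: u_def)
      qed (simp add: w_def u_def)
    qed
  qed
  obtain W where W: "\<And>g y. norm (W g y) = 1" "\<And>g h y. W (g + h) y = W g y * W h y"
      "\<And>h. h \<in> H \<Longrightarrow> W h = w h" "\<And>g. AE y in N. W g y = u g y"
  proof (rule circle_hom_choice[where N = N and u = u and H = H and w = w])
    show "AE y in N. norm (u g y) = 1" "AE y in N. u (g + h) y = u g y * u h y" for g h by (fact u1 um)+
    show "h \<in> H \<Longrightarrow> norm (w h y) = 1" "h \<in> H \<Longrightarrow> k \<in> H \<Longrightarrow> w (h + k) y = w h y * w k y"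
      "h \<in> H \<Longrightarrow> AE y in N. w h y = u h y" for h k y by (fact w1 wm wu)+
  qed (rule H(1), rule that)
  show thesis
  proof (rule that[OF H(2,1) W(1,2) _ AE_Z])
    show nz: "T (e (\<kappa> y)) y \<noteq> 0" if "y \<in> Z" for y using that by (simp add: Z_def)
    show "norm (W h y - 1) * norm (T (e (\<kappa> y)) y) \<le> C * modulus (e (\<kappa> y)) h" if y: "y \<in> Z" and h: "h \<in> H" for h y
    proof -
      have W0: "W 0 y = 1" using W(2)[of 0 0 y] W(1)[of 0 y] by auto
      have "norm (W h y - 1) \<le> c y * modulus (e (\<kappa> y)) h"
        using ww[OF y h is_subgroupD(1)[OF H(1)]] W(3)[OF h] W(3)[OF is_subgroupD(1)[OF H(1)]] W0 by simp
      then have "norm (W h y - 1) * norm (T (e (\<kappa> y)) y) \<le> c y * modulus (e (\<kappa> y)) h * norm (T (e (\<kappa> y)) y)"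
        by (rule mult_right_mono) simp
      then show ?thesis using nz[OF y] by (simp add: c_def)
    qed
    show "AE y in N. y \<in> Z \<longrightarrow> W g y * T (e (\<kappa> y)) y = T (shift g (e (\<kappa> y))) y" for g
      using W(4)[of g] by eventually_elim (auto simp: u_def v_def nz)
  qed
qed

text \<open>
  Both \<open>T f \<cdot> T (e n) = T (f \<star> e n)\<close> and the product of \<open>\<integral>f W\<close> with \<open>T (e n)\<close> are limits of the same sums
  \<open>\<Sum> a\<^sub>z W\<^sub>z T (e n)\<close>, taken over partitions into pieces on which both the translates of \<open>e n\<close>
  and the homomorphisms \<open>W\<close> vary little. Countably many partitions suffice, so one null set is excluded.
\<close>

lemma pointwise_fourier:
  obtains \<theta> where "\<And>y. \<theta> y \<in> characters \<union> {\<lambda>_. 0}" "\<And>f. integrable M f \<Longrightarrow> AE y in N. T f y = fourier M f (\<theta> y)"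
proof -
  obtain e :: "nat \<Rightarrow> 'a \<Rightarrow> complex" where e: "\<And>n. e n \<in> {f. integrable M f}"
    and cover: "\<And>f. f \<in> {f. integrable M f} \<Longrightarrow> AE y in N. y \<in> {y\<in>space N. T f y \<noteq> 0} \<longrightarrow> (\<exists>n. y \<in> {y\<in>space N. T (e n) y \<noteq> 0})"
  proof (rule N.essential_countable_cover[of "{f. integrable M f}" "\<lambda>f. {y\<in>space N. T f y \<noteq> 0}" "\<lambda>_. 0"])
    show "{y \<in> space N. T f y \<noteq> 0} \<in> sets N" if "f \<in> {f. integrable M f}" for f
    proof -
      have [measurable]: "T f \<in> borel_measurable N" using T_measurable that by simp
      show ?thesis by measurable
    qed
  qed (simp, rule that)
  then have ei: "integrable M (e n)" for n by simp
  define \<kappa> where "\<kappa> y = (LEAST n. T (e n) y \<noteq> 0)" for y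
  have \<kappa>: "T (e (\<kappa> y)) y \<noteq> 0" if "T (e n) y \<noteq> 0" for n y
    unfolding \<kappa>_def using that by (rule LeastI)
  obtain H W Z where H: "open H" "is_subgroup H" and W: "\<And>g y. norm (W g y) = 1" "\<And>g h y. W (g + h) y = W g y * W h y"
    and Z: "\<And>y. y \<in> Z \<Longrightarrow> T (e (\<kappa> y)) y \<noteq> 0" "AE y in N. T (e (\<kappa> y)) y \<noteq> 0 \<longrightarrow> y \<in> Z"
    and lip: "\<And>h y. y \<in> Z \<Longrightarrow> h \<in> H \<Longrightarrow> norm (W h y - 1) * norm (T (e (\<kappa> y)) y) \<le> C * modulus (e (\<kappa> y)) h"
    and rep: "\<And>g. AE y in N. y \<in> Z \<longrightarrow> W g y * T (e (\<kappa> y)) y = T (shift g (e (\<kappa> y))) y"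
    by (rule exists_pointwise_characters[OF ei, where \<kappa> = \<kappa>], rule that)
  have Wdiff: "norm (W g y - W h y) = norm (W (g - h) y - 1)" for g h y
  proof -
    have "W g y = W h y * W (g - h) y" using W(2)[of h "g - h" y] by simp
    then have "W g y - W h y = W h y * (W (g - h) y - 1)" by (simp add: algebra_simps)
    then show ?thesis using W(1) by (simp add: norm_mult)
  qed
  have chW: "(\<lambda>g. W g y) \<in> characters" if y: "y \<in> Z" for y
  proof (rule charactersI)
    show "continuous_on UNIV (\<lambda>g. W g y)"
    proof (rule continuous_onI_uniform)
      fix \<epsilon> :: real assume \<epsilon>: "0 < \<epsilon>"
      have "0 < \<epsilon> * norm (T (e (\<kappa> y)) y)" using \<epsilon> Z(1)[OF y] by simp
      then obtain d where d: "0 < d" and Cd: "C * d \<le> \<epsilon> * norm (T (e (\<kappa> y)) y)"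
        using small_factor[OF C_nonneg] by metis
      obtain U where U: "open U" "0 \<in> U" "\<And>u. u \<in> U \<Longrightarrow> L1_norm M (\<lambda>x. shift u (e (\<kappa> y)) x - e (\<kappa> y) x) < d"
        using translation_continuous[OF ei d] by metis
      have "norm (W g y - W h y) \<le> \<epsilon>" if "g - h \<in> U \<inter> H" for g h
      proof -
        have "norm (W (g - h) y - 1) * norm (T (e (\<kappa> y)) y) \<le> C * modulus (e (\<kappa> y)) (g - h)"
          using lip[OF y] that by blast
        also have "\<dots> \<le> C * d"
          using U(3)[of "g - h"] that C_nonneg by (intro mult_left_mono) (auto simp: modulus_def)
        finally have "norm (W (g - h) y - 1) * norm (T (e (\<kappa> y)) y) \<le> \<epsilon> * norm (T (e (\<kappa> y)) y)"
          using Cd by linarith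
        then have "norm (W (g - h) y - 1) \<le> \<epsilon>" using Z(1)[OF y] by simp
        then show ?thesis by (simp add: Wdiff)
      qed
      then show "\<exists>U. open U \<and> 0 \<in> U \<and> (\<forall>g h. g - h \<in> U \<longrightarrow> norm (W g y - W h y) \<le> \<epsilon>)"
        using U(1,2) H is_subgroupD(1)[OF H(2)] by (intro exI[of _ "U \<inter> H"]) auto
    qed
  qed (use W in auto)
  define \<theta> where "\<theta> y = (if y \<in> Z then (\<lambda>g. cnj (W g y)) else (\<lambda>_. 0))" for y
  show thesis
  proof (rule that[of \<theta>])
    show "\<theta> y \<in> characters \<union> {\<lambda>_. 0}" for y
      using chW[THEN cnj_character] by (auto simp: \<theta>_def)
    fix f :: "'a \<Rightarrow> complex" assume f: "integrable M f"
    have at_n: "AE y in N. y \<in> Z \<longrightarrow> \<kappa> y = n \<longrightarrow> T f y * T (e n) y = (\<integral>u. f u * W u y \<partial>M) * T (e n) y" for n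
    proof -
      have "\<exists>U. open U \<and> 0 \<in> U \<and> U \<subseteq> H \<and> (\<forall>u\<in>U. modulus (e n) u \<le> inverse (real (Suc k)))" for k
      proof -
        have "0 < inverse (real (Suc k))" by simp
        from translation_continuous[OF ei this, of n] obtain U where "open U" "0 \<in> U"
            "\<And>u. u \<in> U \<Longrightarrow> L1_norm M (\<lambda>x. shift u (e n) x - e n x) < inverse (real (Suc k))" by metis
        then show ?thesis
          using H(1) is_subgroupD(1)[OF H(2)] by (intro exI[of _ "U \<inter> H"]) (auto simp: modulus_def less_imp_le)
      qed
      then obtain U where U: "\<And>k. open (U k)" "\<And>k. 0 \<in> U k" "\<And>k. U k \<subseteq> H" "\<And>k u. u \<in> U k \<Longrightarrow> modulus (e n) u \<le> inverse (real (Suc k))"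
        by metis
      define P where "P k I E \<longleftrightarrow> finite I \<and> (\<forall>z. E z \<in> sets M) \<and> disjoint_family_on E I \<and>
          (\<forall>z u. z \<in> I \<longrightarrow> u \<in> E z \<longrightarrow> u - z \<in> U k) \<and>
          (\<integral>u. norm (f u) * indicator (- (\<Union>z\<in>I. E z)) u \<partial>M) \<le> inverse (real (Suc k))" for k I E
      have "\<exists>I E. P k I E" for k
      proof -
        have pos: "0 < inverse (real (Suc k))" by simp
        show ?thesis
          by (rule small_pieces[OF f U(1,2) pos, of k]) (unfold P_def, blast)
      qed
      then obtain I E where IE: "\<And>k. P k (I k) (E k)" by metis
      have I: "finite (I k)" and E: "E k z \<in> sets M" "disjoint_family_on (E k) (I k)"
          "z \<in> I k \<Longrightarrow> u \<in> E k z \<Longrightarrow> u - z \<in> U k"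
          "(\<integral>u. norm (f u) * indicator (- (\<Union>z\<in>I k. E k z)) u \<partial>M) \<le> inverse (real (Suc k))" for k z u
        using IE[of k] unfolding P_def by simp_all
      \<comment> \<open>One sequence of partitions serves both limits and does not depend on \<open>y\<close>.\<close>
      define a where "a k z = (\<integral>u. f u * indicator (E k z) u \<partial>M)" for k z
      define b where "b k = L1_norm M (e n) * inverse (real (Suc k)) + inverse (real (Suc k)) * L1_norm M f" for k
      have 1: "AE y in N. norm (T f y * T (e n) y - (\<Sum>z\<in>I k. a k z * T (shift z (e n)) y)) \<le> C * b k" for k
      proof -
        have i1: "integrable M (\<lambda>x. \<Sum>z\<in>I k. a k z * shift z (e n) x)"
          using shift_L1(1)[OF ei] by simp
        have "L1_norm M (\<lambda>x. fourier_conv M f (e n) x - (\<Sum>z\<in>I k. a k z * shift z (e n) x))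
            \<le> L1_norm M (e n) * (\<integral>u. norm (f u) * indicator (- (\<Union>z\<in>I k. E k z)) u \<partial>M) + inverse (real (Suc k)) * L1_norm M f"
          unfolding a_def
          using U(4)[of _ k] E(1,2)[of k] E(3)[of _ k]
          by (intro fourier_conv_step_approx[OF f ei I]) (auto simp: modulus_def)
        also have "\<dots> \<le> b k"
          unfolding b_def using E(4)[of k] L1_norm_nonneg[of M "e n"] by (intro add_right_mono mult_left_mono)
        finally have le: "L1_norm M (\<lambda>x. fourier_conv M f (e n) x - (\<Sum>z\<in>I k. a k z * shift z (e n) x)) \<le> b k" .
        have sum: "AE y in N. T (\<lambda>x. \<Sum>z\<in>I k. a k z * shift z (e n) x) y = (\<Sum>z\<in>I k. a k z * T (shift z (e n)) y)"
          by (rule T_sum[OF I shift_L1(1)[OF ei]])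
        show ?thesis
          using T_lipschitz[OF fourier_conv_L1(1)[OF f ei[of n]] i1] T_conv[OF f ei[of n]] sum
        proof eventually_elim
          case (elim y)
          then have "norm (T f y * T (e n) y - (\<Sum>z\<in>I k. a k z * T (shift z (e n)) y))
              \<le> C * L1_norm M (\<lambda>x. fourier_conv M f (e n) x - (\<Sum>z\<in>I k. a k z * shift z (e n) x))" by simp
          also have "\<dots> \<le> C * b k" using le C_nonneg by (rule mult_left_mono)
          finally show ?case .
        qed
      qed
      have 2: "AE y in N. \<forall>z\<in>I k. y \<in> Z \<longrightarrow> \<kappa> y = n \<longrightarrow> W z y * T (e n) y = T (shift z (e n)) y" for k
      proof (intro AE_ball_countable' countable_finite I)
        show "AE y in N. y \<in> Z \<longrightarrow> \<kappa> y = n \<longrightarrow> W z y * T (e n) y = T (shift z (e n)) y" for z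
          using rep[of z] by eventually_elim auto
      qed
      have 3: "norm ((\<integral>u. f u * W u y \<partial>M) - (\<Sum>z\<in>I k. a k z * W z y)) * norm (T (e n) y)
          \<le> norm (T (e n) y) * inverse (real (Suc k)) + C * inverse (real (Suc k)) * L1_norm M f" if y: "y \<in> Z" "\<kappa> y = n" for y k
      proof -
        have nz: "T (e n) y \<noteq> 0" using Z(1)[OF y(1)] y(2) by simp
        define d where "d = C * inverse (real (Suc k)) / norm (T (e n) y)"
        have near: "norm (W u y - W z y) \<le> d" if zu: "z \<in> I k" "u \<in> E k z" for z u
        proof -
          have "u - z \<in> U k" by (rule E(3)[OF zu])
          then have "norm (W (u - z) y - 1) * norm (T (e n) y) \<le> C * modulus (e n) (u - z)"
            using lip[OF y(1)] U(3) y(2) by blast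
          also have "\<dots> \<le> C * inverse (real (Suc k))"
            using U(4)[OF \<open>u - z \<in> U k\<close>] C_nonneg by (rule mult_left_mono)
          finally show ?thesis using nz by (simp add: Wdiff d_def pos_le_divide_eq)
        qed
        have "norm ((\<integral>u. f u * W u y \<partial>M) - (\<Sum>z\<in>I k. a k z * W z y))
            \<le> 1 * (\<integral>u. norm (f u) * indicator (- (\<Union>z\<in>I k. E k z)) u \<partial>M) + d * L1_norm M f"
          unfolding a_def
        proof (rule integral_step_approx[OF f _ _ I E(1) E(2) near])
          show "(\<lambda>u. W u y) \<in> borel_measurable M"
            by (rule continuous_borel_measurable[OF charactersD(1)[OF chW[OF y(1)]]])
          show "0 \<le> d" using C_nonneg by (simp add: d_def)
        qed (use W in auto)
        also have "\<dots> \<le> inverse (real (Suc k)) + d * L1_norm M f" using E(4)[of k] by simp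
        finally have "norm ((\<integral>u. f u * W u y \<partial>M) - (\<Sum>z\<in>I k. a k z * W z y)) * norm (T (e n) y)
            \<le> (inverse (real (Suc k)) + d * L1_norm M f) * norm (T (e n) y)"
          by (rule mult_right_mono) simp
        also have "\<dots> = norm (T (e n) y) * inverse (real (Suc k)) + C * inverse (real (Suc k)) * L1_norm M f"
          using nz by (simp add: d_def distrib_right)
        finally show ?thesis .
      qed
      have "AE y in N. \<forall>k. norm (T f y * T (e n) y - (\<Sum>z\<in>I k. a k z * T (shift z (e n)) y)) \<le> C * b k"
        "AE y in N. \<forall>k. \<forall>z\<in>I k. y \<in> Z \<longrightarrow> \<kappa> y = n \<longrightarrow> W z y * T (e n) y = T (shift z (e n)) y"
        by (intro AE_all_countable[THEN iffD2] allI 1 2)+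
      then show ?thesis
      proof eventually_elim
        case (elim y)
        show ?case
        proof (intro impI)
          assume y: "y \<in> Z" "\<kappa> y = n"
          define t where "t = T (e n) y"
          define c where "c k = C * b k + (norm t * inverse (real (Suc k)) + C * inverse (real (Suc k)) * L1_norm M f)" for k
          have "norm (T f y * t - (\<integral>u. f u * W u y \<partial>M) * t) \<le> c k" for k
          proof -
            have "(\<Sum>z\<in>I k. a k z * T (shift z (e n)) y) = (\<Sum>z\<in>I k. a k z * W z y) * t"
              unfolding sum_distrib_right using elim(2) y by (intro sum.cong refl) (simp add: t_def mult.assoc)
            then have "norm (T f y * t - (\<Sum>z\<in>I k. a k z * W z y) * t) \<le> C * b k"
              using elim(1)[rule_format, of k] by (simp add: t_def)
            moreover have "norm ((\<integral>u. f u * W u y \<partial>M) * t - (\<Sum>z\<in>I k. a k z * W z y) * t)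
                \<le> norm t * inverse (real (Suc k)) + C * inverse (real (Suc k)) * L1_norm M f"
              using 3[OF y, of k] by (simp add: t_def norm_mult flip: left_diff_distrib)
            ultimately show ?thesis
              unfolding c_def
              using norm_triangle_ineq4[of "T f y * t - (\<Sum>z\<in>I k. a k z * W z y) * t" "(\<integral>u. f u * W u y \<partial>M) * t - (\<Sum>z\<in>I k. a k z * W z y) * t"]
              by simp
          qed
          moreover have "c \<longlonglongrightarrow> C * (L1_norm M (e n) * 0 + 0 * L1_norm M f) + (norm t * 0 + C * 0 * L1_norm M f)"
            unfolding c_def[abs_def] b_def by (intro tendsto_intros LIMSEQ_inverse_real_of_nat)
          ultimately have "norm (T f y * t - (\<integral>u. f u * W u y \<partial>M) * t) \<le> C * (L1_norm M (e n) * 0 + 0 * L1_norm M f) + (norm t * 0 + C * 0 * L1_norm M f)"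
            using LIMSEQ_le_const[of c] by blast
          then show "T f y * T (e n) y = (\<integral>u. f u * W u y \<partial>M) * T (e n) y" by (simp add: t_def)
        qed
      qed
    qed
    have "AE y in N. \<forall>n. y \<in> Z \<longrightarrow> \<kappa> y = n \<longrightarrow> T f y * T (e n) y = (\<integral>u. f u * W u y \<partial>M) * T (e n) y"
      by (intro AE_all_countable[THEN iffD2] allI at_n)
    with Z(2) cover[of f, simplified, OF f] AE_space show "AE y in N. T f y = fourier M f (\<theta> y)"
    proof eventually_elim
      case (elim y)
      show ?case
      proof (cases "y \<in> Z")
        case True
        then show ?thesis using elim(4)[rule_format, OF True refl] Z(1)[OF True] by (simp add: fourier_def \<theta>_def)
      next
        case False
        then have "T f y = 0" using elim(1-3) \<kappa> by blast
        then show ?thesis using False by (simp add: fourier_def \<theta>_def)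
      qed
    qed
  qed
qed

end

section \<open>Passage to the dual group\<close>

lemma coset_eq:
  assumes "is_subgroup H" "y \<in> (+) a ` H"
  shows "(+) y ` H = (+) a ` H"
proof -
  obtain h where h: "y = a + h" "h \<in> H" using assms(2) by auto
  have "y + k \<in> (+) a ` H" if "k \<in> H" for k
    using is_subgroupD(4)[OF assms(1) h(2) that] h(1) by (auto simp: add.assoc)
  moreover have "a + k \<in> (+) y ` H" if "k \<in> H" for k
    using is_subgroupD(2)[OF assms(1) that h(2)] h(1) by (intro image_eqI[of _ _ "k - h"]) auto
  ultimately show ?thesis by auto
qed

context radon_measure
begin

text \<open>
  Each of the countably many compact sets has an open neighbourhood of finite measure, in which the null set is
  approximated with an error from a geometric series of sum \<open>e\<close>.
\<close>

lemma null_set_outer_approx: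
  fixes K :: "nat \<Rightarrow> 'a set"
  assumes Z: "Z \<in> null_sets M" and X: "open X" "X \<subseteq> (\<Union>n. K n)" "\<And>n. compact (K n)" and e: "0 < e"
  shows "\<exists>U. open U \<and> Z \<inter> X \<subseteq> U \<and> U \<subseteq> X \<and> emeasure M U \<le> ennreal e"
proof -
  have "\<exists>V. open V \<and> Z \<inter> X \<inter> K n \<subseteq> V \<and> V \<subseteq> X \<and> emeasure M V \<le> ennreal (e * (1 / 2) ^ Suc n)" for n
  proof -
    obtain W L where W: "open W" "compact L" "K n \<subseteq> W" "W \<subseteq> L"
      by (rule compact_open_nbhd[OF X(3), of n], rule that)
    have WX: "open (W \<inter> X)" using W(1) X(1) by auto
    have fWX: "W \<inter> X \<in> fmeasurable M"
      using W(4) WX by (intro fmeasurableI2[OF compact_fmeasurable[OF W(2)]]) auto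
    have A: "Z \<inter> X \<inter> W \<in> null_sets M"
      using Z W(1) X(1) by (intro null_set_Int2 null_set_Int1) auto
    have A': "Z \<inter> X \<inter> W \<in> sets borel" using null_setsD2[OF A] by simp
    have pos: "0 < e * (1 / 2) ^ Suc n" using e by simp
    obtain V where V: "open V" "Z \<inter> X \<inter> W \<subseteq> V" "V \<subseteq> W \<inter> X" "measure M (V - (Z \<inter> X \<inter> W)) < e * (1 / 2) ^ Suc n"
      by (rule outer_approx[OF A' _ WX fWX pos]) (auto intro: that)
    have fV: "V \<in> fmeasurable M" using V(1,3) by (intro fmeasurableI2[OF fWX]) auto
    have "emeasure M V = emeasure M (V - (Z \<inter> X \<inter> W))"
      using emeasure_Diff_null_set[OF A, of V] V(1) by simp
    also have "\<dots> = ennreal (measure M (V - (Z \<inter> X \<inter> W)))"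
      using fV A' by (intro emeasure_eq_measure2 fmeasurable_Diff) auto
    also have "\<dots> \<le> ennreal (e * (1 / 2) ^ Suc n)"
      using V(4) by (intro ennreal_leI) simp
    finally show ?thesis using V(1-3) W(3) by blast
  qed
  then obtain V where V: "\<And>n. open (V n)" "\<And>n. Z \<inter> X \<inter> K n \<subseteq> V n" "\<And>n. V n \<subseteq> X"
      "\<And>n. emeasure M (V n) \<le> ennreal (e * (1 / 2) ^ Suc n)"
    by metis
  have "emeasure M (\<Union>n. V n) \<le> (\<Sum>n. emeasure M (V n))"
    using V(1) by (intro emeasure_subadditive_countably) auto
  also have "\<dots> \<le> (\<Sum>n. ennreal (e * (1 / 2) ^ Suc n))"
    by (intro suminf_le V(4)) auto
  also have "\<dots> = ennreal (\<Sum>n. e * (1 / 2) ^ Suc n)"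
    using e sums_summable[OF sums_mult[OF power_half_series, of e]] by (intro suminf_ennreal2) auto
  also have "(\<Sum>n. e * (1 / 2) ^ Suc n) = e"
    using sums_unique[OF sums_mult[OF power_half_series, of e]] by simp
  finally have "emeasure M (\<Union>n. V n) \<le> ennreal e" .
  moreover have "Z \<inter> X \<subseteq> (\<Union>n. V n)"
  proof
    fix x assume x: "x \<in> Z \<inter> X"
    then obtain n where "x \<in> K n" using X(2) by blast
    then show "x \<in> (\<Union>n. V n)" using V(2)[of n] x by blast
  qed
  moreover have "open (\<Union>n. V n)" "(\<Union>n. V n) \<subseteq> X" using V(1,3) by auto
  ultimately show ?thesis by blast
qed

text \<open>
  The exceptional set in each coset is covered by open sets of arbitrarily small measure. Over all cosets these
  form a countable intersection of open sets, hence a Borel set, although the union of uncountably many exceptional null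
  sets need not be one. A compact subset of it meets finitely many cosets and is null, and
  inner regularity makes the whole set null.
\<close>

lemma AE_from_cosets:
  fixes H :: "'a set" and K :: "nat \<Rightarrow> 'a set"
  assumes H: "is_subgroup H" "open H" "H = (\<Union>n. K n)" "\<And>n. compact (K n)"
    and P: "\<And>a. AE y in M. y \<in> (+) a ` H \<longrightarrow> P y"
  shows "AE y in M. P y"
proof -
  define \<X> where "\<X> = range (\<lambda>a. (+) a ` H)"
  have X_open: "open X" if "X \<in> \<X>" for X
    using that open_translate[OF H(2)] by (auto simp: \<X>_def)
  have X_eq: "X = (+) y ` H" if X: "X \<in> \<X>" and y: "y \<in> X" for X y
  proof -
    obtain a where a: "X = (+) a ` H" using X by (auto simp: \<X>_def)
    then show ?thesis using coset_eq[OF H(1), of y a] y by simp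
  qed
  have y_X: "y \<in> (+) y ` H" "(+) y ` H \<in> \<X>" for y
    using is_subgroupD(1)[OF H(1)] by (auto simp: \<X>_def intro!: image_eqI[of _ _ 0])
  have "\<exists>U. open U \<and> {y \<in> X. \<not> P y} \<subseteq> U \<and> U \<subseteq> X \<and> emeasure M U \<le> ennreal (inverse (real (Suc n)))" if X: "X \<in> \<X>" for X and n :: nat
  proof -
    obtain a where a: "X = (+) a ` H" using X by (auto simp: \<X>_def)
    obtain Z where Z: "Z \<in> null_sets M" "{y \<in> space M. \<not> (y \<in> (+) a ` H \<longrightarrow> P y)} \<subseteq> Z"
      using P[of a] by (auto simp: eventually_ae_filter)
    have pos: "0 < inverse (real (Suc n))" by simp
    have "X \<subseteq> (\<Union>n. (+) a ` K n)" using a H(3) by auto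
    from null_set_outer_approx[OF Z(1) X_open[OF X] this compact_translate[OF H(4)] pos]
    obtain U where "open U" "Z \<inter> X \<subseteq> U" "U \<subseteq> X" "emeasure M U \<le> ennreal (inverse (real (Suc n)))" by blast
    then show ?thesis using Z(2) a by (intro exI[of _ U]) auto
  qed
  then have "\<forall>X n. \<exists>U. X \<in> \<X> \<longrightarrow> open U \<and> {y \<in> X. \<not> P y} \<subseteq> U \<and> U \<subseteq> X \<and> emeasure M U \<le> ennreal (inverse (real (Suc n)))"
    by blast
  then obtain U where "\<forall>X n. X \<in> \<X> \<longrightarrow> open (U X n) \<and> {y \<in> X. \<not> P y} \<subseteq> U X n \<and> U X n \<subseteq> X \<and> emeasure M (U X n) \<le> ennreal (inverse (real (Suc n)))"
    by metis
  then have U: "\<And>X n. X \<in> \<X> \<Longrightarrow> open (U X n)" "\<And>X n. X \<in> \<X> \<Longrightarrow> {y \<in> X. \<not> P y} \<subseteq> U X n"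
      "\<And>X n. X \<in> \<X> \<Longrightarrow> U X n \<subseteq> X" "\<And>X n. X \<in> \<X> \<Longrightarrow> emeasure M (U X n) \<le> ennreal (inverse (real (Suc n)))"
    by simp_all
  define D where "D = (\<Inter>n. \<Union>X\<in>\<X>. U X n)"
  have D: "D \<in> sets borel"
    unfolding D_def using U(1) by (intro sets.countable_INT'' borel_open open_UN) auto
  have DX: "D \<inter> X \<in> null_sets M" if X: "X \<in> \<X>" for X
  proof (rule null_setsI)
    have sub: "D \<inter> X \<subseteq> U X n" for n
    proof
      fix y assume y: "y \<in> D \<inter> X"
      then obtain X' where X': "X' \<in> \<X>" "y \<in> U X' n" by (auto simp: D_def)
      then have "X' = X" using X_eq[OF X'(1), of y] X_eq[OF X, of y] U(3)[OF X'(1)] y by blast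
      then show "y \<in> U X n" using X' by simp
    qed
    have "emeasure M (D \<inter> X) \<le> ennreal (inverse (real (Suc n)))" for n
      using emeasure_mono[OF sub[of n], of M] U(1,4)[OF X, of n] by (metis borel_open order_trans sets_M)
    moreover have "(\<lambda>n. ennreal (inverse (real (Suc n)))) \<longlonglongrightarrow> ennreal 0"
      by (intro tendsto_ennrealI LIMSEQ_inverse_real_of_nat)
    ultimately have "emeasure M (D \<inter> X) \<le> ennreal 0"
      by (intro LIMSEQ_le_const[of "\<lambda>n. ennreal (inverse (real (Suc n)))"]) auto
    then show "emeasure M (D \<inter> X) = 0" by simp
    show "D \<inter> X \<in> sets M" using D X_open[OF X] by auto
  qed
  have "emeasure M C \<le> 0" if C: "compact C" "C \<subseteq> D" for C
  proof -
    obtain F where F: "F \<subseteq> \<X>" "finite F" "C \<subseteq> \<Union>F"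
    proof (rule compactE[OF C(1), of \<X>])
      show "C \<subseteq> \<Union>\<X>" using y_X by blast
      show "open X" if "X \<in> \<X>" for X by (rule X_open[OF that])
    qed (rule that)
    have "(\<Union>X\<in>F. D \<inter> X) \<in> null_sets M"
      using F(1,2) DX by (intro null_sets.finite_UN) auto
    moreover have "C \<subseteq> (\<Union>X\<in>F. D \<inter> X)" using C(2) F(3) by auto
    ultimately have "emeasure M C \<le> emeasure M (\<Union>X\<in>F. D \<inter> X)" "emeasure M (\<Union>X\<in>F. D \<inter> X) = 0"
      by (auto intro!: emeasure_mono)
    then show ?thesis by simp
  qed
  then have "emeasure M D \<le> 0"
    unfolding inner_regular[OF D] by (intro SUP_least) simp
  then have "D \<in> null_sets M" using D by (intro null_setsI) auto
  moreover have "{y \<in> space M. \<not> P y} \<subseteq> D"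
  proof
    fix y assume "y \<in> {y \<in> space M. \<not> P y}"
    then have "y \<in> U ((+) y ` H) n" for n using U(2)[OF y_X(2)] y_X(1) by blast
    then show "y \<in> D" using y_X(2) by (auto simp: D_def)
  qed
  ultimately show ?thesis by (rule AE_I')
qed

lemma sigma_finite_on_coset:
  fixes H :: "'a set" and K :: "nat \<Rightarrow> 'a set"
  assumes H: "open H" "H = (\<Union>n. K n)" "\<And>n. compact (K n)"
  shows "sigma_finite_measure (density M (indicator ((+) a ` H)))"
proof
  let ?X = "(+) a ` H"
  have X: "?X \<in> sets M" using open_translate[OF H(1)] by simp
  have em: "emeasure (density M (indicator ?X)) B = emeasure M (?X \<inter> B)" if "B \<in> sets M" for B
  proof -
    have "emeasure (density M (indicator ?X)) B = (\<integral>\<^sup>+y. indicator ?X y * indicator B y \<partial>M)"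
      by (rule emeasure_density[OF borel_measurable_indicator[OF X] that])
    also have "\<dots> = (\<integral>\<^sup>+y. indicator (?X \<inter> B) y \<partial>M)"
      by (simp only: indicator_inter_arith)
    also have "\<dots> = emeasure M (?X \<inter> B)"
      using X that by (intro nn_integral_indicator) auto
    finally show ?thesis .
  qed
  have K: "(+) a ` K n \<in> fmeasurable M" for n
    by (rule compact_fmeasurable[OF compact_translate[OF H(3)]])
  show "\<exists>A. countable A \<and> A \<subseteq> sets (density M (indicator ?X)) \<and> \<Union>A = space (density M (indicator ?X)) \<and>
      (\<forall>B\<in>A. emeasure (density M (indicator ?X)) B \<noteq> \<infinity>)"
  proof (intro exI[of _ "insert (- ?X) (range (\<lambda>n. (+) a ` K n))"] conjI ballI)
    show "insert (- ?X) (range (\<lambda>n. (+) a ` K n)) \<subseteq> sets (density M (indicator ?X))"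
      using X K by (auto simp: fmeasurable_def)
    show "\<Union>(insert (- ?X) (range (\<lambda>n. (+) a ` K n))) = space (density M (indicator ?X))"
      using H(2) by auto
    fix B assume "B \<in> insert (- ?X) (range (\<lambda>n. (+) a ` K n))"
    then consider "B = - ?X" | n where "B = (+) a ` K n" by auto
    then show "emeasure (density M (indicator ?X)) B \<noteq> \<infinity>"
    proof cases
      case 1
      then show ?thesis using X by (subst em) auto
    next
      case (2 n)
      then have "?X \<inter> B = (+) a ` K n" using H(2) by auto
      then show ?thesis using K[of n] 2 by (subst em) (auto simp: fmeasurable_def)
    qed
  qed simp
qed

end

lemma haar_measure_radon:
  fixes M :: "'a::{topological_ab_group_add, t2_space} measure"
  assumes "haar_measure M" "\<exists>U C. open U \<and> (0::'a) \<in> U \<and> U \<subseteq> C \<and> compact C"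
  shows "radon_measure M"
proof
  note h = assms(1)[unfolded haar_measure_def]
  show "sets M = sets borel" using h by simp
  show "emeasure M K < \<infinity>" if "compact K" for K using h that by simp
  show "emeasure M A = (SUP K\<in>{K. compact K \<and> K \<subseteq> A}. emeasure M K)" if "A \<in> sets borel" for A
    using h that by blast
qed (rule assms(2))

lemma haar_measure_haar:
  fixes M :: "'a::{topological_ab_group_add, t2_space} measure"
  assumes "haar_measure M" "\<exists>U C. open U \<and> (0::'a) \<in> U \<and> U \<subseteq> C \<and> compact C"
  shows "haar M"
proof -
  interpret radon_measure M by (rule haar_measure_radon[OF assms])
  note h = assms(1)[unfolded haar_measure_def]
  show ?thesis
  proof
    show "emeasure M UNIV \<noteq> 0" by (rule h[THEN conjunct2, THEN conjunct1])
    show "emeasure M ((\<lambda>x. a + x) ` A) = emeasure M A" if "A \<in> sets borel" for a A using h that by blast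
  qed
qed

text \<open>
  On each coset of an open sigma-compact subgroup the measure \<open>\<nu>\<close> is sigma-finite, so a map into the characters exists
  there. The maps on the different cosets together form \<open>\<theta>\<close>.
\<close>

lemma exists_fourier_symbol:
  fixes \<mu> :: "'a::{topological_ab_group_add, t2_space} measure"
    and \<nu> :: "'b::{topological_ab_group_add, t2_space} measure"
  assumes \<mu>: "haar \<mu>" and \<nu>: "radon_measure \<nu>"
    and T: "bounded_linear_L1_Linf \<mu> \<nu> T" "fourier_conv_property \<mu> \<nu> T"
  obtains \<theta> where "\<And>y. \<theta> y \<in> characters \<union> {\<lambda>_. 0}"
    "\<And>f. integrable \<mu> f \<Longrightarrow> AE y in \<nu>. T f y = fourier \<mu> f (\<theta> y)"
proof -
  interpret \<mu>: haar \<mu> by (rule \<mu>)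
  interpret \<nu>: radon_measure \<nu> by (rule \<nu>)
  obtain U C0 where U: "open U" "(0::'b) \<in> U" "U \<subseteq> C0" "compact C0"
    using \<nu>.locally_compact by blast
  obtain H and K :: "nat \<Rightarrow> 'b set" where H: "is_subgroup H" "open H" "\<And>n. compact (K n)" "H = (\<Union>n. K n)"
    by (rule sigma_compact_open_subgroup[OF U], rule that)
  obtain C1 where C1: "\<And>f. integrable \<mu> f \<Longrightarrow> Linf_norm \<nu> (T f) \<le> ennreal (C1 * L1_norm \<mu> f)"
    using T(1) unfolding bounded_linear_L1_Linf_def L1_def by blast
  define C where "C = max 0 C1"
  have C: "0 \<le> C" by (simp add: C_def)
  have meas: "T f \<in> borel_measurable \<nu>" if "integrable \<mu> f" for f
    using T(1) that by (auto simp: bounded_linear_L1_Linf_def L1_def Linf_def)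
  have bound: "AE y in \<nu>. norm (T f y) \<le> C * L1_norm \<mu> f" if f: "integrable \<mu> f" for f
    using esssup_AE[of "\<lambda>y. ennreal (norm (T f y))" \<nu>]
  proof eventually_elim
    case (elim y)
    have "ennreal (norm (T f y)) \<le> ennreal (C1 * L1_norm \<mu> f)"
      using elim C1[OF f] by (simp add: Linf_norm_def)
    also have "\<dots> \<le> ennreal (C * L1_norm \<mu> f)"
      by (intro ennreal_leI mult_right_mono L1_norm_nonneg) (simp add: C_def)
    finally show ?case using C L1_norm_nonneg[of \<mu> f] by simp
  qed
  have add: "AE y in \<nu>. T (\<lambda>x. f x + g x) y = T f y + T g y" if "integrable \<mu> f" "integrable \<mu> g" for f g
    using T(1) that by (simp add: bounded_linear_L1_Linf_def L1_def)
  have scale: "AE y in \<nu>. T (\<lambda>x. c * f x) y = c * T f y" if "integrable \<mu> f" for c f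
    using T(1) that by (simp add: bounded_linear_L1_Linf_def L1_def)
  have conv: "AE y in \<nu>. T (fourier_conv \<mu> f g) y = T f y * T g y" if "integrable \<mu> f" "integrable \<mu> g" for f g
    using T(2) that by (simp add: fourier_conv_property_def L1_def)
  have "\<exists>\<theta>. (\<forall>y. \<theta> y \<in> characters \<union> {\<lambda>_. 0}) \<and>
      (\<forall>f. integrable \<mu> f \<longrightarrow> (AE y in \<nu>. y \<in> (+) a ` H \<longrightarrow> T f y = fourier \<mu> f (\<theta> y)))" for a
  proof -
    define N where "N = density \<nu> (indicator ((+) a ` H))"
    have AE_N: "(AE y in N. P y) \<longleftrightarrow> (AE y in \<nu>. y \<in> (+) a ` H \<longrightarrow> P y)" for P
    proof -
      have X: "(+) a ` H \<in> sets \<nu>" using open_translate[OF H(2), of a] by simp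
      have "(AE y in N. P y) \<longleftrightarrow> (AE y in \<nu>. 0 < (indicator ((+) a ` H) y :: ennreal) \<longrightarrow> P y)"
        unfolding N_def by (rule AE_density[OF borel_measurable_indicator[OF X]])
      moreover have "0 < (indicator ((+) a ` H) y :: ennreal) \<longleftrightarrow> y \<in> (+) a ` H" for y
        by (simp add: indicator_def)
      ultimately show ?thesis by simp
    qed
    have weaken: "AE y in N. P y" if "AE y in \<nu>. P y" for P
      unfolding AE_N using that by eventually_elim simp
    interpret N: sigma_finite_measure N
      unfolding N_def by (rule \<nu>.sigma_finite_on_coset[OF H(2,4,3)])
    interpret conv_homomorphism \<mu> N T C
    proof
      show "T f \<in> borel_measurable N" if "integrable \<mu> f" for f
        using meas[OF that] by (simp add: N_def)
    qed (use C in \<open>auto intro: weaken bound add scale conv\<close>)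
    obtain \<theta> where "\<And>y. \<theta> y \<in> characters \<union> {\<lambda>_. 0}" "\<And>f. integrable \<mu> f \<Longrightarrow> AE y in N. T f y = fourier \<mu> f (\<theta> y)"
      by (rule pointwise_fourier, rule that)
    then show ?thesis unfolding AE_N by blast
  qed
  then have "\<forall>X. \<exists>\<theta>. X \<in> range (\<lambda>a. (+) a ` H) \<longrightarrow> (\<forall>y. \<theta> y \<in> characters \<union> {\<lambda>_. 0}) \<and>
      (\<forall>f. integrable \<mu> f \<longrightarrow> (AE y in \<nu>. y \<in> X \<longrightarrow> T f y = fourier \<mu> f (\<theta> y)))"
    by blast
  from choice[OF this] obtain \<Theta> where "\<forall>X. X \<in> range (\<lambda>a. (+) a ` H) \<longrightarrow> (\<forall>y. \<Theta> X y \<in> characters \<union> {\<lambda>_. 0}) \<and>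
      (\<forall>f. integrable \<mu> f \<longrightarrow> (AE y in \<nu>. y \<in> X \<longrightarrow> T f y = fourier \<mu> f (\<Theta> X y)))"
    by (elim exE)
  note \<Theta>' = this[rule_format, OF rangeI]
  note \<Theta> = \<Theta>'[THEN conjunct1, rule_format] \<Theta>'[THEN conjunct2, rule_format]
  show thesis
  proof (rule that[of "\<lambda>y. \<Theta> ((+) y ` H) y"])
    show "\<Theta> ((+) y ` H) y \<in> characters \<union> {\<lambda>_. 0}" for y by (rule \<Theta>(1))
    fix f :: "'a \<Rightarrow> complex" assume f: "integrable \<mu> f"
    show "AE y in \<nu>. T f y = fourier \<mu> f (\<Theta> ((+) y ` H) y)"
    proof (rule \<nu>.AE_from_cosets[OF H(1,2,4,3)])
      fix a
      show "AE y in \<nu>. y \<in> (+) a ` H \<longrightarrow> T f y = fourier \<mu> f (\<Theta> ((+) y ` H) y)"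
        using \<Theta>(2)[OF f, of a] by eventually_elim (metis coset_eq[OF H(1)])
    qed
  qed
qed

lemma pointwise_representativesI:
  assumes "\<And>f. integrable M f \<Longrightarrow> AE y in N. R f y = T f y" "\<And>y. multiplicative_functional M (\<lambda>f. R f y)"
  shows "pointwise_representatives M N T R"
  unfolding pointwise_representatives_def L1_def
proof (intro conjI ballI allI impI, unfold mem_Collect_eq)
  show "AE y in N. R f y = T f y" if "integrable M f" for f by (rule assms(1)[OF that])
  note m = multiplicative_functionalD[OF assms(2)]
  show "R f y = R g y" if "integrable M f" "integrable M g" "AE x in M. f x = g x" for f g y
    by (rule m(1)[OF that])
  show "R (\<lambda>x. f x + g x) y = R f y + R g y" if "integrable M f" "integrable M g" for f g y
    by (rule m(2)[OF that])
  show "R (\<lambda>x. c * f x) y = c * R f y" if "integrable M f" for f c y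
    by (rule m(3)[OF that])
  show "R (fourier_conv M f g) y = R f y * R g y" if "integrable M f" "integrable M g" for f g y
    by (rule m(4)[OF that])
qed

lemma pointwise_representatives_multiplicative:
  assumes "pointwise_representatives M N T R"
  shows "multiplicative_functional M (\<lambda>f. R f y)"
proof -
  have L1: "f \<in> L1 M" if "integrable M f" for f using that by (simp add: L1_def)
  note h = assms[unfolded pointwise_representatives_def, THEN conjunct2]
  note h1 = h[THEN conjunct1] and h' = h[THEN conjunct2]
  note h2 = h'[THEN conjunct1] and h'' = h'[THEN conjunct2]
  note h3 = h''[THEN conjunct1] and h4 = h''[THEN conjunct2]
  show ?thesis
    unfolding multiplicative_functional_def
  proof (intro conjI allI impI)
    show "R f y = R g y" if "integrable M f" "integrable M g" "AE x in M. f x = g x" for f g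
      by (rule h1[rule_format, OF L1 L1]) (fact that)+
    show "R (\<lambda>x. f x + g x) y = R f y + R g y" if "integrable M f" "integrable M g" for f g
      by (rule h2[rule_format, OF L1 L1]) (fact that)+
    show "R (\<lambda>x. c * f x) y = c * R f y" if "integrable M f" for c f
      by (rule h3[rule_format, OF L1]) (fact that)
    show "R (fourier_conv M f g) y = R f y * R g y" if "integrable M f" "integrable M g" for f g
      by (rule h4[rule_format, OF L1 L1]) (fact that)+
  qed
qed

theorem theorem2:
  fixes \<mu> :: "'a::{topological_ab_group_add, t2_space} measure"
    and \<nu> :: "'a dual measure"
    and T :: "('a \<Rightarrow> complex) \<Rightarrow> ('a dual \<Rightarrow> complex)"
  assumes "locally_compact_space (euclidean :: 'a topology)"
    and "haar_measure \<mu>"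
    and "haar_measure \<nu>"
    and "bounded_linear_L1_Linf \<mu> \<nu> T"
    and "fourier_conv_property \<mu> \<nu> T"
  shows "(\<exists>R. pointwise_representatives \<mu> \<nu> T R) \<and>
    (\<forall>R. pointwise_representatives \<mu> \<nu> T R \<longrightarrow>
      (\<exists>\<theta> :: 'a dual \<Rightarrow> ('a \<Rightarrow> complex).
        (\<forall>\<phi>. \<theta> \<phi> \<in> characters \<union> {\<lambda>_. 0}) \<and>
        (\<forall>f\<in>L1 \<mu>. R f = fourier \<mu> f \<circ> \<theta>) \<and>
        (\<forall>\<phi>. \<theta> \<phi> = (\<lambda>_. 0) \<longleftrightarrow> (\<forall>f\<in>L1 \<mu>. R f \<phi> = 0))))"
proof -
  have "\<forall>x::'a. \<exists>U. open U \<and> (\<exists>K. compact K \<and> x \<in> U \<and> U \<subseteq> K)"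
    using assms(1) by (simp add: locally_compact_space_def)
  from this[rule_format, of 0] obtain U K where UK: "open U" "(0::'a) \<in> U" "U \<subseteq> K" "compact K"
    by blast
  have \<mu>: "haar \<mu>" using UK by (intro haar_measure_haar[OF assms(2)]) blast
  have \<nu>: "radon_measure \<nu>" by (rule haar_measure_radon[OF assms(3) dual_locally_compact[OF UK]])
  interpret haar \<mu> by (rule \<mu>)
  obtain \<theta> where \<theta>: "\<And>y. \<theta> y \<in> characters \<union> {\<lambda>_. 0}"
      "\<And>f. integrable \<mu> f \<Longrightarrow> AE y in \<nu>. T f y = fourier \<mu> f (\<theta> y)"
    by (rule exists_fourier_symbol[OF \<mu> \<nu> assms(4,5)], rule that)
  have "AE y in \<nu>. fourier \<mu> f (\<theta> y) = T f y" if "integrable \<mu> f" for f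
    using \<theta>(2)[OF that] by eventually_elim simp
  then have "pointwise_representatives \<mu> \<nu> T (\<lambda>f y. fourier \<mu> f (\<theta> y))"
    using fourier_multiplicative[OF \<theta>(1)] by (rule pointwise_representativesI)
  moreover have "\<exists>\<theta> :: 'a dual \<Rightarrow> ('a \<Rightarrow> complex). (\<forall>\<phi>. \<theta> \<phi> \<in> characters \<union> {\<lambda>_. 0}) \<and>
      (\<forall>f\<in>L1 \<mu>. R f = fourier \<mu> f \<circ> \<theta>) \<and> (\<forall>\<phi>. \<theta> \<phi> = (\<lambda>_. 0) \<longleftrightarrow> (\<forall>f\<in>L1 \<mu>. R f \<phi> = 0))"
    if R: "pointwise_representatives \<mu> \<nu> T R" for R
  proof -
    define P where "P \<phi> \<xi> \<longleftrightarrow> \<xi> \<in> characters \<union> {\<lambda>_. 0} \<and> (\<forall>f. integrable \<mu> f \<longrightarrow> R f \<phi> = fourier \<mu> f \<xi>) \<and>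
        (\<xi> = (\<lambda>_. 0) \<longleftrightarrow> (\<forall>f. integrable \<mu> f \<longrightarrow> R f \<phi> = 0))" for \<phi> \<xi>
    have "\<exists>\<xi>. P \<phi> \<xi>" for \<phi>
      unfolding P_def
      by (rule multiplicative_functional_cases[OF pointwise_representatives_multiplicative[OF R, of \<phi>]])
        (intro exI conjI allI impI; assumption)
    then obtain \<theta> where \<theta>: "\<And>\<phi>. P \<phi> (\<theta> \<phi>)" by metis
    show ?thesis
    proof (intro exI[of _ \<theta>] conjI allI ballI)
      fix \<phi>
      note \<theta>' = \<theta>[of \<phi>, unfolded P_def]
      show "\<theta> \<phi> \<in> characters \<union> {\<lambda>_. 0}" by (rule \<theta>'[THEN conjunct1])
      show "\<theta> \<phi> = (\<lambda>_. 0) \<longleftrightarrow> (\<forall>f\<in>L1 \<mu>. R f \<phi> = 0)"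
        unfolding L1_def mem_Collect_eq Ball_def by (rule \<theta>'[THEN conjunct2, THEN conjunct2])
    next
      show "R f = fourier \<mu> f \<circ> \<theta>" if "f \<in> L1 \<mu>" for f
        using \<theta> that by (simp add: P_def L1_def fun_eq_iff)
    qed
  qed
  ultimately show ?thesis by blast
qed

end
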